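(* Let $(G,+)$ be a finitely generated abelian group, $G = F \times H$, where $F = \prod_{i=1}^{n} \langle z_i \rangle$ is torsion-free of rank $n$, and $H = \prod_{i=1}^{m} \langle x_i \rangle$ is a finite $2$-group with $|x_1| \ge |x_2| \ge \dots \ge |x_m| > 1$. (1) The groups $G$ such that $|\mathcal{H}(G)| = |T(G)| = 4$ are the following: - $n = 0$, $m \ge 2$, $|x_1| > 4$, $|x_1| > |x_2|$, and $|x_2| > |x_3|$ if $m > 2$; - $n = 1$, $m \ge 1$, $|x_1| \ge 4$, and either $m = 1$, or $m > 1$ and $|x_1| > |x_2|$. (2) The groups $G$ such that $|\mathcal{H}(G)| = |T(G)| = 2$ are the following: - $n = 0$, $m = 1$, $|x_1| > 4$; - $n = 0$, $m = 2$, $|x_1| = 4$, $|x_2| = 2$; - $n = 0$, $m > 2$, $|x_1| > 4$, $|x_1| > |x_2|$, $|x_2| = |x_3|$; - $n = 0$, $m \ge 2$, $|x_1| = |x_2| > 4$, and $|x_2| > |x_3|$ if $m > 2$; - $n = 1$, $|x_1| = |x_2| = \dots = |x_k| \ge 4$ for some $k$ with $2 \le k \le m$, and $|x_k| > |x_{k+1}|$ if $k < m$; - $n = 1$, $m = 1$, $|x_1| = 2$; - $n = 2$, $m \ge 1$, and $|x_1| > |x_2|$ if $m > 1$. (3) For all other groups $G$ we have $|\mathcal{H}(G)| = |T(G)| = 1$.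
   Context: $S(G)$ is the group of all permutations of the set $G$, $\rho : G \to S(G)$, $\rho(g) : x \mapsto x + g$, is the regular representation, and $\mathrm{Hol}(G) = N_{S(G)}(\rho(G))$. A subgroup of $S(G)$ is regular if it acts regularly (sharply transitively) on $G$. One sets $\mathcal{H}(G) = \{ N \le S(G) : N \text{ is regular}, N \cong G \text{ and } N_{S(G)}(N) = \mathrm{Hol}(G) \}$ and $T(G) = N_{S(G)}(\mathrm{Hol}(G)) / \mathrm{Hol}(G)$. Products of groups are direct products. *)

theory Defs
  imports "HOL-Algebra.Algebra"
begin

text \<open>Groups are written multiplicatively, and \<open>S(G)\<close> is \<^term>\<open>BijGroup (carrier G)\<close>.\<close>

definition regular_rep :: "('a, 'b) monoid_scheme \<Rightarrow> 'a \<Rightarrow> ('a \<Rightarrow> 'a)" where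
  "regular_rep G g = (\<lambda>x\<in>carrier G. x \<otimes>\<^bsub>G\<^esub> g)"

definition Hol :: "('a, 'b) monoid_scheme \<Rightarrow> ('a \<Rightarrow> 'a) set" where
  "Hol G = normalizer (BijGroup (carrier G)) (regular_rep G ` carrier G)"

definition regular_subgroup :: "'a set \<Rightarrow> ('a \<Rightarrow> 'a) set \<Rightarrow> bool" where
  "regular_subgroup S N \<longleftrightarrow>
     subgroup N (BijGroup S) \<and> (\<forall>x\<in>S. \<forall>y\<in>S. \<exists>!f. f \<in> N \<and> f x = y)"

definition HH :: "('a, 'b) monoid_scheme \<Rightarrow> ('a \<Rightarrow> 'a) set set" where
  "HH G = {N. regular_subgroup (carrier G) N \<and>
              (BijGroup (carrier G))\<lparr>carrier := N\<rparr> \<cong> G \<and>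
              normalizer (BijGroup (carrier G)) N = Hol G}"

definition TT :: "('a, 'b) monoid_scheme \<Rightarrow> ('a \<Rightarrow> 'a) set monoid" where
  "TT G = (BijGroup (carrier G))
            \<lparr>carrier := normalizer (BijGroup (carrier G)) (Hol G)\<rparr> Mod Hol G"

text \<open>The subgroup \<open>A\<close> of \<open>G\<close> is the internal direct product of the cyclic subgroups
  generated by the \<open>g i\<close>, for \<open>i\<close> in the finite set \<open>I\<close>.\<close>

definition direct_product_of_cyclics ::
    "('a, 'b) monoid_scheme \<Rightarrow> 'a set \<Rightarrow> 'i set \<Rightarrow> ('i \<Rightarrow> 'a) \<Rightarrow> bool" where
  "direct_product_of_cyclics G A I g \<longleftrightarrow>
     subgroup A G \<and> g ` I \<subseteq> A \<and>
     (\<lambda>f. finprod G f I) \<in>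
       iso (product_group I (\<lambda>i. subgroup_generated G {g i})) (subgroup_generated G A)"

text \<open>In the following two lists \<open>d i\<close> stands for the order of \<open>x\<^sub>i\<close>; it is
  only meaningful for \<open>1 \<le> i \<le> m\<close>.\<close>

definition list_of_four :: "nat \<Rightarrow> nat \<Rightarrow> (nat \<Rightarrow> nat) \<Rightarrow> bool" where
  "list_of_four n m d \<longleftrightarrow>
     (n = 0 \<and> m \<ge> 2 \<and> d 1 > 4 \<and> d 1 > d 2 \<and> (m > 2 \<longrightarrow> d 2 > d 3)) \<or>
     (n = 1 \<and> m \<ge> 1 \<and> d 1 \<ge> 4 \<and> (m = 1 \<or> (m > 1 \<and> d 1 > d 2)))"

definition list_of_two :: "nat \<Rightarrow> nat \<Rightarrow> (nat \<Rightarrow> nat) \<Rightarrow> bool" where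
  "list_of_two n m d \<longleftrightarrow>
     (n = 0 \<and> m = 1 \<and> d 1 > 4) \<or>
     (n = 0 \<and> m = 2 \<and> d 1 = 4 \<and> d 2 = 2) \<or>
     (n = 0 \<and> m > 2 \<and> d 1 > 4 \<and> d 1 > d 2 \<and> d 2 = d 3) \<or>
     (n = 0 \<and> m \<ge> 2 \<and> d 1 = d 2 \<and> d 2 > 4 \<and> (m > 2 \<longrightarrow> d 2 > d 3)) \<or>
     (n = 1 \<and> (\<exists>k. 2 \<le> k \<and> k \<le> m \<and> (\<forall>i\<in>{1..k}. d i = d 1) \<and> d 1 \<ge> 4 \<and>
                     (k < m \<longrightarrow> d k > d (k + 1)))) \<or>
     (n = 1 \<and> m = 1 \<and> d 1 = 2) \<or>
     (n = 2 \<and> m \<ge> 1 \<and> (m > 1 \<longrightarrow> d 1 > d 2))"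

end

theory Submission
  imports Defs
begin

text \<open>
  Both cardinalities agree because the normalizer \<open>NHol G\<close> of the holomorph acts transitively on
  \<open>HH G\<close> by conjugation, with \<open>Hol G\<close> as the stabilizer of the group of translations. It remains to
  determine \<open>HH G\<close>, and this is a problem about bilinear forms over the field with two elements.

  A member \<open>N\<close> of \<open>HH G\<close> consists of affine maps \<open>x \<mapsto> x \<otimes> B x g \<otimes> g\<close>. The function \<open>B\<close> is a commutative and
  associative product on the abelian group \<open>G\<close> for which every automorphism of \<open>G\<close> is a ring
  automorphism. Inversion is such an automorphism, so all products are of order at most two; and the
  linear parts of the elements of \<open>N\<close> are such automorphisms, so all triple products are trivial
  (\<open>HH_imp_invariant_product\<close>). Thus \<open>B\<close> amounts to an invariant symmetric bilinear map from \<open>G\<close> modulo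
  squares to the subgroup of involutions.

  Conversely, suppose that an invariant form \<open>B\<close> has a quadratic refinement \<open>q\<close>, that is
  \<open>q (x \<otimes> y) = q x \<otimes> q y \<otimes> B x y\<close>, and that \<open>B\<close> and \<open>q\<close> take values in a characteristic elementary abelian
  2-subgroup that lies in the radical of \<open>B\<close> and on which \<open>q\<close> vanishes. Then
  \<open>x \<mapsto> x \<otimes> q x\<close> is an involution that normalizes the holomorph, and it conjugates the translations to the regular subgroup belonging to \<open>B\<close> (\<open>circ_set_in_HH\<close>).

  Take a basis \<open>e\<close> of \<open>G\<close>, put first the elements of infinite order and then the others by decreasing
  order, and let \<open>D\<close> be the largest finite order. A product is determined by its values on pairs of
  basis elements, and invariance under transvections is so restrictive that it leaves at most two
  binary parameters. Write \<open>\<chi>\<^sub>i\<close> for the parity of the \<open>i\<close>-th coordinate and \<open>w\<^sub>i\<close> for the involution below a basis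
  element \<open>e i\<close> of order \<open>D\<close>. The candidates that survive are as follows.
  \<^item> For rank zero and only one basis element of order \<open>D\<close>: the form \<open>\<chi>\<^sub>1 \<chi>\<^sub>1 w\<^sub>1\<close>, and also
    \<open>(\<chi>\<^sub>1 \<chi>\<^sub>2 + \<chi>\<^sub>2 \<chi>\<^sub>1) w\<^sub>1\<close> if the second order exists and is not repeated.
  \<^item> For rank zero and exactly two basis elements of order \<open>D\<close>: one product on the plane of the first
    two parities, with values in the span of \<open>w\<^sub>1\<close> and \<open>w\<^sub>2\<close>.
  \<^item> For rank one: the sum of \<open>(\<chi>\<^sub>1 \<chi>\<^sub>i + \<chi>\<^sub>i \<chi>\<^sub>1) w\<^sub>i\<close> over all \<open>e i\<close> of order \<open>D\<close>, and also \<open>\<chi>\<^sub>1 \<chi>\<^sub>1 w\<^sub>2\<close> if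
    only \<open>e 2\<close> has order \<open>D\<close>.
  \<^item> For rank two and only one basis element of order \<open>D\<close>: the form \<open>(\<chi>\<^sub>1 \<chi>\<^sub>2 + \<chi>\<^sub>2 \<chi>\<^sub>1) w\<^sub>3\<close>.

  Two obstructions remain, and they account for the conditions on \<open>D\<close> in the lists. If \<open>D = 2\<close>, then
  \<open>w\<^sub>i = e i\<close> is not a square, and a form that involves both \<open>\<chi>\<^sub>i\<close> and \<open>w\<^sub>i\<close> violates the triviality of
  triple products. If \<open>D = 4\<close> and the rank is zero, a form with a nontrivial diagonal satisfies
  \<open>B x x = x \<otimes> x\<close>, so that the regular subgroup has exponent two and is not isomorphic to \<open>G\<close>. In all other
  cases a refinement exists, built from products of two coordinates and from binomial coefficients.
\<close>

section \<open>Conjugation and normalizers\<close>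

definition conj_set :: "('a, 'b) monoid_scheme \<Rightarrow> 'a \<Rightarrow> 'a set \<Rightarrow> 'a set" where
  "conj_set G a U = (\<lambda>h. a \<otimes>\<^bsub>G\<^esub> h \<otimes>\<^bsub>G\<^esub> inv\<^bsub>G\<^esub> a) ` U"

context group
begin

lemma conj_mult:
  assumes a: "a \<in> carrier G" and x: "x \<in> carrier G" and y: "y \<in> carrier G"
  shows "a \<otimes> (x \<otimes> y) \<otimes> inv a = (a \<otimes> x \<otimes> inv a) \<otimes> (a \<otimes> y \<otimes> inv a)"
proof -
  have "inv a \<otimes> (a \<otimes> y \<otimes> inv a) = y \<otimes> inv a"
    using a y by (simp add: m_assoc[symmetric])
  then show ?thesis using a x y by (simp add: m_assoc)
qed

lemma conj_set_closed:
  assumes "a \<in> carrier G" "U \<subseteq> carrier G"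
  shows "conj_set G a U \<subseteq> carrier G"
  using assms by (auto simp: conj_set_def)

lemma conj_set_mult:
  assumes "a \<in> carrier G" "b \<in> carrier G" "U \<subseteq> carrier G"
  shows "conj_set G a (conj_set G b U) = conj_set G (a \<otimes> b) U"
proof -
  have "a \<otimes> (b \<otimes> h \<otimes> inv b) \<otimes> inv a = a \<otimes> b \<otimes> h \<otimes> inv (a \<otimes> b)" if "h \<in> U" for h
    using assms that by (auto simp: inv_mult_group m_assoc subset_iff)
  then show ?thesis
    unfolding conj_set_def image_image by (intro image_cong) auto
qed

lemma conj_set_one [simp]: "U \<subseteq> carrier G \<Longrightarrow> conj_set G \<one> U = U"
proof -
  assume "U \<subseteq> carrier G"
  then have "\<one> \<otimes> h \<otimes> inv \<one> = h" if "h \<in> U" for h using that by auto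
  then show ?thesis unfolding conj_set_def by simp
qed

lemma conj_set_eq_swap:
  assumes "a \<in> carrier G" "U \<subseteq> carrier G" "Y \<subseteq> carrier G"
  shows "conj_set G a U = Y \<longleftrightarrow> U = conj_set G (inv a) Y"
  using assms conj_set_mult[of a "inv a" Y] conj_set_mult[of "inv a" a U] by auto

lemma normalizer_iff:
  assumes "H \<subseteq> carrier G"
  shows "a \<in> normalizer G H \<longleftrightarrow> a \<in> carrier G \<and> conj_set G a H = H"
proof -
  have "a <# H #> inv a = conj_set G a H"
    by (auto simp: conj_set_def l_coset_def r_coset_def)
  then show ?thesis using assms
    by (auto simp: normalizer_def stabilizer_def)
qed

lemma normalizer_conj_set:
  assumes a: "a \<in> carrier G" and H: "H \<subseteq> carrier G"
  shows "normalizer G (conj_set G a H) = conj_set G a (normalizer G H)"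
proof -
  have sub: "normalizer G H \<subseteq> carrier G" using normalizer_iff[OF H] by auto
  have main: "b \<in> normalizer G (conj_set G a H) \<longleftrightarrow>
      b \<in> carrier G \<and> inv a \<otimes> b \<otimes> a \<in> normalizer G H" for b
  proof (cases "b \<in> carrier G")
    case True
    have "conj_set G b (conj_set G a H) = conj_set G a H \<longleftrightarrow>
        conj_set G (inv a \<otimes> b \<otimes> a) H = H"
      using a H True conj_set_eq_swap[of a H "conj_set G b (conj_set G a H)"]
      by (auto simp: conj_set_mult conj_set_closed m_assoc)
    then show ?thesis
      using True a H by (auto simp: normalizer_iff conj_set_closed)
  qed (use normalizer_iff[of "conj_set G a H"] a H in \<open>auto simp: conj_set_closed\<close>)
  show ?thesis
  proof (intro equalityI subsetI)
    fix b assume "b \<in> normalizer G (conj_set G a H)"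
    then have b: "b \<in> carrier G" "inv a \<otimes> b \<otimes> a \<in> normalizer G H" using main by auto
    have "b = a \<otimes> (inv a \<otimes> b \<otimes> a) \<otimes> inv a"
      using a b(1) by (metis inv_closed l_one m_assoc m_closed r_inv r_one)
    then show "b \<in> conj_set G a (normalizer G H)" unfolding conj_set_def using b(2) by blast
  next
    fix b assume "b \<in> conj_set G a (normalizer G H)"
    then obtain c where c: "c \<in> normalizer G H" "b = a \<otimes> c \<otimes> inv a" unfolding conj_set_def by blast
    then have cc: "c \<in> carrier G" using sub by auto
    have "inv a \<otimes> b \<otimes> a = c" using a cc c(2)
      by (metis inv_closed inv_solve_right l_inv l_one m_assoc m_closed)
    then show "b \<in> normalizer G (conj_set G a H)" using main c a cc by auto
  qed
qed

end

text \<open>Compares the number of cosets with the size of an orbit, both indexed by the same group,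
  without any finiteness assumption.\<close>

lemma card_image_eq_if_same_fibres:
  assumes "\<And>a b. a \<in> M \<Longrightarrow> b \<in> M \<Longrightarrow> f a = f b \<longleftrightarrow> g a = g b"
  shows "card (f ` M) = card (g ` M)"
proof -
  have "bij_betw (\<lambda>y. g (inv_into M f y)) (f ` M) (g ` M)"
    unfolding bij_betw_def
  proof (intro conjI inj_onI)
    fix y z assume y: "y \<in> f ` M" and z: "z \<in> f ` M"
      and "g (inv_into M f y) = g (inv_into M f z)"
    then have "f (inv_into M f y) = f (inv_into M f z)"
      using assms by (simp add: inv_into_into)
    then show "y = z" using y z by (simp add: f_inv_into_f)
  next
    have "g (inv_into M f (f a)) = g a" if "a \<in> M" for a
      using that assms[of "inv_into M f (f a)" a] by (simp add: inv_into_into f_inv_into_f)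
    then show "(\<lambda>y. g (inv_into M f y)) ` f ` M = g ` M"
      unfolding image_image by (intro image_cong) auto
  qed
  then show ?thesis by (rule bij_betw_same_card)
qed

section \<open>The multiple holomorph and its orbit\<close>

abbreviation Sym where "Sym G \<equiv> BijGroup (carrier G)"

definition Reg :: "('a, 'b) monoid_scheme \<Rightarrow> ('a \<Rightarrow> 'a) set" where
  "Reg G = regular_rep G ` carrier G"

text \<open>The normalizer of the holomorph; its quotient by \<open>Hol G\<close> is \<open>TT G\<close>.\<close>

definition NHol :: "('a, 'b) monoid_scheme \<Rightarrow> ('a \<Rightarrow> 'a) set" where
  "NHol G = normalizer (Sym G) (Hol G)"

lemma Sym_mult: "f \<in> Bij S \<Longrightarrow> g \<in> Bij S \<Longrightarrow> f \<otimes>\<^bsub>BijGroup S\<^esub> g = compose S f g"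
  by (simp add: BijGroup_def)

lemma Sym_carrier [simp]: "carrier (BijGroup S) = Bij S"
  by (simp add: BijGroup_def)

lemma Sym_one: "\<one>\<^bsub>BijGroup S\<^esub> = (\<lambda>x\<in>S. x)"
  by (simp add: BijGroup_def)

lemma Bij_apply: "f \<in> Bij S \<Longrightarrow> x \<in> S \<Longrightarrow> f x \<in> S"
  using Bij_imp_funcset by blast

lemma Bij_eqI: "f \<in> Bij S \<Longrightarrow> g \<in> Bij S \<Longrightarrow> (\<And>x. x \<in> S \<Longrightarrow> f x = g x) \<Longrightarrow> f = g"
  by (meson Bij_imp_extensional extensionalityI)

lemma Bij_inj: "f \<in> Bij S \<Longrightarrow> x \<in> S \<Longrightarrow> y \<in> S \<Longrightarrow> f x = f y \<Longrightarrow> x = y"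
  by (auto simp: Bij_def bij_betw_def dest: inj_onD)

lemma Bij_surj: "f \<in> Bij S \<Longrightarrow> y \<in> S \<Longrightarrow> \<exists>x\<in>S. f x = y"
  by (force simp: Bij_def bij_betw_def)

lemma BijI: "f \<in> extensional S \<Longrightarrow> (\<And>x. x \<in> S \<Longrightarrow> f x \<in> S) \<Longrightarrow>
   (\<And>x y. x \<in> S \<Longrightarrow> y \<in> S \<Longrightarrow> f x = f y \<Longrightarrow> x = y) \<Longrightarrow> (\<And>y. y \<in> S \<Longrightarrow> \<exists>x\<in>S. f x = y) \<Longrightarrow> f \<in> Bij S"
  by (force simp: Bij_def bij_betw_def inj_on_def)

lemma (in group) conj_eq_iff:
  assumes "a \<in> carrier G" "h \<in> carrier G" "k \<in> carrier G"
  shows "a \<otimes> h \<otimes> inv a = k \<longleftrightarrow> a \<otimes> h = k \<otimes> a"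
  using assms by (metis inv_solve_right m_closed)

lemma Sym_conj_eq_iff:
  assumes "a \<in> Bij S" "h \<in> Bij S" "k \<in> Bij S"
  shows "a \<otimes>\<^bsub>BijGroup S\<^esub> h \<otimes>\<^bsub>BijGroup S\<^esub> inv\<^bsub>BijGroup S\<^esub> a = k \<longleftrightarrow> (\<forall>x\<in>S. a (h x) = k (a x))"
proof -
  have "a \<otimes>\<^bsub>BijGroup S\<^esub> h \<otimes>\<^bsub>BijGroup S\<^esub> inv\<^bsub>BijGroup S\<^esub> a = k
     \<longleftrightarrow> compose S a h = compose S k a"
    using group.conj_eq_iff[OF group_BijGroup, of a S h k] assms by (simp add: Sym_mult)
  also have "\<dots> \<longleftrightarrow> (\<forall>x\<in>S. a (h x) = k (a x))"
    by (auto simp: compose_def fun_eq_iff)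
  finally show ?thesis .
qed

lemma Bij_conj:
  assumes "a \<in> Bij S" "h \<in> Bij S"
  shows "a \<otimes>\<^bsub>BijGroup S\<^esub> h \<otimes>\<^bsub>BijGroup S\<^esub> inv\<^bsub>BijGroup S\<^esub> a \<in> Bij S"
proof -
  interpret S: group "BijGroup S" by (rule group_BijGroup)
  show ?thesis using assms S.m_closed S.inv_closed by (metis Sym_carrier)
qed

lemma conj_set_Sym_iff:
  assumes "a \<in> Bij S" "U \<subseteq> Bij S"
  shows "k \<in> conj_set (BijGroup S) a U \<longleftrightarrow> k \<in> Bij S \<and> (\<exists>h\<in>U. \<forall>x\<in>S. a (h x) = k (a x))"
proof -
  have "k = a \<otimes>\<^bsub>BijGroup S\<^esub> h \<otimes>\<^bsub>BijGroup S\<^esub> inv\<^bsub>BijGroup S\<^esub> a \<longleftrightarrow> k \<in> Bij S \<and> (\<forall>x\<in>S. a (h x) = k (a x))"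
    if "h \<in> U" for h
  proof (cases "k \<in> Bij S")
    case True
    with Sym_conj_eq_iff[of a S h k] that assms show ?thesis by (metis subsetD)
  next
    case False
    then show ?thesis using Bij_conj[of a S h] that assms by blast
  qed
  then show ?thesis unfolding conj_set_def by blast
qed

context comm_group
begin

lemma regular_rep_apply [simp]: "x \<in> carrier G \<Longrightarrow> regular_rep G g x = x \<otimes> g"
  by (simp add: regular_rep_def)

lemma regular_rep_Bij:
  assumes "g \<in> carrier G" shows "regular_rep G g \<in> Bij (carrier G)"
proof (rule BijI)
  fix y assume y: "y \<in> carrier G"
  then have "y \<otimes> inv g \<otimes> g = y" using assms by (simp add: m_assoc)
  with y show "\<exists>x\<in>carrier G. regular_rep G g x = y"
    using assms by (intro bexI[of _ "y \<otimes> inv g"]) auto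
qed (use assms in \<open>auto simp: regular_rep_def\<close>)

lemma Reg_subset: "Reg G \<subseteq> Bij (carrier G)"
  unfolding Reg_def using regular_rep_Bij by auto

lemma Reg_subgroup: "subgroup (Reg G) (Sym G)"
proof -
  interpret S: group "Sym G" by (rule group_BijGroup)
  show ?thesis
  proof (rule S.subgroupI)
    show "Reg G \<noteq> {}" unfolding Reg_def by auto
    show "Reg G \<subseteq> carrier (Sym G)" using Reg_subset by simp
  next
    fix a assume "a \<in> Reg G"
    then obtain g where g: "g \<in> carrier G" "a = regular_rep G g" by (auto simp: Reg_def)
    have "regular_rep G (inv g) \<otimes>\<^bsub>Sym G\<^esub> a = \<one>\<^bsub>Sym G\<^esub>"
      using g by (auto simp: Sym_mult regular_rep_Bij Sym_one compose_def m_assoc)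
    then have "inv\<^bsub>Sym G\<^esub> a = regular_rep G (inv g)"
      using g by (intro S.inv_equality) (auto simp: regular_rep_Bij)
    then show "inv\<^bsub>Sym G\<^esub> a \<in> Reg G" using g by (auto simp: Reg_def)
  next
    fix a b assume "a \<in> Reg G" "b \<in> Reg G"
    then obtain g h where g: "g \<in> carrier G" "a = regular_rep G g"
      and h: "h \<in> carrier G" "b = regular_rep G h" by (auto simp: Reg_def)
    have "a \<otimes>\<^bsub>Sym G\<^esub> b = regular_rep G (h \<otimes> g)"
      unfolding g(2) h(2) Sym_mult[OF regular_rep_Bij[OF g(1)] regular_rep_Bij[OF h(1)]]
      using g h by (auto simp: compose_def m_assoc regular_rep_def)
    then show "a \<otimes>\<^bsub>Sym G\<^esub> b \<in> Reg G" using g h by (auto simp: Reg_def)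
  qed
qed

lemma Hol_eq: "Hol G = normalizer (Sym G) (Reg G)"
  by (simp add: Hol_def Reg_def)

lemma Hol_subgroup: "subgroup (Hol G) (Sym G)"
  unfolding Hol_eq using group.normalizer_imp_subgroup[OF group_BijGroup] Reg_subset by simp

lemma Hol_subset: "Hol G \<subseteq> Bij (carrier G)"
  using subgroup.subset[OF Hol_subgroup] by simp

lemma NHol_subgroup: "subgroup (NHol G) (Sym G)"
  unfolding NHol_def using group.normalizer_imp_subgroup[OF group_BijGroup] Hol_subset by simp

text \<open>In the abelian case the holomorph consists of the affine bijections, those of the form
  automorphism followed by translation. The equation says this without naming the linear part:
  it makes \<open>f\<close> divided by \<open>f \<one>\<close> multiplicative.\<close>

lemma Hol_iff: "f \<in> Hol G \<longleftrightarrow> f \<in> Bij (carrier G) \<and>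
   (\<forall>x\<in>carrier G. \<forall>y\<in>carrier G. f (x \<otimes> y) \<otimes> f \<one> = f x \<otimes> f y)"
proof (cases "f \<in> Bij (carrier G)")
  case f: True
  have cl: "f x \<in> carrier G" if "x \<in> carrier G" for x using f that by (rule Bij_apply)
  have H: "f \<in> Hol G \<longleftrightarrow> conj_set (Sym G) f (Reg G) = Reg G"
    unfolding Hol_eq using group.normalizer_iff[OF group_BijGroup, of "Reg G" "carrier G" f] f Reg_subset
    by simp
  have mem: "k \<in> conj_set (Sym G) f (Reg G) \<longleftrightarrow>
      k \<in> Bij (carrier G) \<and> (\<exists>g\<in>carrier G. \<forall>x\<in>carrier G. f (x \<otimes> g) = k (f x))" for k
    unfolding conj_set_Sym_iff[OF f Reg_subset] by (auto simp: Reg_def)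
  show ?thesis
  proof
    assume "f \<in> Hol G"
    then have eq: "conj_set (Sym G) f (Reg G) = Reg G" using H by simp
    have "f (x \<otimes> y) \<otimes> f \<one> = f x \<otimes> f y" if x: "x \<in> carrier G" and y: "y \<in> carrier G" for x y
    proof -
      have "regular_rep G y \<in> Reg G" using y by (auto simp: Reg_def)
      define k where "k = f \<otimes>\<^bsub>Sym G\<^esub> regular_rep G y \<otimes>\<^bsub>Sym G\<^esub> inv\<^bsub>Sym G\<^esub> f"
      have kc: "k \<in> conj_set (Sym G) f (Reg G)" unfolding k_def conj_set_def using y by (auto simp: Reg_def)
      have kB: "k \<in> Bij (carrier G)" using mem kc by simp
      have k: "\<forall>x\<in>carrier G. f (regular_rep G y x) = k (f x)"
        using Sym_conj_eq_iff[OF f regular_rep_Bij[OF y] kB] k_def by simp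
      obtain z where z: "z \<in> carrier G" "k = regular_rep G z" using kc eq by (auto simp: Reg_def)
      have "f (u \<otimes> y) = f u \<otimes> z" if "u \<in> carrier G" for u using k y z cl that by auto
      from this[OF x] this[OF one_closed] have "f (x \<otimes> y) = f x \<otimes> z" "f y = f \<one> \<otimes> z" using y by simp_all
      then show ?thesis using x y z(1) cl by (simp add: m_ac)
    qed
    then show "f \<in> Bij (carrier G) \<and>
      (\<forall>x\<in>carrier G. \<forall>y\<in>carrier G. f (x \<otimes> y) \<otimes> f \<one> = f x \<otimes> f y)" using f by simp
  next
    assume "f \<in> Bij (carrier G) \<and>
      (\<forall>x\<in>carrier G. \<forall>y\<in>carrier G. f (x \<otimes> y) \<otimes> f \<one> = f x \<otimes> f y)"
    then have aff: "f (x \<otimes> y) \<otimes> f \<one> = f x \<otimes> f y" if "x \<in> carrier G" "y \<in> carrier G" for x y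
      using that by simp
    have aff': "f (x \<otimes> y) = f x \<otimes> (f y \<otimes> inv f \<one>)" if "x \<in> carrier G" "y \<in> carrier G" for x y
    proof -
      have "f (x \<otimes> y) = f x \<otimes> f y \<otimes> inv f \<one>"
        using inv_solve_right[of "f (x \<otimes> y)" "f x \<otimes> f y" "f \<one>"] aff[OF that] that cl by simp
      then show ?thesis using that cl by (simp add: m_assoc)
    qed
    have "conj_set (Sym G) f (Reg G) = Reg G"
    proof (intro equalityI subsetI)
      fix k assume "k \<in> conj_set (Sym G) f (Reg G)"
      then obtain g where k: "k \<in> Bij (carrier G)" "g \<in> carrier G" "\<forall>x\<in>carrier G. f (x \<otimes> g) = k (f x)"
        using mem by auto
      have "k = regular_rep G (f g \<otimes> inv f \<one>)"
      proof (rule Bij_eqI[OF k(1)])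
        show "regular_rep G (f g \<otimes> inv f \<one>) \<in> Bij (carrier G)" using k cl by (auto intro: regular_rep_Bij)
        fix y assume "y \<in> carrier G"
        then obtain x where x: "x \<in> carrier G" "y = f x" using Bij_surj[OF f] by metis
        then show "k y = regular_rep G (f g \<otimes> inv f \<one>) y" using k aff' cl by simp
      qed
      then show "k \<in> Reg G" unfolding Reg_def using k cl by auto
    next
      fix k assume "k \<in> Reg G"
      then obtain z where z: "z \<in> carrier G" "k = regular_rep G z" by (auto simp: Reg_def)
      obtain g where g: "g \<in> carrier G" "f g = z \<otimes> f \<one>" using Bij_surj[OF f, of "z \<otimes> f \<one>"] z cl by auto
      have "f g \<otimes> inv f \<one> = z" using g z cl by (simp add: m_assoc)
      then have "\<forall>x\<in>carrier G. f (x \<otimes> g) = k (f x)" using aff' g z cl by simp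
      then show "k \<in> conj_set (Sym G) f (Reg G)" unfolding mem using g z regular_rep_Bij by blast
    qed
    then show "f \<in> Hol G" using H by simp
  qed
qed (use Hol_subset in auto)

text \<open>Evaluation at a base point \<open>s\<close> identifies a regular subgroup with the underlying set;
  \<open>\<nu>\<close> is the inverse of this identification.\<close>

lemma regular_subgroup_parametrization:
  assumes "regular_subgroup S N" "s \<in> S"
  obtains \<nu> where "\<And>x. x \<in> S \<Longrightarrow> \<nu> x \<in> N" "\<And>x. x \<in> S \<Longrightarrow> \<nu> x s = x"
    "\<And>f. f \<in> N \<Longrightarrow> \<nu> (f s) = f"
proof
  have sub: "subgroup N (BijGroup S)" and
    ex1: "\<And>x y. x \<in> S \<Longrightarrow> y \<in> S \<Longrightarrow> \<exists>!f. f \<in> N \<and> f x = y"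
    using assms(1) unfolding regular_subgroup_def by auto
  have NB: "N \<subseteq> Bij S" using subgroup.subset[OF sub] by simp
  let ?\<nu> = "\<lambda>x. THE f. f \<in> N \<and> f s = x"
  show "?\<nu> x \<in> N" "?\<nu> x s = x" if "x \<in> S" for x
    using theI'[OF ex1[OF assms(2) that]] by blast+
  show "?\<nu> (f s) = f" if "f \<in> N" for f
  proof -
    have "f s \<in> S" by (rule Bij_apply[OF subsetD[OF NB that] assms(2)])
    from the1_equality[OF ex1[OF assms(2) this], of f] that show ?thesis by blast
  qed
qed

text \<open>Transporting an isomorphism \<open>N \<cong> G\<close> along the identification of \<open>N\<close> with the underlying set
  gives a permutation of \<open>G\<close>, and this permutation carries the action of \<open>N\<close> to translations.\<close>

lemma regular_isomorphic_imp_conjugate: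
  assumes reg: "regular_subgroup (carrier G) N" and iso: "(Sym G)\<lparr>carrier := N\<rparr> \<cong> G"
  shows "\<exists>a \<in> Bij (carrier G). conj_set (Sym G) a N = Reg G"
proof -
  have sub: "subgroup N (Sym G)" using reg unfolding regular_subgroup_def by auto
  have NB: "N \<subseteq> Bij (carrier G)" using subgroup.subset[OF sub] by simp
  obtain \<phi> where "\<phi> \<in> iso ((Sym G)\<lparr>carrier := N\<rparr>) G" using iso by (auto simp: is_iso_def)
  then have \<phi>h: "\<phi> \<in> hom ((Sym G)\<lparr>carrier := N\<rparr>) G" and bij: "bij_betw \<phi> N (carrier G)"
    by (simp_all add: iso_def)
  have hom: "\<phi> (f \<otimes>\<^bsub>Sym G\<^esub> h) = \<phi> f \<otimes> \<phi> h" if "f \<in> N" "h \<in> N" for f h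
    using hom_mult[OF \<phi>h, of f h] that by simp
  have \<phi>surj: "\<exists>f\<in>N. \<phi> f = y" if "y \<in> carrier G" for y
    using that bij_betw_imp_surj_on[OF bij] by (metis imageE)
  have \<phi>cl: "\<phi> f \<in> carrier G" if "f \<in> N" for f using bij_betwE[OF bij] that by simp
  obtain \<nu> where \<nu>': "\<And>x. x \<in> carrier G \<Longrightarrow> \<nu> x \<in> N" "\<And>x. x \<in> carrier G \<Longrightarrow> \<nu> x \<one> = x"
    and \<nu>_eq: "\<And>f. f \<in> N \<Longrightarrow> \<nu> (f \<one>) = f"
    using regular_subgroup_parametrization[OF reg one_closed] by metis
  have \<nu>: "\<nu> x \<in> N \<and> \<nu> x \<one> = x" if "x \<in> carrier G" for x
    using \<nu>'[OF that] by simp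
  define a where "a = (\<lambda>x\<in>carrier G. \<phi> (\<nu> x))"
  have aB: "a \<in> Bij (carrier G)"
  proof (rule BijI)
    show "a \<in> extensional (carrier G)" by (simp add: a_def)
    show "a x \<in> carrier G" if "x \<in> carrier G" for x using that \<phi>cl[of "\<nu> x"] \<nu>[of x] by (simp add: a_def)
    show "x = y" if "x \<in> carrier G" "y \<in> carrier G" "a x = a y" for x y
    proof -
      have "\<phi> (\<nu> x) = \<phi> (\<nu> y)" using that by (simp add: a_def)
      then have "\<nu> x = \<nu> y" using \<nu>[OF that(1)] \<nu>[OF that(2)]
        by (intro inj_onD[OF bij_betw_imp_inj_on[OF bij]]) auto
      then show ?thesis using \<nu>[OF that(1)] \<nu>[OF that(2)] by metis
    qed
    show "\<exists>x\<in>carrier G. a x = y" if "y \<in> carrier G" for y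
    proof -
      obtain f where f: "f \<in> N" "\<phi> f = y" using \<phi>surj[OF \<open>y \<in> carrier G\<close>] by blast
      have "f \<one> \<in> carrier G" using Bij_apply[OF subsetD[OF NB f(1)] one_closed] .
      then show ?thesis using f \<nu>_eq[OF f(1)] by (intro bexI[of _ "f \<one>"]) (simp_all add: a_def)
    qed
  qed
  have inter: "a (f x) = regular_rep G (\<phi> f) (a x)" if f: "f \<in> N" and x: "x \<in> carrier G" for f x
  proof -
    have nx: "\<nu> x \<in> N" "\<nu> x \<one> = x" using \<nu>[OF x] by simp_all
    have fB: "f \<in> Bij (carrier G)" "\<nu> x \<in> Bij (carrier G)" using NB f nx by auto
    have fx: "f x \<in> carrier G" using Bij_apply[OF fB(1) x] .
    have m: "f \<otimes>\<^bsub>Sym G\<^esub> \<nu> x \<in> N" using subgroup.m_closed[OF sub f nx(1)] .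
    have "(f \<otimes>\<^bsub>Sym G\<^esub> \<nu> x) \<one> = f x" using fB nx by (simp add: Sym_mult compose_def)
    then have "\<nu> (f x) = f \<otimes>\<^bsub>Sym G\<^esub> \<nu> x" using \<nu>_eq[OF m] by simp
    then have "a (f x) = \<phi> f \<otimes> \<phi> (\<nu> x)" using hom[OF f nx(1)] fx by (simp add: a_def)
    then show ?thesis using x \<phi>cl[OF f] \<phi>cl[OF nx(1)] by (simp add: a_def m_comm)
  qed
  have "conj_set (Sym G) a N = Reg G"
  proof (intro equalityI subsetI)
    fix k assume "k \<in> conj_set (Sym G) a N"
    then obtain f where k: "k \<in> Bij (carrier G)" "f \<in> N" "\<forall>x\<in>carrier G. a (f x) = k (a x)"
      using conj_set_Sym_iff[OF aB NB] by auto
    have "k = regular_rep G (\<phi> f)"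
    proof (rule Bij_eqI[OF k(1)])
      show "regular_rep G (\<phi> f) \<in> Bij (carrier G)" using \<phi>cl k regular_rep_Bij by auto
      fix y assume "y \<in> carrier G"
      then obtain x where "x \<in> carrier G" "y = a x" using Bij_surj[OF aB] by metis
      then show "k y = regular_rep G (\<phi> f) y" using k(3) inter[OF k(2)] by auto
    qed
    then show "k \<in> Reg G" using \<phi>cl k by (auto simp: Reg_def)
  next
    fix k assume "k \<in> Reg G"
    then obtain z where z: "z \<in> carrier G" "k = regular_rep G z" by (auto simp: Reg_def)
    then obtain f where f: "f \<in> N" "\<phi> f = z" using \<phi>surj by blast
    then show "k \<in> conj_set (Sym G) a N" unfolding conj_set_Sym_iff[OF aB NB]
      using inter[OF f(1)] f z regular_rep_Bij[OF z(1)] by blast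
  qed
  then show ?thesis using aB by blast
qed

lemma regular_subgroup_Reg: "regular_subgroup (carrier G) (Reg G)"
  unfolding regular_subgroup_def
proof (intro conjI ballI Reg_subgroup)
  fix x y assume xy: "x \<in> carrier G" "y \<in> carrier G"
  show "\<exists>!f. f \<in> Reg G \<and> f x = y"
  proof (rule ex1I[of _ "regular_rep G (inv x \<otimes> y)"])
    have "x \<otimes> (inv x \<otimes> y) = y" using xy by (simp add: m_assoc[symmetric])
    then show "regular_rep G (inv x \<otimes> y) \<in> Reg G \<and> regular_rep G (inv x \<otimes> y) x = y"
      using xy by (simp add: Reg_def)
    fix f assume "f \<in> Reg G \<and> f x = y"
    then obtain g where g: "g \<in> carrier G" "f = regular_rep G g" "x \<otimes> g = y"
      using xy by (auto simp: Reg_def)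
    then have "g = inv x \<otimes> y" using xy by (simp add: m_assoc[symmetric] flip: g(3))
    then show "f = regular_rep G (inv x \<otimes> y)" using g by simp
  qed
qed

lemma regular_subgroup_conj:
  assumes a: "a \<in> Bij S" and N: "regular_subgroup S N"
  shows "regular_subgroup S (conj_set (BijGroup S) a N)"
proof -
  interpret S: group "BijGroup S" by (rule group_BijGroup)
  have sub: "subgroup N (BijGroup S)" and
    ex1: "\<And>x y. x \<in> S \<Longrightarrow> y \<in> S \<Longrightarrow> \<exists>!f. f \<in> N \<and> f x = y"
    using N unfolding regular_subgroup_def by auto
  have NB: "N \<subseteq> Bij S" using subgroup.subset[OF sub] by simp
  have "subgroup (conj_set (BijGroup S) a N) (BijGroup S)"
  proof -
    interpret h: group_hom "BijGroup S" "BijGroup S" "\<lambda>h. a \<otimes>\<^bsub>BijGroup S\<^esub> h \<otimes>\<^bsub>BijGroup S\<^esub> inv\<^bsub>BijGroup S\<^esub> a"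
    proof
      show "(\<lambda>h. a \<otimes>\<^bsub>BijGroup S\<^esub> h \<otimes>\<^bsub>BijGroup S\<^esub> inv\<^bsub>BijGroup S\<^esub> a) \<in> hom (BijGroup S) (BijGroup S)"
      proof (rule homI)
        fix x y assume "x \<in> carrier (BijGroup S)" "y \<in> carrier (BijGroup S)"
        then show "a \<otimes>\<^bsub>BijGroup S\<^esub> (x \<otimes>\<^bsub>BijGroup S\<^esub> y) \<otimes>\<^bsub>BijGroup S\<^esub> inv\<^bsub>BijGroup S\<^esub> a =
             a \<otimes>\<^bsub>BijGroup S\<^esub> x \<otimes>\<^bsub>BijGroup S\<^esub> inv\<^bsub>BijGroup S\<^esub> a \<otimes>\<^bsub>BijGroup S\<^esub>
             (a \<otimes>\<^bsub>BijGroup S\<^esub> y \<otimes>\<^bsub>BijGroup S\<^esub> inv\<^bsub>BijGroup S\<^esub> a)"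
          using a S.conj_mult[of a x y] by simp
      qed (use a Bij_conj in auto)
    qed
    show ?thesis unfolding conj_set_def by (rule h.subgroup_img_is_subgroup[OF sub])
  qed
  moreover have "\<exists>!f. f \<in> conj_set (BijGroup S) a N \<and> f x = y" if xy: "x \<in> S" "y \<in> S" for x y
  proof -
    obtain u v where uv: "u \<in> S" "a u = x" "v \<in> S" "a v = y" using Bij_surj[OF a] xy by metis
    obtain f where f: "f \<in> N" "f u = v" using ex1[of u v] uv by auto
    define k where "k = a \<otimes>\<^bsub>BijGroup S\<^esub> f \<otimes>\<^bsub>BijGroup S\<^esub> inv\<^bsub>BijGroup S\<^esub> a"
    have fB: "f \<in> Bij S" using f NB by auto
    have kB: "k \<in> Bij S" unfolding k_def by (rule Bij_conj[OF a fB])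
    have ak: "\<forall>x\<in>S. a (f x) = k (a x)" using Sym_conj_eq_iff[OF a fB kB] k_def by simp
    show ?thesis
    proof (rule ex1I[of _ k])
      show "k \<in> conj_set (BijGroup S) a N \<and> k x = y" using ak uv f by (auto simp: k_def conj_set_def)
      fix k' assume k': "k' \<in> conj_set (BijGroup S) a N \<and> k' x = y"
      then obtain f' where f': "f' \<in> N" "\<forall>x\<in>S. a (f' x) = k' (a x)" "k' \<in> Bij S"
        using conj_set_Sym_iff[OF a NB] by auto
      have "a (f' u) = a v" using f' uv k' by auto
      then have "f' u = v"
        using Bij_inj[OF a] uv Bij_apply[OF subsetD[OF NB f'(1)] uv(1)] by simp
      then have "f' = f" using f' f ex1[of u v] uv by auto
      then have "\<forall>x\<in>S. k' (a x) = k (a x)" using ak f' by auto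
      then show "k' = k" using Bij_eqI[OF f'(3) kB] Bij_surj[OF a] by metis
    qed
  qed
  ultimately show ?thesis unfolding regular_subgroup_def by auto
qed

lemma conj_set_iso:
  assumes a: "a \<in> Bij S" and N: "subgroup N (BijGroup S)"
  shows "(BijGroup S)\<lparr>carrier := N\<rparr> \<cong> (BijGroup S)\<lparr>carrier := conj_set (BijGroup S) a N\<rparr>"
proof -
  interpret S: group "BijGroup S" by (rule group_BijGroup)
  have NB: "N \<subseteq> carrier (BijGroup S)" using subgroup.subset[OF N] by simp
  have ac: "a \<in> carrier (BijGroup S)" using a by simp
  let ?c = "\<lambda>h. a \<otimes>\<^bsub>BijGroup S\<^esub> h \<otimes>\<^bsub>BijGroup S\<^esub> inv\<^bsub>BijGroup S\<^esub> a"
  have "?c \<in> iso ((BijGroup S)\<lparr>carrier := N\<rparr>) ((BijGroup S)\<lparr>carrier := conj_set (BijGroup S) a N\<rparr>)"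
  proof (rule isoI)
    show "?c \<in> hom ((BijGroup S)\<lparr>carrier := N\<rparr>) ((BijGroup S)\<lparr>carrier := conj_set (BijGroup S) a N\<rparr>)"
    proof (rule homI)
      fix x y assume "x \<in> carrier ((BijGroup S)\<lparr>carrier := N\<rparr>)" "y \<in> carrier ((BijGroup S)\<lparr>carrier := N\<rparr>)"
      then have "x \<in> carrier (BijGroup S)" "y \<in> carrier (BijGroup S)" using NB by auto
      then show "?c (x \<otimes>\<^bsub>(BijGroup S)\<lparr>carrier := N\<rparr>\<^esub> y) =
         ?c x \<otimes>\<^bsub>(BijGroup S)\<lparr>carrier := conj_set (BijGroup S) a N\<rparr>\<^esub> ?c y"
        using S.conj_mult[OF ac, of x y] by simp
    qed (auto simp: conj_set_def)
    have "inj_on ?c N"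
    proof (rule inj_onI)
      fix x y assume "x \<in> N" "y \<in> N" and e: "?c x = ?c y"
      then have "x \<in> carrier (BijGroup S)" "y \<in> carrier (BijGroup S)" using NB by auto
      then show "x = y" using e ac S.m_closed S.inv_closed S.l_cancel S.r_cancel by metis
    qed
    then show "bij_betw ?c (carrier ((BijGroup S)\<lparr>carrier := N\<rparr>))
        (carrier ((BijGroup S)\<lparr>carrier := conj_set (BijGroup S) a N\<rparr>))"
      by (simp add: bij_betw_def conj_set_def)
  qed
  then show ?thesis by (auto simp: is_iso_def)
qed

lemma Reg_iso: "(Sym G)\<lparr>carrier := Reg G\<rparr> \<cong> G"
proof -
  have "regular_rep G \<in> iso G ((Sym G)\<lparr>carrier := Reg G\<rparr>)"
  proof (rule isoI)
    show "regular_rep G \<in> hom G ((Sym G)\<lparr>carrier := Reg G\<rparr>)"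
    proof (rule homI)
      fix x y assume "x \<in> carrier G" "y \<in> carrier G"
      then show "regular_rep G (x \<otimes> y) =
          regular_rep G x \<otimes>\<^bsub>(Sym G)\<lparr>carrier := Reg G\<rparr>\<^esub> regular_rep G y"
        using Sym_mult[OF regular_rep_Bij regular_rep_Bij, of x y]
        by (auto simp: compose_def regular_rep_def m_ac)
    qed (auto simp: Reg_def)
    have "inj_on (regular_rep G) (carrier G)"
    proof (rule inj_onI)
      fix x y assume "x \<in> carrier G" "y \<in> carrier G" "regular_rep G x = regular_rep G y"
      then have "regular_rep G x \<one> = regular_rep G y \<one>" by simp
      then show "x = y" using \<open>x \<in> carrier G\<close> \<open>y \<in> carrier G\<close> by simp
    qed
    then show "bij_betw (regular_rep G) (carrier G) (carrier ((Sym G)\<lparr>carrier := Reg G\<rparr>))"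
      by (simp add: bij_betw_def Reg_def)
  qed
  then show ?thesis using iso_sym by (auto simp: is_iso_def)
qed

text \<open>If \<open>a\<close> conjugates \<open>N\<close> to the translations, it conjugates the normalizer of \<open>N\<close> to \<open>Hol G\<close>.
  Hence \<open>N\<close> has normalizer \<open>Hol G\<close> exactly when \<open>a\<close> normalizes \<open>Hol G\<close>.\<close>

lemma HH_eq_orbit: "HH G = (\<lambda>a. conj_set (Sym G) (inv\<^bsub>Sym G\<^esub> a) (Reg G)) ` NHol G"
proof -
  interpret S: group "Sym G" by (rule group_BijGroup)
  have R: "Reg G \<subseteq> carrier (Sym G)" and Hs: "Hol G \<subseteq> carrier (Sym G)" using Reg_subset Hol_subset by auto
  show ?thesis
  proof (intro equalityI subsetI)
    fix N assume "N \<in> HH G"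
    then have N: "regular_subgroup (carrier G) N" "(Sym G)\<lparr>carrier := N\<rparr> \<cong> G"
      "normalizer (Sym G) N = Hol G" unfolding HH_def by auto
    obtain a where a: "a \<in> carrier (Sym G)" and e: "conj_set (Sym G) a N = Reg G"
      using regular_isomorphic_imp_conjugate[OF N(1,2)] by auto
    have NB: "N \<subseteq> carrier (Sym G)"
      using N(1) subgroup.subset unfolding regular_subgroup_def by blast
    have "Hol G = conj_set (Sym G) a (Hol G)"
      using S.normalizer_conj_set[OF a NB] e N(3) Hol_eq by simp
    then have "a \<in> NHol G" unfolding NHol_def using S.normalizer_iff[OF Hs] a by simp
    moreover have "N = conj_set (Sym G) (inv\<^bsub>Sym G\<^esub> a) (Reg G)"
      using S.conj_set_eq_swap[OF a NB R] e by simp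
    ultimately show "N \<in> (\<lambda>a. conj_set (Sym G) (inv\<^bsub>Sym G\<^esub> a) (Reg G)) ` NHol G" by blast
  next
    fix N assume "N \<in> (\<lambda>a. conj_set (Sym G) (inv\<^bsub>Sym G\<^esub> a) (Reg G)) ` NHol G"
    then obtain a where aN: "a \<in> NHol G" and Neq: "N = conj_set (Sym G) (inv\<^bsub>Sym G\<^esub> a) (Reg G)" by blast
    define b where "b = inv\<^bsub>Sym G\<^esub> a"
    have bN: "b \<in> NHol G" unfolding b_def using subgroup.m_inv_closed[OF NHol_subgroup] aN by simp
    have b: "b \<in> carrier (Sym G)" using bN NHol_subgroup subgroup.subset by blast
    have "conj_set (Sym G) b (Hol G) = Hol G"
      using bN unfolding NHol_def using S.normalizer_iff[OF Hs] by simp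
    then have "normalizer (Sym G) N = Hol G"
      using S.normalizer_conj_set[OF b R] Hol_eq Neq b_def by simp
    moreover have "regular_subgroup (carrier G) N"
      using regular_subgroup_conj[OF _ regular_subgroup_Reg] b Neq b_def by auto
    moreover have "(Sym G)\<lparr>carrier := N\<rparr> \<cong> G"
    proof -
      have "(Sym G)\<lparr>carrier := Reg G\<rparr> \<cong> (Sym G)\<lparr>carrier := N\<rparr>"
        unfolding Neq b_def[symmetric] by (rule conj_set_iso) (use b Reg_subgroup in auto)
      then have "(Sym G)\<lparr>carrier := N\<rparr> \<cong> (Sym G)\<lparr>carrier := Reg G\<rparr>"
        using group.iso_sym[OF S.subgroup_imp_group[OF Reg_subgroup]] by blast
      then show ?thesis using Reg_iso iso_trans by blast
    qed
    ultimately show "N \<in> HH G" unfolding HH_def by simp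
  qed
qed

text \<open>The group \<open>NHol G\<close> acts transitively on \<open>HH G\<close>, and \<open>Hol G\<close> is the stabilizer of the
  translations.\<close>

theorem card_HH_eq_order_TT: "card (HH G) = order (TT G)"
proof -
  interpret S: group "Sym G" by (rule group_BijGroup)
  have R: "Reg G \<subseteq> carrier (Sym G)" and Hs: "Hol G \<subseteq> carrier (Sym G)" using Reg_subset Hol_subset by auto
  have "carrier (TT G) = (\<lambda>a. Hol G #>\<^bsub>Sym G\<^esub> a) ` NHol G"
    by (auto simp: TT_def FactGroup_def RCOSETS_def NHol_def r_coset_def)
  moreover have "card ((\<lambda>a. Hol G #>\<^bsub>Sym G\<^esub> a) ` NHol G) = card (HH G)"
    unfolding HH_eq_orbit
  proof (rule card_image_eq_if_same_fibres)
    fix a b assume "a \<in> NHol G" "b \<in> NHol G"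
    then have a: "a \<in> carrier (Sym G)" and b: "b \<in> carrier (Sym G)"
      using NHol_subgroup subgroup.subset by blast+
    have "Hol G #>\<^bsub>Sym G\<^esub> a = Hol G #>\<^bsub>Sym G\<^esub> b \<longleftrightarrow> b \<in> Hol G #>\<^bsub>Sym G\<^esub> a"
      using a b S.repr_independence[OF _ a Hol_subgroup] S.repr_independenceD[OF Hol_subgroup b] by metis
    also have "\<dots> \<longleftrightarrow> b \<otimes>\<^bsub>Sym G\<^esub> inv\<^bsub>Sym G\<^esub> a \<in> Hol G"
      using subgroup.rcos_module[OF Hol_subgroup S.is_group a b] .
    also have "\<dots> \<longleftrightarrow> conj_set (Sym G) (b \<otimes>\<^bsub>Sym G\<^esub> inv\<^bsub>Sym G\<^esub> a) (Reg G) = Reg G"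
      unfolding Hol_eq using S.normalizer_iff[OF R] a b by (simp del: Sym_carrier)
    also have "\<dots> \<longleftrightarrow> conj_set (Sym G) b (conj_set (Sym G) (inv\<^bsub>Sym G\<^esub> a) (Reg G)) = Reg G"
      using S.conj_set_mult[OF b S.inv_closed[OF a] R] by simp
    also have "\<dots> \<longleftrightarrow> conj_set (Sym G) (inv\<^bsub>Sym G\<^esub> a) (Reg G) = conj_set (Sym G) (inv\<^bsub>Sym G\<^esub> b) (Reg G)"
      by (rule S.conj_set_eq_swap[OF b S.conj_set_closed[OF S.inv_closed[OF a] R] R])
    finally show "Hol G #>\<^bsub>Sym G\<^esub> a = Hol G #>\<^bsub>Sym G\<^esub> b \<longleftrightarrow>
      conj_set (Sym G) (inv\<^bsub>Sym G\<^esub> a) (Reg G) = conj_set (Sym G) (inv\<^bsub>Sym G\<^esub> b) (Reg G)" .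
  qed
  ultimately show ?thesis unfolding order_def by simp
qed

end

section \<open>Invariant products and quadratic refinements\<close>

text \<open>When \<open>B\<close> is the product of a commutative nilpotent ring on \<open>G\<close>, this is the translation by \<open>g\<close> for
  the circle operation of that ring.\<close>

definition circ :: "('a, 'b) monoid_scheme \<Rightarrow> ('a \<Rightarrow> 'a \<Rightarrow> 'a) \<Rightarrow> 'a \<Rightarrow> 'a \<Rightarrow> 'a" where
  "circ G B g = (\<lambda>x\<in>carrier G. x \<otimes>\<^bsub>G\<^esub> B x g \<otimes>\<^bsub>G\<^esub> g)"

definition circ_set :: "('a, 'b) monoid_scheme \<Rightarrow> ('a \<Rightarrow> 'a \<Rightarrow> 'a) \<Rightarrow> ('a \<Rightarrow> 'a) set" where
  "circ_set G B = circ G B ` carrier G"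

text \<open>The ring structures that describe members of \<open>HH G\<close>: every automorphism of the additive
  structure preserves the product, and all products of three elements vanish.\<close>

locale invariant_product = comm_group G for G :: "('a, 'b) monoid_scheme" (structure) +
  fixes B :: "'a \<Rightarrow> 'a \<Rightarrow> 'a"
  assumes B_closed [simp]: "x \<in> carrier G \<Longrightarrow> y \<in> carrier G \<Longrightarrow> B x y \<in> carrier G"
    and B_sym: "x \<in> carrier G \<Longrightarrow> y \<in> carrier G \<Longrightarrow> B x y = B y x"
    and B_mult: "x \<in> carrier G \<Longrightarrow> y \<in> carrier G \<Longrightarrow> w \<in> carrier G \<Longrightarrow> B (x \<otimes> y) w = B x w \<otimes> B y w"
    and B_aut: "\<alpha> \<in> iso G G \<Longrightarrow> x \<in> carrier G \<Longrightarrow> y \<in> carrier G \<Longrightarrow> B (\<alpha> x) (\<alpha> y) = \<alpha> (B x y)"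
    and B_sq: "x \<in> carrier G \<Longrightarrow> y \<in> carrier G \<Longrightarrow> B x y \<otimes> B x y = \<one>"
    and B_nil: "x \<in> carrier G \<Longrightarrow> y \<in> carrier G \<Longrightarrow> w \<in> carrier G \<Longrightarrow> B x (B y w) = \<one>"

text \<open>A biadditive form \<open>B\<close> with a quadratic refinement \<open>q\<close>. Both take values in an elementary abelian
  2-subgroup \<open>Z\<close> and are insensitive to translation by \<open>Z\<close>, which makes iterated expressions
  such as \<open>q (x \<otimes> q x)\<close> collapse.\<close>

locale polar_pair = comm_group G for G :: "('a, 'b) monoid_scheme" (structure) +
  fixes Z :: "'a set" and B :: "'a \<Rightarrow> 'a \<Rightarrow> 'a" and q :: "'a \<Rightarrow> 'a"
  assumes Z_sub: "subgroup Z G"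
    and Z_sq: "z \<in> Z \<Longrightarrow> z \<otimes> z = \<one>"
    and B_in: "x \<in> carrier G \<Longrightarrow> y \<in> carrier G \<Longrightarrow> B x y \<in> Z"
    and q_in: "x \<in> carrier G \<Longrightarrow> q x \<in> Z"
    and B_sym: "x \<in> carrier G \<Longrightarrow> y \<in> carrier G \<Longrightarrow> B x y = B y x"
    and B_mult: "x \<in> carrier G \<Longrightarrow> y \<in> carrier G \<Longrightarrow> w \<in> carrier G \<Longrightarrow> B (x \<otimes> y) w = B x w \<otimes> B y w"
    and B_Z: "x \<in> carrier G \<Longrightarrow> z \<in> Z \<Longrightarrow> B x z = \<one>"
    and q_mult: "x \<in> carrier G \<Longrightarrow> y \<in> carrier G \<Longrightarrow> q (x \<otimes> y) = q x \<otimes> q y \<otimes> B x y"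
    and q_Z: "z \<in> Z \<Longrightarrow> q z = \<one>"

locale quadratic_datum = polar_pair G Z B q for G :: "('a, 'b) monoid_scheme" (structure) and Z B q +
  assumes Z_char: "\<alpha> \<in> iso G G \<Longrightarrow> z \<in> Z \<Longrightarrow> \<alpha> z \<in> Z"
    and B_aut: "\<alpha> \<in> iso G G \<Longrightarrow> x \<in> carrier G \<Longrightarrow> y \<in> carrier G \<Longrightarrow> B (\<alpha> x) (\<alpha> y) = \<alpha> (B x y)"

context comm_group
begin

lemma cancel_left: "c \<otimes> a = c \<otimes> b \<Longrightarrow> a \<in> carrier G \<Longrightarrow> b \<in> carrier G \<Longrightarrow> c \<in> carrier G \<Longrightarrow> a = b"
  by simp

lemma conj_Reg_in_HH:
  assumes "a \<in> NHol G" shows "conj_set (Sym G) a (Reg G) \<in> HH G"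
proof -
  interpret S: group "Sym G" by (rule group_BijGroup)
  have "inv\<^bsub>Sym G\<^esub> a \<in> NHol G" using subgroup.m_inv_closed[OF NHol_subgroup assms] .
  moreover have "a \<in> carrier (Sym G)" using assms NHol_subgroup subgroup.subset by blast
  ultimately show ?thesis unfolding HH_eq_orbit
    by (intro image_eqI[of _ _ "inv\<^bsub>Sym G\<^esub> a"]) (simp_all del: Sym_carrier)
qed

lemma Hol_decomp:
  assumes f: "f \<in> Hol G"
  shows "\<exists>\<alpha>\<in>iso G G. \<forall>x\<in>carrier G. f x = \<alpha> x \<otimes> f \<one>"
proof -
  have fB: "f \<in> Bij (carrier G)" using f by (simp add: Hol_iff)
  have aff: "f (x \<otimes> y) \<otimes> f \<one> = f x \<otimes> f y" if "x \<in> carrier G" "y \<in> carrier G" for x y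
    using f that by (auto simp: Hol_iff)
  have cl: "f x \<in> carrier G" if "x \<in> carrier G" for x by (rule Bij_apply[OF fB that])
  have iso: "(\<lambda>x. f x \<otimes> inv f \<one>) \<in> iso G G"
  proof (rule isoI)
    show "(\<lambda>x. f x \<otimes> inv f \<one>) \<in> hom G G"
    proof (rule homI)
      fix x y assume x: "x \<in> carrier G" and y: "y \<in> carrier G"
      have "f (x \<otimes> y) \<otimes> inv f \<one> = (f (x \<otimes> y) \<otimes> f \<one>) \<otimes> (inv f \<one> \<otimes> inv f \<one>)"
        using cl x y by (simp add: m_assoc[of "f (x \<otimes> y)"] m_assoc[symmetric, of "f \<one>"])
      also have "\<dots> = f x \<otimes> inv f \<one> \<otimes> (f y \<otimes> inv f \<one>)"
        unfolding aff[OF x y] using cl x y by (simp add: m_ac)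
      finally show "f (x \<otimes> y) \<otimes> inv f \<one> = f x \<otimes> inv f \<one> \<otimes> (f y \<otimes> inv f \<one>)" .
    qed (use cl in simp)
    show "bij_betw (\<lambda>x. f x \<otimes> inv f \<one>) (carrier G) (carrier G)"
    proof (rule bij_betw_imageI)
      show "inj_on (\<lambda>x. f x \<otimes> inv f \<one>) (carrier G)"
      proof (rule inj_onI)
        fix x y assume xy: "x \<in> carrier G" "y \<in> carrier G" "f x \<otimes> inv f \<one> = f y \<otimes> inv f \<one>"
        then have "f x = f y" using cl by simp
        then show "x = y" using Bij_inj[OF fB] xy by simp
      qed
      show "(\<lambda>x. f x \<otimes> inv f \<one>) ` carrier G = carrier G"
      proof (intro equalityI subsetI)
        fix y assume y: "y \<in> carrier G"
        obtain x where x: "x \<in> carrier G" "f x = y \<otimes> f \<one>"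
          using Bij_surj[OF fB, of "y \<otimes> f \<one>"] y cl by auto
        then have "y = f x \<otimes> inv f \<one>" using y cl by (simp add: m_assoc)
        then show "y \<in> (\<lambda>x. f x \<otimes> inv f \<one>) ` carrier G" using x by blast
      qed (use cl in auto)
    qed
  qed
  have "f x = f x \<otimes> inv f \<one> \<otimes> f \<one>" if "x \<in> carrier G" for x
    using cl that by (simp add: m_assoc)
  then show ?thesis by (intro bexI[OF _ iso] ballI)
qed

lemma iso_restrict_Hol:
  assumes "\<alpha> \<in> iso G G" shows "restrict \<alpha> (carrier G) \<in> Hol G"
proof -
  have h: "\<alpha> \<in> hom G G" and b: "bij_betw \<alpha> (carrier G) (carrier G)" using assms by (auto simp: iso_def)
  have "restrict \<alpha> (carrier G) \<in> Bij (carrier G)"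
    using b by (auto simp: Bij_def)
  moreover have "\<alpha> \<one> = \<one>" using h hom_one[OF h is_group is_group] by simp
  ultimately show ?thesis unfolding Hol_iff using h by (auto simp: hom_mult hom_in_carrier)
qed

lemma inv_iso: "(\<lambda>x. inv x) \<in> iso G G"
proof (rule isoI)
  show "bij_betw (\<lambda>x. inv x) (carrier G) (carrier G)"
    by (rule bij_betw_byWitness[where f' = "\<lambda>x. inv x"]) auto
qed (auto intro!: homI simp: inv_mult)

text \<open>Every \<open>N\<close> in \<open>HH G\<close> normalizes itself, hence lies in \<open>Hol G\<close>, so its elements \<open>\<nu> g\<close> are affine and
  \<open>B x g = \<nu> g x \<otimes> inv x \<otimes> inv g\<close> is additive in \<open>x\<close>. Commutativity of \<open>N\<close> gives symmetry,
  closure under composition gives associativity, and the fact that the automorphisms of \<open>G\<close> normalize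
  \<open>N\<close> gives their compatibility with \<open>B\<close>. The remaining two properties come from applying this
  compatibility to two particular automorphisms: inversion shows \<open>B x y \<otimes> B x y = \<one>\<close>, and
  \<open>x \<mapsto> x \<otimes> B x h\<close>, the linear part of \<open>\<nu> h\<close>, shows that triple products are trivial.\<close>

lemma HH_imp_invariant_product:
  assumes N: "N \<in> HH G"
  shows "\<exists>B. N = circ_set G B \<and> invariant_product G B"
proof -
  interpret S: group "Sym G" by (rule group_BijGroup)
  have reg: "regular_subgroup (carrier G) N" and iso: "(Sym G)\<lparr>carrier := N\<rparr> \<cong> G"
    and norm: "normalizer (Sym G) N = Hol G" using N by (auto simp: HH_def)
  have sub: "subgroup N (Sym G)" using reg unfolding regular_subgroup_def by auto
  have NB: "N \<subseteq> Bij (carrier G)" using subgroup.subset[OF sub] by simp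
  have NHol: "N \<subseteq> Hol G"
    using subgroup.subset[OF normal_imp_subgroup[OF S.subgroup_in_normalizer[OF sub]]] norm by simp
  obtain \<nu> where \<nu>N: "\<And>x. x \<in> carrier G \<Longrightarrow> \<nu> x \<in> N" and \<nu>1: "\<And>x. x \<in> carrier G \<Longrightarrow> \<nu> x \<one> = x"
    and \<nu>_eq: "\<And>f. f \<in> N \<Longrightarrow> \<nu> (f \<one>) = f"
    using regular_subgroup_parametrization[OF reg one_closed] by metis
  have \<nu>_uniq: "f = \<nu> x" if "f \<in> N" "f \<one> = x" for f x
    using \<nu>_eq[OF that(1)] that(2) by simp
  have \<nu>cl: "\<nu> g x \<in> carrier G" if "g \<in> carrier G" "x \<in> carrier G" for g x
    by (rule Bij_apply[OF subsetD[OF NB \<nu>N[OF that(1)]] that(2)])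
  have comp: "f \<otimes>\<^bsub>Sym G\<^esub> h \<in> N" "(f \<otimes>\<^bsub>Sym G\<^esub> h) x = f (h x)"
    if "f \<in> N" "h \<in> N" "x \<in> carrier G" for f h x
    using subgroup.m_closed[OF sub that(1,2)] that NB by (auto simp: Sym_mult subsetD compose_def)
  obtain \<phi> where \<phi>: "\<phi> \<in> iso ((Sym G)\<lparr>carrier := N\<rparr>) G" using iso by (auto simp: is_iso_def)
  have \<phi>h: "\<phi> \<in> hom ((Sym G)\<lparr>carrier := N\<rparr>) G" and \<phi>b: "bij_betw \<phi> N (carrier G)"
    using \<phi> by (simp_all add: iso_def)
  have Ncomm: "f (h x) = h (f x)" if f: "f \<in> N" and h: "h \<in> N" and x: "x \<in> carrier G" for f h x
  proof -
    have cl: "\<phi> f \<in> carrier G" "\<phi> h \<in> carrier G" using f h bij_betwE[OF \<phi>b] by auto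
    have "\<phi> (f \<otimes>\<^bsub>Sym G\<^esub> h) = \<phi> f \<otimes> \<phi> h" "\<phi> (h \<otimes>\<^bsub>Sym G\<^esub> f) = \<phi> h \<otimes> \<phi> f"
      using hom_mult[OF \<phi>h, of f h] hom_mult[OF \<phi>h, of h f] f h by simp_all
    then have "\<phi> (f \<otimes>\<^bsub>Sym G\<^esub> h) = \<phi> (h \<otimes>\<^bsub>Sym G\<^esub> f)" using cl by (simp add: m_comm)
    then have "f \<otimes>\<^bsub>Sym G\<^esub> h = h \<otimes>\<^bsub>Sym G\<^esub> f"
      using inj_onD[OF bij_betw_imp_inj_on[OF \<phi>b] _ comp(1)[OF f h x] comp(1)[OF h f x]] by simp
    then show ?thesis using comp(2)[OF f h x] comp(2)[OF h f x] by simp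
  qed
  define B where "B x g = \<nu> g x \<otimes> inv x \<otimes> inv g" for x g
  have Bcl: "B x g \<in> carrier G" if "x \<in> carrier G" "g \<in> carrier G" for x g
    using that \<nu>cl by (simp add: B_def)
  have \<nu>B: "\<nu> g x = x \<otimes> B x g \<otimes> g" if x: "x \<in> carrier G" and g: "g \<in> carrier G" for x g
  proof -
    have "x \<otimes> B x g \<otimes> g = \<nu> g x \<otimes> (x \<otimes> inv x) \<otimes> (g \<otimes> inv g)"
      unfolding B_def using \<nu>cl[OF g x] x g by (simp add: m_ac del: r_inv Units_r_inv)
    then show ?thesis using x g \<nu>cl[OF g x] by simp
  qed
  have N_eq: "N = circ_set G B"
  proof -
    have c: "circ G B g = \<nu> g" if g: "g \<in> carrier G" for g
    proof (rule extensionalityI)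
      show "\<nu> g \<in> extensional (carrier G)" using NB \<nu>N[OF g] Bij_imp_extensional by blast
    qed (use g \<nu>B in \<open>auto simp: circ_def\<close>)
    have "N = \<nu> ` carrier G"
    proof (intro equalityI subsetI)
      fix f assume f: "f \<in> N"
      have "f \<one> \<in> carrier G" by (rule Bij_apply[OF subsetD[OF NB f] one_closed])
      then show "f \<in> \<nu> ` carrier G" using \<nu>_uniq[OF f refl] by blast
    qed (use \<nu>N in auto)
    then show ?thesis unfolding circ_set_def using c by simp
  qed
  have Bsym: "B x g = B g x" if x: "x \<in> carrier G" and g: "g \<in> carrier G" for x g
  proof -
    have "\<nu> g x = \<nu> x g" using Ncomm[OF \<nu>N[OF g] \<nu>N[OF x] one_closed] \<nu>1 x g by simp
    then show ?thesis unfolding B_def using x g \<nu>cl by (simp add: m_ac)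
  qed
  have Bmult: "B (x \<otimes> y) g = B x g \<otimes> B y g"
    if x: "x \<in> carrier G" and y: "y \<in> carrier G" and g: "g \<in> carrier G" for x y g
  proof -
    have "\<nu> g \<in> Hol G" using NHol \<nu>N[OF g] by blast
    then have "\<nu> g (x \<otimes> y) \<otimes> g = \<nu> g x \<otimes> \<nu> g y" using x y \<nu>1[OF g] by (simp add: Hol_iff)
    then have "(x \<otimes> y \<otimes> g \<otimes> g) \<otimes> B (x \<otimes> y) g = (x \<otimes> y \<otimes> g \<otimes> g) \<otimes> (B x g \<otimes> B y g)"
      using x y g by (simp add: \<nu>B Bcl m_ac)
    then show ?thesis by (rule cancel_left) (use x y g Bcl in simp_all)
  qed
  have Bmult2: "B g (x \<otimes> y) = B g x \<otimes> B g y"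
    if x: "x \<in> carrier G" and y: "y \<in> carrier G" and g: "g \<in> carrier G" for x y g
    using Bmult[OF that] Bsym x y g by simp
  have Baut: "B (\<alpha> x) (\<alpha> g) = \<alpha> (B x g)"
    if \<alpha>: "\<alpha> \<in> iso G G" and x: "x \<in> carrier G" and g: "g \<in> carrier G" for \<alpha> x g
  proof -
    have h: "\<alpha> \<in> hom G G" using \<alpha> by (simp add: iso_def)
    have \<alpha>cl: "\<alpha> x \<in> carrier G" if "x \<in> carrier G" for x using hom_in_carrier[OF h that] .
    define f where "f = restrict \<alpha> (carrier G)"
    have f: "f \<in> normalizer (Sym G) N" unfolding norm f_def by (rule iso_restrict_Hol[OF \<alpha>])
    then have cN: "conj_set (Sym G) f N = N" and fB: "f \<in> Bij (carrier G)"
      using S.normalizer_iff[of N f] NB by auto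
    define k where "k = f \<otimes>\<^bsub>Sym G\<^esub> \<nu> g \<otimes>\<^bsub>Sym G\<^esub> inv\<^bsub>Sym G\<^esub> f"
    have gB: "\<nu> g \<in> Bij (carrier G)" using NB \<nu>N[OF g] by blast
    have kN: "k \<in> N" using cN \<nu>N[OF g] unfolding k_def conj_set_def by blast
    have kB: "k \<in> Bij (carrier G)" using kN NB by blast
    have k: "\<forall>x\<in>carrier G. f (\<nu> g x) = k (f x)"
      using Sym_conj_eq_iff[OF fB gB kB] k_def by simp
    have k': "\<alpha> (\<nu> g x) = k (\<alpha> x)" if "x \<in> carrier G" for x
      using bspec[OF k that] that \<nu>cl[OF g that] by (simp add: f_def)
    have "k \<one> = \<alpha> g" using k'[OF one_closed] \<nu>1[OF g] hom_one[OF h is_group is_group] by simp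
    then have "k = \<nu> (\<alpha> g)" using \<nu>_uniq[OF kN] by simp
    then have "\<alpha> (\<nu> g x) = \<nu> (\<alpha> g) (\<alpha> x)" using k'[OF x] by simp
    then have "(\<alpha> x \<otimes> \<alpha> g) \<otimes> \<alpha> (B x g) = (\<alpha> x \<otimes> \<alpha> g) \<otimes> B (\<alpha> x) (\<alpha> g)"
      using x g by (simp add: \<nu>B Bcl hom_mult[OF h] \<alpha>cl m_ac)
    then have "\<alpha> (B x g) = B (\<alpha> x) (\<alpha> g)" by (rule cancel_left) (use x g Bcl \<alpha>cl in simp_all)
    then show ?thesis by simp
  qed
  have Binv: "B (inv x) g = inv (B x g)" if x: "x \<in> carrier G" and g: "g \<in> carrier G" for x g
  proof -
    have "(\<lambda>x. B x g) \<in> hom G G" using g Bcl Bmult by (auto intro!: homI)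
    then interpret h: group_hom G G "\<lambda>x. B x g" by unfold_locales
    show ?thesis using h.hom_inv[OF x] .
  qed
  have Bsq: "B x g \<otimes> B x g = \<one>" if x: "x \<in> carrier G" and g: "g \<in> carrier G" for x g
  proof -
    have "B (inv x) (inv g) = B x g"
      using Binv[of x "inv g"] Binv[of g x] Bsym[of x "inv g"] Bsym[of x g] x g Bcl by simp
    then have "inv (B x g) = B x g" using Baut[OF inv_iso x g] by simp
    then show ?thesis using Bcl[OF x g] r_inv by metis
  qed
  have Bassoc: "B (B x g) h = B x (B g h)"
    if x: "x \<in> carrier G" and g: "g \<in> carrier G" and h: "h \<in> carrier G" for x g h
  proof -
    let ?k = "\<nu> h g"
    have k: "?k \<in> carrier G" by (rule \<nu>cl[OF h g])
    have "\<nu> h \<otimes>\<^bsub>Sym G\<^esub> \<nu> g = \<nu> ?k"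
      using comp[OF \<nu>N[OF h] \<nu>N[OF g] one_closed] \<nu>1[OF g] by (intro \<nu>_uniq) simp_all
    then have "\<nu> h (\<nu> g x) = \<nu> ?k x" using comp(2)[OF \<nu>N[OF h] \<nu>N[OF g] x] by simp
    moreover have "\<nu> h (\<nu> g x) = (x \<otimes> B x g \<otimes> g \<otimes> B x h \<otimes> B g h \<otimes> h) \<otimes> B (B x g) h"
      using x g h by (simp add: \<nu>B Bcl Bmult m_ac)
    moreover have "\<nu> ?k x = (x \<otimes> B x g \<otimes> g \<otimes> B x h \<otimes> B g h \<otimes> h) \<otimes> B x (B g h)"
      using x g h by (simp add: \<nu>B Bcl Bmult2 m_ac)
    ultimately have "(x \<otimes> B x g \<otimes> g \<otimes> B x h \<otimes> B g h \<otimes> h) \<otimes> B (B x g) h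
        = (x \<otimes> B x g \<otimes> g \<otimes> B x h \<otimes> B g h \<otimes> h) \<otimes> B x (B g h)" by simp
    then show ?thesis by (rule cancel_left) (use x g h Bcl in simp_all)
  qed
  have Bnil: "B w (B y h) = \<one>" if w: "w \<in> carrier G" and y: "y \<in> carrier G" and h: "h \<in> carrier G" for w y h
  proof -
    have "\<nu> h \<in> Hol G" using NHol \<nu>N[OF h] by blast
    from Hol_decomp[OF this] obtain \<alpha> where \<alpha>: "\<alpha> \<in> iso G G"
      and \<alpha>\<nu>: "\<forall>x\<in>carrier G. \<nu> h x = \<alpha> x \<otimes> h" using \<nu>1[OF h] by auto
    have hm: "\<alpha> \<in> hom G G" and b: "bij_betw \<alpha> (carrier G) (carrier G)" using \<alpha> by (simp_all add: iso_def)
    have \<alpha>B: "\<alpha> x = x \<otimes> B x h" if x: "x \<in> carrier G" for x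
      using bspec[OF \<alpha>\<nu> x] x h hom_in_carrier[OF hm x] Bcl[OF x h] by (simp add: \<nu>B)
    obtain x where x: "x \<in> carrier G" "\<alpha> x = w" using bij_betw_imp_surj_on[OF b] w by (metis imageE)
    have ax: "\<alpha> (B x y) = B x y \<otimes> B (B x y) h" using \<alpha>B[OF Bcl[OF x(1) y]] .
    \<comment> \<open>Associativity and symmetry make the terms of degree three agree, so that comparing both sides
        of the invariance under \<open>\<alpha>\<close> leaves only \<open>B (\<alpha> x) (B y h)\<close>, where \<open>\<alpha> x\<close> is arbitrary.\<close>
    have e1: "B (B x y) h = B (B x h) y"
      using x y h Bassoc[of x y h] Bassoc[of x h y] Bsym[of y h] by simp
    have "B (x \<otimes> B x h) (y \<otimes> B y h) = B x y \<otimes> B (B x h) y"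
      using Baut[OF \<alpha> x(1) y] \<alpha>B[OF x(1)] \<alpha>B[OF y] ax e1 by simp
    moreover have "B (x \<otimes> B x h) (y \<otimes> B y h) = (B x y \<otimes> B (B x h) y) \<otimes> B (x \<otimes> B x h) (B y h)"
      using x y h by (simp add: Bmult Bmult2 Bcl m_ac)
    ultimately have "(B x y \<otimes> B (B x h) y) \<otimes> B (x \<otimes> B x h) (B y h) = (B x y \<otimes> B (B x h) y) \<otimes> \<one>"
      using x y h Bcl by simp
    then have "B (x \<otimes> B x h) (B y h) = \<one>" by (rule cancel_left) (use x y h Bcl in simp_all)
    then show ?thesis using x \<alpha>B by simp
  qed
  have "invariant_product G B"
    by unfold_locales (fact Bcl Bsym Bmult Baut Bsq Bnil)+
  then show ?thesis using N_eq by blast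
qed

end

context polar_pair
begin

lemma Z_closed [simp]: "z \<in> Z \<Longrightarrow> z \<in> carrier G"
  using subgroup.subset[OF Z_sub] by blast

lemma B_closed [simp]: "x \<in> carrier G \<Longrightarrow> y \<in> carrier G \<Longrightarrow> B x y \<in> carrier G"
  using B_in Z_closed by blast

lemma q_closed [simp]: "x \<in> carrier G \<Longrightarrow> q x \<in> carrier G"
  using q_in Z_closed by blast

lemma B_mult2:
  "x \<in> carrier G \<Longrightarrow> y \<in> carrier G \<Longrightarrow> w \<in> carrier G \<Longrightarrow> B w (x \<otimes> y) = B w x \<otimes> B w y"
  using B_mult[of x y w] B_sym by simp

lemma B_Z2: "x \<in> carrier G \<Longrightarrow> z \<in> Z \<Longrightarrow> B z x = \<one>"
  using B_Z B_sym by simp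

lemma q_add_Z: "x \<in> carrier G \<Longrightarrow> z \<in> Z \<Longrightarrow> q (x \<otimes> z) = q x"
  by (simp add: q_mult q_Z B_Z)

lemma Z_cancel: "x \<in> carrier G \<Longrightarrow> z \<in> Z \<Longrightarrow> x \<otimes> z \<otimes> z = x"
  using Z_sq by (simp add: m_assoc)

text \<open>An isomorphism from \<open>G\<close> to its circle group, and an involution because \<open>q (x \<otimes> q x) = q x\<close>.\<close>

definition \<theta> :: "'a \<Rightarrow> 'a" where "\<theta> = (\<lambda>x\<in>carrier G. x \<otimes> q x)"

lemma theta_apply: "x \<in> carrier G \<Longrightarrow> \<theta> x = x \<otimes> q x"
  by (simp add: \<theta>_def)

lemma theta_closed [simp]: "x \<in> carrier G \<Longrightarrow> \<theta> x \<in> carrier G"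
  by (simp add: theta_apply)

lemma theta_theta [simp]: "x \<in> carrier G \<Longrightarrow> \<theta> (\<theta> x) = x"
  by (simp add: theta_apply q_add_Z q_in Z_cancel)

lemma theta_Bij: "\<theta> \<in> Bij (carrier G)"
proof (rule BijI)
  show "x = y" if "x \<in> carrier G" "y \<in> carrier G" "\<theta> x = \<theta> y" for x y
    using that theta_theta by metis
  show "\<exists>x\<in>carrier G. \<theta> x = y" if "y \<in> carrier G" for y
    using that by (intro bexI[of _ "\<theta> y"]) simp_all
qed (auto simp: \<theta>_def)

end

context quadratic_datum
begin

text \<open>For a linear \<open>\<alpha>\<close> the conjugate is \<open>x \<mapsto> \<alpha> x \<otimes> \<alpha> (q x) \<otimes> q (\<alpha> x)\<close>. The two refinements \<open>\<alpha> \<circ> q\<close> and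
  \<open>q \<circ> \<alpha>\<close> have the same polarization because \<open>B\<close> is invariant under \<open>\<alpha>\<close>, so their product is additive
  and the conjugate is linear again. The computation below carries a translation part along.\<close>

lemma theta_conj_Hol:
  assumes f: "f \<in> Hol G"
  shows "(\<lambda>x\<in>carrier G. \<theta> (f (\<theta> x))) \<in> Hol G"
proof -
  let ?F = "\<lambda>x\<in>carrier G. \<theta> (f (\<theta> x))"
  have fB: "f \<in> Bij (carrier G)" using f by (simp add: Hol_iff)
  have cl: "f x \<in> carrier G" if "x \<in> carrier G" for x by (rule Bij_apply[OF fB that])
  obtain \<alpha> where \<alpha>: "\<alpha> \<in> iso G G" and dec: "\<forall>x\<in>carrier G. f x = \<alpha> x \<otimes> f \<one>"
    using Hol_decomp[OF f] by blast
  have h: "\<alpha> \<in> hom G G" using \<alpha> by (simp add: iso_def)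
  have \<alpha>cl: "\<alpha> x \<in> carrier G" if "x \<in> carrier G" for x by (rule hom_in_carrier[OF h that])
  let ?t = "f \<one>"
  have t: "?t \<in> carrier G" using cl by simp
  have F: "?F x = \<alpha> x \<otimes> ?t \<otimes> \<alpha> (q x) \<otimes> q (\<alpha> x \<otimes> ?t)" if x: "x \<in> carrier G" for x
  proof -
    have z: "\<alpha> (q x) \<in> Z" using Z_char[OF \<alpha> q_in[OF x]] .
    have "f (\<theta> x) = \<alpha> (x \<otimes> q x) \<otimes> ?t" using bspec[OF dec, of "x \<otimes> q x"] x by (simp add: theta_apply)
    then have "f (\<theta> x) = \<alpha> x \<otimes> ?t \<otimes> \<alpha> (q x)"
      using hom_mult[OF h x q_closed[OF x]] \<alpha>cl x t by (simp add: m_ac)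
    then show ?thesis using x t z \<alpha>cl q_add_Z[OF _ z, of "\<alpha> x \<otimes> ?t"] by (simp add: theta_apply)
  qed
  have "?F \<in> Bij (carrier G)"
  proof (rule BijI)
    show "x = y" if "x \<in> carrier G" "y \<in> carrier G" "?F x = ?F y" for x y
    proof -
      have "\<theta> (\<theta> (f (\<theta> x))) = \<theta> (\<theta> (f (\<theta> y)))" using that by simp
      then have "f (\<theta> x) = f (\<theta> y)" using that cl by simp
      then have "\<theta> (\<theta> x) = \<theta> (\<theta> y)" using Bij_inj[OF fB] that theta_closed by metis
      then show ?thesis using that by simp
    qed
    show "\<exists>x\<in>carrier G. ?F x = y" if y: "y \<in> carrier G" for y
    proof -
      obtain x where "x \<in> carrier G" "f x = \<theta> y" using Bij_surj[OF fB theta_closed[OF y]] by blast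
      then show ?thesis using y by (intro bexI[of _ "\<theta> x"]) simp_all
    qed
  qed (use cl in auto)
  moreover have "?F (x \<otimes> y) \<otimes> ?F \<one> = ?F x \<otimes> ?F y" if x: "x \<in> carrier G" and y: "y \<in> carrier G" for x y
  proof -
    let ?ax = "\<alpha> x" and ?ay = "\<alpha> y" and ?b = "\<alpha> (B x y)"
    have a: "?ax \<in> carrier G" "?ay \<in> carrier G" using \<alpha>cl x y by auto
    have b: "?b \<in> Z" using Z_char[OF \<alpha> B_in[OF x y]] .
    have bB: "B ?ax ?ay = ?b" by (rule B_aut[OF \<alpha> x y])
    have cls: "\<alpha> (q x) \<in> carrier G" "\<alpha> (q y) \<in> carrier G" "?b \<in> carrier G" using \<alpha>cl x y by auto
    have q1: "q \<one> = \<one>" using q_Z subgroup.one_closed[OF Z_sub] .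
    have a1: "\<alpha> \<one> = \<one>" using hom_one[OF h is_group is_group] by simp
    have L: "?F (x \<otimes> y) \<otimes> ?F \<one> =
      (?ax \<otimes> ?ay \<otimes> ?t \<otimes> ?t \<otimes> \<alpha> (q x) \<otimes> \<alpha> (q y)) \<otimes> ?b \<otimes> (q (?ax \<otimes> ?ay \<otimes> ?t) \<otimes> q ?t)"
      using x y a t cls F[of "x \<otimes> y"] F[OF one_closed]
      by (simp add: hom_mult[OF h] q_mult[OF x y] q1 a1 m_ac)
    have "q (?ax \<otimes> ?ay \<otimes> ?t) \<otimes> q ?t = (q ?ax \<otimes> q ?t \<otimes> B ?ax ?t) \<otimes> (q ?ay \<otimes> q ?t \<otimes> B ?ay ?t) \<otimes> ?b"
      using a t cls by (simp add: q_mult B_mult B_mult2 bB m_ac)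
    then have Q: "q (?ax \<otimes> ?ay \<otimes> ?t) \<otimes> q ?t = q (?ax \<otimes> ?t) \<otimes> q (?ay \<otimes> ?t) \<otimes> ?b"
      using a t by (simp add: q_mult)
    have "?F (x \<otimes> y) \<otimes> ?F \<one> =
      ((?ax \<otimes> ?ay \<otimes> ?t \<otimes> ?t \<otimes> \<alpha> (q x) \<otimes> \<alpha> (q y)) \<otimes> (q (?ax \<otimes> ?t) \<otimes> q (?ay \<otimes> ?t))) \<otimes> ?b \<otimes> ?b"
      unfolding L Q using a t cls by (simp add: m_ac)
    also have "\<dots> = (?ax \<otimes> ?ay \<otimes> ?t \<otimes> ?t \<otimes> \<alpha> (q x) \<otimes> \<alpha> (q y)) \<otimes> (q (?ax \<otimes> ?t) \<otimes> q (?ay \<otimes> ?t))"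
      using a t cls by (intro Z_cancel[OF _ b]) simp
    also have "\<dots> = ?F x \<otimes> ?F y"
      unfolding F[OF x] F[OF y] using a t cls by (simp add: m_ac)
    finally show ?thesis .
  qed
  ultimately show ?thesis unfolding Hol_iff by blast
qed

text \<open>Since \<open>\<theta>\<close> is an involution, the inclusion of the conjugate of \<open>Hol G\<close> in \<open>Hol G\<close> is an equality.
  This is what replaces a counting argument when \<open>G\<close> is infinite.\<close>

lemma theta_NHol: "\<theta> \<in> NHol G"
proof -
  interpret S: group "Sym G" by (rule group_BijGroup)
  have cl: "f x \<in> carrier G" if "f \<in> Hol G" "x \<in> carrier G" for f x
    by (rule Bij_apply[OF subsetD[OF Hol_subset that(1)] that(2)])
  have "conj_set (Sym G) \<theta> (Hol G) = Hol G"
  proof (intro equalityI subsetI)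
    fix k assume "k \<in> conj_set (Sym G) \<theta> (Hol G)"
    then obtain h where k: "k \<in> Bij (carrier G)" "h \<in> Hol G" "\<forall>x\<in>carrier G. \<theta> (h x) = k (\<theta> x)"
      using conj_set_Sym_iff[OF theta_Bij Hol_subset] by blast
    have "k = (\<lambda>x\<in>carrier G. \<theta> (h (\<theta> x)))"
    proof (rule extensionalityI[OF Bij_imp_extensional[OF k(1)]])
      fix x assume x: "x \<in> carrier G"
      show "k x = (\<lambda>x\<in>carrier G. \<theta> (h (\<theta> x))) x" using bspec[OF k(3) theta_closed[OF x]] x by simp
    qed simp
    then show "k \<in> Hol G" using theta_conj_Hol[OF k(2)] by simp
  next
    fix k assume k: "k \<in> Hol G"
    have "\<forall>x\<in>carrier G. \<theta> ((\<lambda>x\<in>carrier G. \<theta> (k (\<theta> x))) x) = k (\<theta> x)"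
      using cl[OF k] by simp
    then show "k \<in> conj_set (Sym G) \<theta> (Hol G)"
      using conj_set_Sym_iff[OF theta_Bij Hol_subset] theta_conj_Hol[OF k] k Hol_subset by blast
  qed
  then show ?thesis unfolding NHol_def using S.normalizer_iff[of "Hol G" \<theta>] theta_Bij Hol_subset by simp
qed

text \<open>Conjugation by \<open>\<theta>\<close> carries translations to circle translations.\<close>

theorem circ_set_in_HH: "circ_set G B \<in> HH G"
proof -
  have eq: "\<theta> (x \<otimes> g) = circ G B (\<theta> g) (\<theta> x)" if x: "x \<in> carrier G" and g: "g \<in> carrier G" for x g
  proof -
    have z: "B (x \<otimes> q x) (g \<otimes> q g) = B x g"
      using x g by (simp add: B_mult B_mult2 B_Z B_Z2 q_in)
    show ?thesis using x g z B_sym[OF g x] by (simp add: circ_def theta_apply q_mult m_ac)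
  qed
  have cB: "circ G B g \<in> Bij (carrier G)" if g: "g \<in> carrier G" for g
  proof -
    let ?k = "compose (carrier G) (compose (carrier G) \<theta> (regular_rep G (\<theta> g))) \<theta>"
    have k: "?k \<in> Bij (carrier G)"
      using theta_Bij regular_rep_Bij[OF theta_closed[OF g]] by (simp add: compose_Bij)
    have "circ G B g = ?k"
    proof (rule extensionalityI)
      show "?k \<in> extensional (carrier G)" using k by (rule Bij_imp_extensional)
      fix x assume x: "x \<in> carrier G"
      show "circ G B g x = ?k x" using x g eq[of "\<theta> x" "\<theta> g"] by (simp add: compose_def)
    qed (simp add: circ_def)
    then show ?thesis using k by simp
  qed
  have "circ_set G B = conj_set (Sym G) \<theta> (Reg G)"
  proof (intro equalityI subsetI)
    fix k assume "k \<in> circ_set G B"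
    then obtain g where g: "g \<in> carrier G" "k = circ G B g" by (auto simp: circ_set_def)
    have "\<forall>x\<in>carrier G. \<theta> (regular_rep G (\<theta> g) x) = k (\<theta> x)" using eq[of _ "\<theta> g"] g by simp
    then show "k \<in> conj_set (Sym G) \<theta> (Reg G)"
      using conj_set_Sym_iff[OF theta_Bij Reg_subset] cB[OF g(1)] g theta_closed[OF g(1)]
      unfolding Reg_def by blast
  next
    fix k assume "k \<in> conj_set (Sym G) \<theta> (Reg G)"
    then obtain g where k: "k \<in> Bij (carrier G)" "g \<in> carrier G"
      "\<forall>x\<in>carrier G. \<theta> (regular_rep G g x) = k (\<theta> x)"
      using conj_set_Sym_iff[OF theta_Bij Reg_subset] by (auto simp: Reg_def)
    have "k = circ G B (\<theta> g)"
    proof (rule Bij_eqI[OF k(1) cB])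
      fix x assume x: "x \<in> carrier G"
      show "k x = circ G B (\<theta> g) x" using bspec[OF k(3), of "\<theta> x"] eq[of "\<theta> x" g] x k(2) by simp
    qed (use k in simp)
    then show "k \<in> circ_set G B"
      using imageI[OF theta_closed[OF k(2)], of "circ G B"] by (simp add: circ_set_def)
  qed
  then show ?thesis using conj_Reg_in_HH[OF theta_NHol] by simp
qed

end

context comm_group
begin

lemma quadratic_datum_trivial: "quadratic_datum G {\<one>} (\<lambda>x y. \<one>) (\<lambda>x. \<one>)"
  by unfold_locales (auto simp: triv_subgroup hom_one iso_def hom_mult)

lemma polar_pair_mult:
  assumes "polar_pair G Z B q" "polar_pair G Z B' q'"
  shows "polar_pair G Z (\<lambda>x y. B x y \<otimes> B' x y) (\<lambda>x. q x \<otimes> q' x)"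
proof -
  interpret Q: polar_pair G Z B q by fact
  interpret Q': polar_pair G Z B' q' by fact
  show ?thesis
    by unfold_locales (auto simp: Q.Z_sub Q.Z_sq Q.B_in Q'.B_in Q.q_in Q'.q_in Q.B_mult Q'.B_mult
      Q.B_Z Q'.B_Z Q.q_mult Q'.q_mult Q.q_Z Q'.q_Z m_ac subgroup.m_closed[OF Q.Z_sub]
      subgroup.one_closed[OF Q.Z_sub] subgroup.m_inv_closed[OF Q.Z_sub]
      intro: arg_cong2[OF Q.B_sym Q'.B_sym])
qed

lemma quadratic_datum_mult:
  assumes "quadratic_datum G Z B q" "quadratic_datum G Z B' q'"
  shows "quadratic_datum G Z (\<lambda>x y. B x y \<otimes> B' x y) (\<lambda>x. q x \<otimes> q' x)"
proof -
  interpret Q: quadratic_datum G Z B q by fact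
  interpret Q': quadratic_datum G Z B' q' by fact
  interpret P: polar_pair G Z "\<lambda>x y. B x y \<otimes> B' x y" "\<lambda>x. q x \<otimes> q' x"
    by (rule polar_pair_mult) unfold_locales
  show ?thesis
  proof unfold_locales
    fix \<alpha> x y assume \<alpha>: "\<alpha> \<in> iso G G" and xy: "x \<in> carrier G" "y \<in> carrier G"
    then show "B (\<alpha> x) (\<alpha> y) \<otimes> B' (\<alpha> x) (\<alpha> y) = \<alpha> (B x y \<otimes> B' x y)"
      using hom_mult[OF iso_imp_homomorphism[OF \<alpha>], of "B x y" "B' x y"] by (simp add: Q.B_aut Q'.B_aut)
  qed (simp add: Q.Z_char)
qed

lemma circ_set_eq_iff:
  assumes "\<And>x y. x \<in> carrier G \<Longrightarrow> y \<in> carrier G \<Longrightarrow> B x y \<in> carrier G"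
    and "\<And>x y. x \<in> carrier G \<Longrightarrow> y \<in> carrier G \<Longrightarrow> B' x y \<in> carrier G"
    and "\<And>x. x \<in> carrier G \<Longrightarrow> B \<one> x = \<one>" "\<And>x. x \<in> carrier G \<Longrightarrow> B' \<one> x = \<one>"
  shows "circ_set G B = circ_set G B' \<longleftrightarrow> (\<forall>x\<in>carrier G. \<forall>y\<in>carrier G. B x y = B' x y)"
proof
  assume eq: "circ_set G B = circ_set G B'"
  show "\<forall>x\<in>carrier G. \<forall>y\<in>carrier G. B x y = B' x y"
  proof (intro ballI)
    fix x y assume x: "x \<in> carrier G" and y: "y \<in> carrier G"
    have "circ G B y \<in> circ_set G B'" unfolding eq[symmetric] using y by (simp add: circ_set_def)
    then obtain g where g: "g \<in> carrier G" "circ G B y = circ G B' g" by (auto simp: circ_set_def)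
    have "circ G B y \<one> = circ G B' g \<one>" using g by simp
    then have "y = g" using assms y g(1) by (simp add: circ_def)
    then have "circ G B y x = circ G B' y x" using g by simp
    then show "B x y = B' x y" using assms x y by (simp add: circ_def)
  qed
next
  assume "\<forall>x\<in>carrier G. \<forall>y\<in>carrier G. B x y = B' x y"
  then have "circ G B y = circ G B' y" if "y \<in> carrier G" for y
    unfolding circ_def using that by (intro restrict_ext) simp
  then show "circ_set G B = circ_set G B'" unfolding circ_set_def by (intro image_cong) auto
qed

end

context invariant_product
begin

lemma B_mult2:
  "x \<in> carrier G \<Longrightarrow> y \<in> carrier G \<Longrightarrow> w \<in> carrier G \<Longrightarrow> B w (x \<otimes> y) = B w x \<otimes> B w y"
  using B_mult[of x y w] B_sym by simp

text \<open>The square of the circle translation by \<open>g\<close> is the one by \<open>g \<otimes> B g g \<otimes> g\<close>, which is trivial under the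
  hypothesis; the isomorphic group \<open>G\<close> then has exponent two as well.\<close>

lemma exponent_two_if_square_eq_product:
  assumes iso: "(Sym G)\<lparr>carrier := circ_set G B\<rparr> \<cong> G" and sub: "subgroup (circ_set G B) (Sym G)"
    and sq: "\<And>x. x \<in> carrier G \<Longrightarrow> x \<otimes> x \<otimes> B x x = \<one>" and g: "g \<in> carrier G"
  shows "g \<otimes> g = \<one>"
proof -
  interpret S: group "Sym G" by (rule group_BijGroup)
  interpret N: group "(Sym G)\<lparr>carrier := circ_set G B\<rparr>" by (rule S.subgroup_imp_group[OF sub])
  obtain \<phi> where \<phi>: "\<phi> \<in> iso ((Sym G)\<lparr>carrier := circ_set G B\<rparr>) G" using iso by (auto simp: is_iso_def)
  have \<phi>h: "\<phi> \<in> hom ((Sym G)\<lparr>carrier := circ_set G B\<rparr>) G"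
    and \<phi>b: "bij_betw \<phi> (circ_set G B) (carrier G)" using \<phi> by (simp_all add: iso_def)
  obtain f where f: "f \<in> circ_set G B" "\<phi> f = g" using bij_betw_imp_surj_on[OF \<phi>b] g by (metis imageE)
  then obtain y where y: "y \<in> carrier G" "f = circ G B y" by (auto simp: circ_set_def)
  have fB: "f \<in> Bij (carrier G)" using subgroup.subset[OF sub] f by auto
  have "f (f x) = x" if x: "x \<in> carrier G" for x
  proof -
    have "f (f x) = x \<otimes> (B x y \<otimes> B x y) \<otimes> (y \<otimes> y \<otimes> B y y)"
      using x y B_nil[of y x y] B_sym[of "B x y" y]
      by (simp add: circ_def B_mult m_ac del: B_sq)
    then show ?thesis using x y sq B_sq by simp
  qed
  then have "f \<otimes>\<^bsub>Sym G\<^esub> f = \<one>\<^bsub>Sym G\<^esub>" using fB by (auto simp: Sym_mult Sym_one compose_def)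
  then have "\<phi> (f \<otimes>\<^bsub>Sym G\<^esub> f) = \<one>"
    using hom_one[OF \<phi>h N.is_group group_axioms] by simp
  then show ?thesis using hom_mult[OF \<phi>h, of f f] f by simp
qed

end

section \<open>Coordinates with respect to a basis\<close>

context comm_group
begin

lemma finprod_int_pow_mult:
  fixes k :: "nat \<Rightarrow> int"
  assumes "finite A" "\<And>i. i \<in> A \<Longrightarrow> e i \<in> carrier G"
  shows "finprod G (\<lambda>i. e i [^] k i) A \<otimes> finprod G (\<lambda>i. e i [^] l i) A = finprod G (\<lambda>i. e i [^] (k i + l i)) A"
proof -
  have "finprod G (\<lambda>i. e i [^] (k i + l i)) A = finprod G (\<lambda>i. e i [^] k i \<otimes> e i [^] l i) A"
    using assms by (intro finprod_cong') (auto simp: int_pow_mult)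
  also have "\<dots> = finprod G (\<lambda>i. e i [^] k i) A \<otimes> finprod G (\<lambda>i. e i [^] l i) A"
    using assms by (intro finprod_multf) auto
  finally show ?thesis by simp
qed

lemma int_pow_nat_mod:
  fixes a :: int
  assumes "h \<in> carrier G" "h [^] (d::nat) = \<one>"
  shows "h [^] (a mod int d) = h [^] a"
proof -
  have "h [^] a = h [^] (int d * (a div int d) + a mod int d)" by simp
  also have "\<dots> = (h [^] int d) [^] (a div int d) \<otimes> h [^] (a mod int d)"
    using assms(1) by (simp only: int_pow_mult int_pow_pow)
  also have "\<dots> = h [^] (a mod int d)" using assms by (simp add: int_pow_int)
  finally show ?thesis by simp
qed

lemma int_pow_parity:
  fixes a b :: int
  assumes "w \<in> carrier G" "w \<otimes> w = \<one>" "even (a - b)"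
  shows "w [^] a = w [^] b"
proof -
  have w: "w [^] (2::nat) = \<one>" using assms by (simp add: numeral_2_eq_2)
  have "a mod int 2 = b mod int 2" using assms(3) by (simp add: mod_eq_dvd_iff)
  then show ?thesis using int_pow_nat_mod[OF assms(1) w, of a] int_pow_nat_mod[OF assms(1) w, of b] by simp
qed

end

text \<open>The elements \<open>e 1, \<dots>, e r\<close> form a basis of \<open>G\<close>. The order of \<open>e i\<close> is \<open>d i\<close>, where \<open>0\<close> stands for infinite
  order; the basis elements of infinite order come first, followed by those of 2-power order with the
  orders decreasing. With this convention the orders form a descending chain for divisibility, as
  every number divides \<open>0\<close>.\<close>

locale adapted_basis = comm_group G for G :: "('a, 'b) monoid_scheme" (structure) +
  fixes n r :: nat and e :: "nat \<Rightarrow> 'a" and d :: "nat \<Rightarrow> nat"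
  assumes e_closed: "i \<in> {1..r} \<Longrightarrow> e i \<in> carrier G"
    and span: "x \<in> carrier G \<Longrightarrow> \<exists>k::nat \<Rightarrow> int. x = finprod G (\<lambda>i. e i [^] k i) {1..r}"
    and indep: "finprod G (\<lambda>i. e i [^] (k i :: int)) {1..r} = \<one> \<Longrightarrow> i \<in> {1..r} \<Longrightarrow> int (d i) dvd k i"
    and e_pow: "i \<in> {1..r} \<Longrightarrow> e i [^] d i = \<one>"
    and n_le: "n \<le> r"
    and d_zero: "i \<in> {1..r} \<Longrightarrow> d i = 0 \<longleftrightarrow> i \<le> n"
    and d_two: "i \<in> {1..r} \<Longrightarrow> n < i \<Longrightarrow> \<exists>k. d i = 2 ^ Suc k"
    and d_anti: "n < i \<Longrightarrow> i \<le> j \<Longrightarrow> j \<le> r \<Longrightarrow> d j \<le> d i"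
begin

abbreviation "I \<equiv> {1..r}"

definition lin :: "(nat \<Rightarrow> int) \<Rightarrow> 'a" where "lin k = finprod G (\<lambda>i. e i [^] k i) I"

text \<open>As \<open>k mod 0 = k\<close>, the coordinates at basis elements of infinite order are honest integers.\<close>

definition c :: "nat \<Rightarrow> 'a \<Rightarrow> int" where "c i x = (SOME k. x = lin k) i mod int (d i)"

lemma lin_closed [simp]: "lin k \<in> carrier G"
  unfolding lin_def using e_closed by (intro finprod_closed) auto

lemma lin_mult: "lin k \<otimes> lin l = lin (\<lambda>i. k i + l i)"
  unfolding lin_def using e_closed by (intro finprod_int_pow_mult) auto

lemma lin_zero: "lin (\<lambda>i. 0) = \<one>"
  unfolding lin_def by simp

lemma lin_inv: "inv (lin k) = lin (\<lambda>i. - k i)"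
  by (rule inv_equality) (simp_all add: lin_mult lin_zero)

lemma e_pow_int: "i \<in> I \<Longrightarrow> int (d i) dvd a \<Longrightarrow> e i [^] a = \<one>"
  using int_pow_nat_mod[OF e_closed e_pow, of i a] by simp

lemma lin_eq_iff: "lin k = lin l \<longleftrightarrow> (\<forall>i\<in>I. k i mod int (d i) = l i mod int (d i))"
proof
  assume "lin k = lin l"
  then have "lin (\<lambda>i. k i - l i) = \<one>"
    using lin_mult[of k "\<lambda>i. - l i"] by (simp flip: lin_inv)
  then show "\<forall>i\<in>I. k i mod int (d i) = l i mod int (d i)"
    using indep[of "\<lambda>i. k i - l i"] unfolding lin_def by (simp add: mod_eq_dvd_iff)
next
  assume *: "\<forall>i\<in>I. k i mod int (d i) = l i mod int (d i)"
  have "e i [^] k i = e i [^] l i" if "i \<in> I" for i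
    using int_pow_nat_mod[OF e_closed e_pow, OF that that, of "k i"]
      int_pow_nat_mod[OF e_closed e_pow, OF that that, of "l i"] * that by simp
  then show "lin k = lin l" unfolding lin_def using e_closed by (intro finprod_cong') auto
qed

lemma c_lin: "i \<in> I \<Longrightarrow> c i (lin k) = k i mod int (d i)"
proof -
  assume i: "i \<in> I"
  have "lin k = lin (SOME l. lin k = lin l)"
    using someI[of "\<lambda>l. lin k = lin l", OF refl] .
  from bspec[OF iffD1[OF lin_eq_iff this] i] show ?thesis unfolding c_def by (rule sym)
qed

lemma lin_c:
  assumes x: "x \<in> carrier G" shows "x = lin (\<lambda>i. c i x)"
proof -
  obtain k where k: "x = lin k" using span[OF x] by (auto simp: lin_def)
  have "lin k = lin (\<lambda>i. c i (lin k))" unfolding lin_eq_iff by (simp add: c_lin)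
  then show ?thesis by (simp flip: k)
qed

lemma c_eqI: "x \<in> carrier G \<Longrightarrow> y \<in> carrier G \<Longrightarrow> (\<And>i. i \<in> I \<Longrightarrow> c i x = c i y) \<Longrightarrow> x = y"
  using lin_c[of x] lin_c[of y] lin_eq_iff by metis

lemma c_mod [simp]: "c i x mod int (d i) = c i x"
  by (simp add: c_def)

lemma c_eq_zero_if_dvd: "int (d i) dvd c i x \<Longrightarrow> c i x = 0"
  using c_mod[of i x] dvd_imp_mod_0 by metis

lemma c_mult:
  assumes "x \<in> carrier G" "y \<in> carrier G" "i \<in> I"
  shows "c i (x \<otimes> y) = (c i x + c i y) mod int (d i)"
proof -
  have "x \<otimes> y = lin (\<lambda>i. c i x + c i y)"
    using lin_mult[of "\<lambda>i. c i x" "\<lambda>i. c i y"] lin_c[OF assms(1)] lin_c[OF assms(2)] by simp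
  then show ?thesis using c_lin[OF assms(3)] by simp
qed

lemma c_one: "i \<in> I \<Longrightarrow> c i \<one> = 0"
  using c_lin[of i "\<lambda>i. 0"] by (simp add: lin_zero)

lemma e_lin: "j \<in> I \<Longrightarrow> e j [^] (a::int) = lin (\<lambda>i. if i = j then a else 0)"
proof -
  assume j: "j \<in> I"
  have "lin (\<lambda>i. if i = j then a else 0) = finprod G (\<lambda>i. if j = i then e i [^] a else \<one>) I"
    unfolding lin_def using e_closed by (intro finprod_cong') auto
  also have "\<dots> = e j [^] a" using j e_closed by (intro finprod_singleton) auto
  finally show ?thesis by simp
qed

lemma c_e_pow: "i \<in> I \<Longrightarrow> j \<in> I \<Longrightarrow> c i (e j [^] (a::int)) = (if i = j then a mod int (d i) else 0)"
  by (simp add: e_lin c_lin)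

lemma d_not_one: "i \<in> I \<Longrightarrow> d i \<noteq> 1"
  using d_zero[of i] d_two[of i] by (cases "i \<le> n") auto

lemma d_even: "i \<in> I \<Longrightarrow> even (d i)"
  using d_zero[of i] d_two[of i] by (cases "i \<le> n") auto

lemma c_e: "i \<in> I \<Longrightarrow> j \<in> I \<Longrightarrow> c i (e j) = (if i = j then 1 else 0)"
proof -
  assume i: "i \<in> I" and j: "j \<in> I"
  have "1 mod int (d i) = 1" using d_not_one[OF i] by (cases "d i = 0") auto
  then show ?thesis using c_e_pow[OF i j, of 1] e_closed[OF j] by auto
qed

lemma e_pow_eq_one_iff: "i \<in> I \<Longrightarrow> e i [^] (a::int) = \<one> \<longleftrightarrow> int (d i) dvd a"
  using c_e_pow[of i i a] c_one[of i] e_pow_int by auto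

lemma c_inv:
  assumes "x \<in> carrier G" "i \<in> I" shows "c i (inv x) = (- c i x) mod int (d i)"
  using lin_inv[of "\<lambda>i. c i x"] lin_c[OF assms(1)] c_lin[OF assms(2)] by simp

lemma c_nat_pow:
  assumes "x \<in> carrier G" "i \<in> I"
  shows "c i (x [^] (m::nat)) = (int m * c i x) mod int (d i)"
proof (induction m)
  case (Suc m)
  have "c i (x [^] Suc m) = (c i (x [^] m) + c i x) mod int (d i)" using assms by (simp add: c_mult)
  then show ?case unfolding Suc.IH by (simp add: mod_simps algebra_simps)
qed (use assms c_one in simp)

lemma c_int_pow:
  assumes "x \<in> carrier G" "i \<in> I"
  shows "c i (x [^] (m::int)) = (m * c i x) mod int (d i)"
proof (cases "m \<ge> 0")
  case True
  then have "x [^] m = x [^] nat m" using int_pow_int[of G x "nat m"] by simp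
  then show ?thesis using c_nat_pow[OF assms, of "nat m"] True by simp
next
  case False
  then have "m = - int (nat (- m))" by simp
  then obtain l where l: "m = - int l" by blast
  have "x [^] m = inv (x [^] l)" unfolding l using int_pow_neg_int[OF assms(1)] .
  then show ?thesis using assms l by (simp add: c_inv c_nat_pow mod_simps)
qed

text \<open>Every element is a product of basis elements and their inverses.\<close>

lemma basis_induct:
  assumes add: "\<And>x y. x \<in> carrier G \<Longrightarrow> y \<in> carrier G \<Longrightarrow> P x \<Longrightarrow> P y \<Longrightarrow> P (x \<otimes> y)"
    and inv: "\<And>x. x \<in> carrier G \<Longrightarrow> P x \<Longrightarrow> P (inv x)"
    and base: "P \<one>" "\<And>j. j \<in> I \<Longrightarrow> P (e j)" and x: "x \<in> carrier G"
  shows "P x"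
proof -
  have nat: "P (e j [^] (m::nat))" if "j \<in> I" for j m
    by (induction m) (use that base add e_closed in auto)
  have int: "P (e j [^] (a::int))" if "j \<in> I" for j a
  proof (cases "a \<ge> 0")
    case True
    then show ?thesis using nat[OF that, of "nat a"] int_pow_int[of G "e j" "nat a"] by simp
  next
    case False
    then have "a = - int (nat (- a))" by simp
    then obtain l where l: "a = - int l" by blast
    show ?thesis unfolding l int_pow_neg_int[OF e_closed[OF that]]
      using inv nat[OF that] e_closed[OF that] by simp
  qed
  have "P (finprod G (\<lambda>i. e i [^] k i) A)" if "finite A" "A \<subseteq> I" for A and k :: "nat \<Rightarrow> int"
    using that
  proof (induction A)
    case (insert a A)
    have "finprod G (\<lambda>i. e i [^] k i) (insert a A) = e a [^] k a \<otimes> finprod G (\<lambda>i. e i [^] k i) A"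
      using insert.hyps insert.prems e_closed by (intro finprod_insert) auto
    moreover have "finprod G (\<lambda>i. e i [^] k i) A \<in> carrier G"
      using insert.prems e_closed by (intro finprod_closed) auto
    moreover have "a \<in> I" "A \<subseteq> I" using insert.prems by auto
    ultimately show ?case using insert.IH int[of a "k a"] e_closed[of a] add by simp
  qed (use base in simp)
  from this[of I "\<lambda>i. c i x"] show ?thesis using lin_c[OF x] by (simp add: lin_def)
qed

lemma hom_eq_on_basis:
  assumes f: "f \<in> hom G G" and g: "g \<in> hom G G" and "\<And>j. j \<in> I \<Longrightarrow> f (e j) = g (e j)"
    and x: "x \<in> carrier G"
  shows "f x = g x"
proof -
  interpret f: group_hom G G f by unfold_locales (rule f)
  interpret g: group_hom G G g by unfold_locales (rule g)
  show ?thesis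
    by (rule basis_induct[where P = "\<lambda>x. f x = g x", OF _ _ _ _ x]) (use assms in auto)
qed

text \<open>The automorphism that replaces \<open>e i\<close> by \<open>e i \<otimes> h\<close> and fixes the other basis elements. These
  transvections are the only automorphisms, besides inversion and the linear parts of the elements of
  the regular subgroup, whose action on an invariant product is exploited to bound the number of products.\<close>

lemma transvection_iso:
  assumes i: "i \<in> I" and h: "h \<in> carrier G" "h [^] d i = \<one>" "c i h = 0"
  shows "(\<lambda>x. x \<otimes> h [^] c i x) \<in> iso G G"
proof (rule isoI)
  have pm: "h [^] (a mod int (d i)) = h [^] a" for a :: int
    by (rule int_pow_nat_mod) (use h in auto)
  show "(\<lambda>x. x \<otimes> h [^] c i x) \<in> hom G G"
    by (rule homI) (use i h in \<open>auto simp: c_mult pm int_pow_mult m_ac\<close>)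
  have inv1: "c i (x \<otimes> h [^] (a::int)) = c i x" if "x \<in> carrier G" for x a
    using i h that by (simp add: c_mult c_int_pow)
  show "bij_betw (\<lambda>x. x \<otimes> h [^] c i x) (carrier G) (carrier G)"
  proof (rule bij_betw_byWitness[where f' = "\<lambda>x. x \<otimes> h [^] (- c i x)"])
    show "\<forall>x\<in>carrier G. x \<otimes> h [^] c i x \<otimes> h [^] - c i (x \<otimes> h [^] c i x) = x"
      using h by (simp add: inv1 m_assoc int_pow_neg)
    show "\<forall>x\<in>carrier G. x \<otimes> h [^] - c i x \<otimes> h [^] c i (x \<otimes> h [^] - c i x) = x"
      using h by (simp add: inv1) (simp add: m_assoc int_pow_neg)
  qed (use h in auto)
qed

lemma d_dvd: "i \<in> I \<Longrightarrow> j \<in> I \<Longrightarrow> i \<le> j \<Longrightarrow> d j dvd d i"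
proof -
  assume i: "i \<in> I" and j: "j \<in> I" and ij: "i \<le> j"
  show ?thesis
  proof (cases "i \<le> n")
    case True then show ?thesis using d_zero[OF i] by simp
  next
    case False
    then obtain a b where ab: "d i = 2 ^ Suc a" "d j = 2 ^ Suc b" using d_two[OF i] d_two[OF j] ij by auto
    have "d j \<le> d i" using d_anti[of i j] False ij j by simp
    then have "(2::nat) ^ Suc b \<le> 2 ^ Suc a" using ab by simp
    then have "Suc b \<le> Suc a" by (subst (asm) power_increasing_iff) auto
    then show ?thesis unfolding ab by (rule le_imp_power_dvd)
  qed
qed

lemma d_dvd2:
  assumes i: "i \<in> I" and j: "j \<in> I" and ij: "i \<le> j" and ne: "d i \<noteq> d j"
  shows "2 * d j dvd d i"
proof (cases "i \<le> n")
  case True then show ?thesis using d_zero[OF i] by simp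
next
  case False
  then obtain a b where ab: "d i = 2 ^ Suc a" "d j = 2 ^ Suc b" using d_two[OF i] d_two[OF j] ij by auto
  have "d j \<le> d i" using d_anti[of i j] False ij j by simp
  then have "(2::nat) ^ Suc b < 2 ^ Suc a" using ab ne by simp
  then have "Suc b < Suc a" by (subst (asm) power_strict_increasing_iff) auto
  then have "Suc (Suc b) \<le> Suc a" by simp
  then have "(2::nat) ^ Suc (Suc b) dvd 2 ^ Suc a" by (rule le_imp_power_dvd)
  then show ?thesis unfolding ab by simp
qed

end

section \<open>Constraints imposed by transvections\<close>

locale basis_product = adapted_basis G n r e d + invariant_product G B
  for G :: "('a, 'b) monoid_scheme" (structure) and n r e d B
begin

abbreviation u :: "nat \<Rightarrow> nat \<Rightarrow> 'a" where "u j l \<equiv> B (e j) (e l)"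

lemma u_closed [simp]: "j \<in> I \<Longrightarrow> l \<in> I \<Longrightarrow> u j l \<in> carrier G"
  using e_closed by simp

lemma u_sym: "j \<in> I \<Longrightarrow> l \<in> I \<Longrightarrow> u j l = u l j"
  using e_closed B_sym by simp

lemma c_u_half:
  assumes "i \<in> I" "x \<in> carrier G" "y \<in> carrier G"
  shows "int (d i) dvd 2 * c i (B x y)"
proof -
  have "(c i (B x y) + c i (B x y)) mod int (d i) = 0"
    using c_mult[of "B x y" "B x y" i] B_sq[OF assms(2,3)] c_one[OF assms(1)] assms by simp
  then show ?thesis by (simp add: mod_eq_0_iff_dvd)
qed

lemma B_pow_even:
  assumes "x \<in> carrier G" "y \<in> carrier G" "even (m::nat)" shows "B (x [^] m) y = \<one>"
proof -
  have hom: "(\<lambda>x. B x y) \<in> hom G G" using assms by (auto intro!: homI simp: B_mult)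
  have "B (x [^] m) y = B x y [^] m"
  proof -
    interpret h: group_hom G G "\<lambda>x. B x y" by unfold_locales (rule hom)
    show ?thesis using h.hom_nat_pow[OF assms(1)] .
  qed
  moreover obtain k where "m = 2 * k" using assms(3) by (elim evenE)
  moreover have "B x y [^] (2::nat) = \<one>" using B_sq assms by (simp add: numeral_2_eq_2)
  ultimately show ?thesis using assms by (simp flip: nat_pow_pow)
qed

text \<open>The three lemmas that follow compare both sides of the invariance of \<open>B\<close> under a transvection at
  \<open>i\<close>, on two basis elements none, one, or both of which are \<open>e i\<close>.\<close>

lemma transvection_other:
  assumes i: "i \<in> I" and h: "h \<in> carrier G" "h [^] d i = \<one>" "c i h = 0"
    and j: "j \<in> I" "j \<noteq> i" and l: "l \<in> I" "l \<noteq> i"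
  shows "h [^] c i (u j l) = \<one>"
proof -
  have "u j l \<otimes> h [^] c i (u j l) = u j l \<otimes> \<one>"
    using B_aut[OF transvection_iso[OF i h] e_closed[OF j(1)] e_closed[OF l(1)]]
      i j l h e_closed by (simp add: c_e)
  then show ?thesis by (rule cancel_left) (use j l h in simp_all)
qed

lemma transvection_one:
  assumes i: "i \<in> I" and h: "h \<in> carrier G" "h [^] d i = \<one>" "c i h = 0"
    and l: "l \<in> I" "l \<noteq> i"
  shows "B h (e l) = h [^] c i (u i l)"
proof -
  have "u i l \<otimes> B h (e l) = u i l \<otimes> h [^] c i (u i l)"
    using B_aut[OF transvection_iso[OF i h] e_closed[OF i(1)] e_closed[OF l(1)]]
      i l h e_closed by (simp add: c_e B_mult)
  then show ?thesis by (rule cancel_left) (use i l h e_closed in simp_all)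
qed

lemma transvection_both:
  assumes i: "i \<in> I" and h: "h \<in> carrier G" "h [^] d i = \<one>" "c i h = 0"
  shows "B h h = h [^] c i (u i i)"
proof -
  have ei: "e i \<in> carrier G" by (rule e_closed[OF i])
  have "B (e i \<otimes> h) (e i \<otimes> h) = u i i \<otimes> h [^] c i (u i i)"
    using B_aut[OF transvection_iso[OF i h] ei ei] i h ei by (simp add: c_e)
  moreover have "B (e i \<otimes> h) (e i \<otimes> h) = u i i \<otimes> (B (e i) h \<otimes> B (e i) h) \<otimes> B h h"
    using ei h B_sym[OF h(1) ei] by (simp add: B_mult B_mult2 m_ac del: B_sq)
  ultimately have "u i i \<otimes> B h h = u i i \<otimes> h [^] c i (u i i)" using B_sq ei h by simp
  then show ?thesis by (rule cancel_left) (use ei h in simp_all)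
qed

text \<open>The transvection at \<open>i\<close> with \<open>h = e p\<close>, available as soon as the order of \<open>e p\<close> divides that of \<open>e i\<close>.\<close>

lemma u_exchange:
  assumes "i \<in> I" "p \<in> I" "p \<noteq> i" "d p dvd d i"
  shows "l \<in> I \<Longrightarrow> l \<noteq> i \<Longrightarrow> u p l = e p [^] c i (u i l)" "u p p = e p [^] c i (u i i)"
proof -
  obtain m where "d i = d p * m" using assms(4) by (elim dvdE)
  then have "e p [^] d i = \<one>" using e_pow[OF assms(2)] e_closed[OF assms(2)] by (simp flip: nat_pow_pow)
  moreover have "c i (e p) = 0" using c_e assms by simp
  ultimately show "l \<in> I \<Longrightarrow> l \<noteq> i \<Longrightarrow> u p l = e p [^] c i (u i l)" "u p p = e p [^] c i (u i i)"
    using transvection_one[OF assms(1) e_closed[OF assms(2)]]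
      transvection_both[OF assms(1) e_closed[OF assms(2)]] by auto
qed

text \<open>The value \<open>u i l\<close> is an involution, so its \<open>i\<close>-th coordinate is half of \<open>d i\<close> or zero; if the order of
  \<open>e p\<close> divides this half, the exchange relation leaves nothing.\<close>

lemma u_eq_one:
  assumes i: "i \<in> I" and p: "p \<in> I" "p \<noteq> i" and dd: "2 * d p dvd d i" and l: "l \<in> I" "l \<noteq> i"
  shows "u p l = \<one>"
proof -
  have "d p dvd d i" using dd by (rule dvd_mult_right)
  then have "u p l = e p [^] c i (u i l)" using u_exchange(1)[OF i p] l by simp
  moreover have "int (2 * d p) dvd 2 * c i (u i l)"
    using c_u_half[OF i e_closed[OF i] e_closed[OF l(1)]] dd by (meson dvd_trans of_nat_dvd_iff)
  ultimately show ?thesis using e_pow_int[OF p(1)] by simp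
qed

text \<open>Between basis elements of the same order, the transvection moves the involution below \<open>e i\<close>; a value
  that does not involve \<open>e i\<close> as an argument has to be fixed.\<close>

lemma c_u_eq_zero_twin:
  assumes i: "i \<in> I" and p: "p \<in> I" "p \<noteq> i" "d p = d i"
    and j: "j \<in> I" "j \<noteq> i" and l: "l \<in> I" "l \<noteq> i"
  shows "c i (u j l) = 0"
proof -
  have "e p [^] c i (u j l) = \<one>"
    using transvection_other[OF i e_closed[OF p(1)] _ _ j l] e_pow[OF p(1)] c_e[OF i p(1)] p by simp
  then have "int (d i) dvd c i (u j l)" using e_pow_eq_one_iff[OF p(1)] p by simp
  then show ?thesis by (rule c_eq_zero_if_dvd)
qed

text \<open>A suitable even power \<open>h\<close> of \<open>e p\<close> gives a transvection at \<open>i\<close> that is trivial modulo squares and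
  hence does not affect the arguments of \<open>B\<close>, but does move the involution below \<open>e i\<close>. Consequently
  all values of \<open>B\<close> lie in the span of the involutions below the basis elements of largest finite order.\<close>

lemma c_u_eq_zero_lower:
  assumes i: "i \<in> I" and p: "p \<in> I" "d p > 0" "2 * d i dvd d p"
    and j: "j \<in> I" and l: "l \<in> I"
  shows "c i (u j l) = 0"
proof -
  obtain s where s: "d p = 2 * d i * s" using p by (elim dvdE)
  have di: "d i > 0" using s p by (cases "d i = 0") auto
  have pi: "p \<noteq> i" using s p by auto
  define h where "h = e p [^] (2 * s)"
  have ep: "e p \<in> carrier G" by (rule e_closed[OF p(1)])
  have h: "h \<in> carrier G" "h [^] d i = \<one>" "c i h = 0"
    using ep e_pow[OF p(1)] s c_nat_pow[OF ep i] c_e[OF i p(1)] pi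
    by (simp_all add: h_def nat_pow_pow mult.commute mult.left_commute)
  have ev: "B h y = \<one>" if "y \<in> carrier G" for y
    unfolding h_def using ep that by (intro B_pow_even) auto
  have "h [^] c i (u j l) = \<one>"
  proof (cases "j = i"; cases "l = i")
    assume "j = i" "l = i"
    then show ?thesis using transvection_both[OF i h] ev h by simp
  next
    assume "j = i" "l \<noteq> i"
    then show ?thesis using transvection_one[OF i h l] ev e_closed[OF l] by simp
  next
    assume "j \<noteq> i" "l = i"
    then show ?thesis using transvection_one[OF i h j] ev e_closed[OF j] u_sym[OF i j] by simp
  next
    assume "j \<noteq> i" "l \<noteq> i"
    then show ?thesis using transvection_other[OF i h j _ l] by simp
  qed
  then have "e p [^] (int (2 * s) * c i (u j l)) = \<one>"
    using ep by (simp add: h_def int_pow_pow flip: int_pow_int)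
  then have "int (d p) dvd int (2 * s) * c i (u j l)" using e_pow_eq_one_iff[OF p(1)] by blast
  moreover have "int (d p) = int (2 * s) * int (d i)" using s by simp
  ultimately have "int (d i) dvd c i (u j l)" using p(2) by (cases "s = 0") auto
  then show ?thesis by (rule c_eq_zero_if_dvd)
qed

end

section \<open>Upper bounds for the space of invariant products\<close>

context adapted_basis
begin

text \<open>The index of the first basis element of finite order; \<open>D\<close> is the largest finite order.\<close>

abbreviation t :: nat where "t \<equiv> Suc n"

abbreviation D :: nat where "D \<equiv> d (Suc n)"

text \<open>Only one basis element has the largest finite order (vacuously also when none has finite order).\<close>

definition unique_top :: bool where "unique_top \<longleftrightarrow> (Suc t \<le> r \<longrightarrow> d (Suc t) \<noteq> D)"

lemma t_in: "n < r \<Longrightarrow> t \<in> I" by simp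

lemma D_pos: "n < r \<Longrightarrow> D > 0" using d_zero[of t] by auto

lemma D_even: "n < r \<Longrightarrow> even D" using d_even t_in by blast

lemma lower_dvd:
  assumes "i \<in> I" "n < i" "d i \<noteq> D" shows "2 * d i dvd D"
  using d_dvd2[of t i] assms t_in by auto

lemma unique_topD: "unique_top \<Longrightarrow> i \<in> I \<Longrightarrow> n < i \<Longrightarrow> i \<noteq> t \<Longrightarrow> d i \<noteq> D"
proof -
  assume u: unique_top and i: "i \<in> I" "n < i" "i \<noteq> t"
  then have i2: "Suc t \<le> i" "Suc t \<in> I" by auto
  have "d i \<le> d (Suc t)" using d_anti[of "Suc t" i] i i2 by simp
  moreover have "d (Suc t) \<le> D" using d_anti[of t "Suc t"] i2 by simp
  moreover have "d (Suc t) \<noteq> D" using u i2 by (simp add: unique_top_def)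
  ultimately show ?thesis by simp
qed

lemma unique_top_cases:
  obtains "unique_top" | "Suc t \<in> I" "d (Suc t) = D"
  unfolding unique_top_def by fastforce

lemma half_cases:
  assumes i: "i \<in> I" "d i = D" "n < r" and h: "int D dvd 2 * c i x"
  shows "c i x = 0 \<or> c i x = int (D div 2)"
proof -
  have D: "D > 0" using D_pos i by simp
  obtain s where s: "2 * c i x = int D * s" using h by (elim dvdE)
  have "0 \<le> c i x \<and> c i x < int D" using c_mod[of i x] i D
    by (metis of_nat_0_less_iff pos_mod_bound pos_mod_sign)
  then have "0 \<le> int D * s \<and> int D * s < int D * 2" using s by linarith
  then have "0 \<le> s \<and> s < 2"
    using D mult_less_cancel_left_pos[of "int D" s 2] zero_le_mult_iff[of "int D" s] by linarith
  then have "s = 0 \<or> s = 1" by auto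
  moreover obtain k where "D = 2 * k" using D_even[OF i(3)] by (elim evenE)
  ultimately show ?thesis using s by auto
qed

end

context basis_product
begin

lemma c_u_infinite: "i \<in> I \<Longrightarrow> i \<le> n \<Longrightarrow> j \<in> I \<Longrightarrow> l \<in> I \<Longrightarrow> c i (u j l) = 0"
  using c_u_half[of i "e j" "e l"] d_zero[of i] e_closed by simp

lemma c_u_lower: "i \<in> I \<Longrightarrow> n < i \<Longrightarrow> d i \<noteq> D \<Longrightarrow> j \<in> I \<Longrightarrow> l \<in> I \<Longrightarrow> c i (u j l) = 0"
  using c_u_eq_zero_lower[of i t] t_in D_pos lower_dvd[of i] by auto

lemma c_u_not_top: "i \<in> I \<Longrightarrow> d i \<noteq> D \<Longrightarrow> j \<in> I \<Longrightarrow> l \<in> I \<Longrightarrow> c i (u j l) = 0"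
  using c_u_infinite c_u_lower by (cases "i \<le> n") auto

lemma u_eq_oneI:
  assumes "j \<in> I" "l \<in> I" "\<And>i. i \<in> I \<Longrightarrow> n < i \<Longrightarrow> d i = D \<Longrightarrow> c i (u j l) = 0"
  shows "u j l = \<one>"
  using assms c_u_infinite c_u_lower c_one by (intro c_eqI) (auto simp: not_le, metis One_nat_def atLeastAtMost_iff not_le)

lemma c_u_top_cases:
  assumes "i \<in> I" "n < i" "d i = D" "j \<in> I" "l \<in> I"
  shows "c i (u j l) = 0 \<or> c i (u j l) = int (D div 2)"
  using half_cases[of i "u j l"] c_u_half[of i "e j" "e l"] assms e_closed by auto

lemma u_unique_top:
  assumes top: unique_top and n: "n < r" and j: "j \<in> I" and l: "l \<in> I"
  shows "u j l = e t [^] c t (u j l)"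
proof (rule c_eqI)
  fix i assume i: "i \<in> I"
  show "c i (u j l) = c i (e t [^] c t (u j l))"
  proof (cases "i = t")
    case False
    then have "c i (u j l) = 0"
      using c_u_infinite[OF i _ j l] c_u_lower[OF i _ _ j l] unique_topD[OF top i] by (cases "i \<le> n") auto
    then show ?thesis using c_e_pow[OF i t_in[OF n]] False by simp
  qed (use c_e_pow[OF i t_in[OF n]] in simp)
qed (use j l e_closed[OF t_in[OF n]] in auto)

lemma u_no_torsion: "r = n \<Longrightarrow> j \<in> I \<Longrightarrow> l \<in> I \<Longrightarrow> u j l = \<one>"
  by (rule u_eq_oneI) auto

text \<open>The value lies in the span of the involutions below several basis elements of order \<open>D\<close>, and the
  transvections among these leave no nontrivial element of this span fixed.\<close>

lemma u_infinite:
  assumes top: "\<not> unique_top" and j: "j \<in> I" "j \<le> n" and l: "l \<in> I" "l \<le> n"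
  shows "u j l = \<one>"
proof (rule u_eq_oneI[OF j(1) l(1)])
  fix i assume i: "i \<in> I" "n < i" "d i = D"
  have t2: "Suc t \<in> I" "d (Suc t) = D" using top by (auto simp: unique_top_def)
  define p where "p = (if i = t then Suc t else t)"
  have "p \<in> I" "p \<noteq> i" "d p = d i" using i t2 by (auto simp: p_def)
  then show "c i (u j l) = 0" using c_u_eq_zero_twin[of i p j l] i j l by auto
qed

text \<open>Some basis element of infinite order differs from both \<open>e p\<close> and \<open>e l\<close>, and a transvection there
  kills \<open>u p l\<close>.\<close>

lemma u_rank_three:
  assumes "3 \<le> n" and p: "p \<in> I" and l: "l \<in> I"
  shows "u p l = \<one>"
proof -
  have "\<exists>i\<in>{1,2,3}. i \<noteq> p \<and> i \<noteq> l" by auto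
  then obtain i where i: "i \<in> {1,2,3}" "p \<noteq> i" "l \<noteq> i" by auto
  then have "i \<in> I" "d i = 0" using assms n_le d_zero[of i] by auto
  then show ?thesis using u_eq_one[of i p l] i p l by simp
qed

lemma u_rank_two:
  assumes "n = 2" and p: "p \<in> I" and l: "l \<in> I" and "(p, l) \<noteq> (1, 2)" "(p, l) \<noteq> (2, 1)"
  shows "u p l = \<one>"
proof -
  have "\<exists>i\<in>{1,2}. i \<noteq> p \<and> i \<noteq> l" using assms by auto
  then obtain i where i: "i \<in> {1,2}" "p \<noteq> i" "l \<noteq> i" by auto
  then have "i \<in> I" "d i = 0" using assms n_le d_zero[of i] by auto
  then show ?thesis using u_eq_one[of i p l] i p l by simp
qed

lemma u_rank_one_finite:
  assumes "n = 1" and p: "p \<in> I" "p \<noteq> 1" and l: "l \<in> I" "l \<noteq> 1"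
  shows "u p l = \<one>"
  using u_eq_one[of 1 p l] assms n_le d_zero[of 1] by auto

lemma u_rank_one_lower:
  assumes "n = 1" and p: "p \<in> I" "p \<noteq> 1" "d p \<noteq> D"
  shows "u p 1 = \<one>"
proof -
  have t: "t \<in> I" using p assms by auto
  have "2 * d p dvd D" using lower_dvd[of p] p assms by auto
  then show ?thesis using u_eq_one[of t p 1] t p assms by auto
qed

text \<open>One parameter \<open>\<beta>\<close> governs all the values \<open>u p 1\<close>: transvections between the \<open>e p\<close> of order \<open>D\<close> force
  each value into the span of \<open>e p\<close> alone and make the coefficients equal.\<close>

lemma u_rank_one_top:
  assumes n: "n = 1" and r: "1 < r"
  obtains \<beta> where "\<beta> = 0 \<or> \<beta> = int (D div 2)"
    "\<And>p. p \<in> I \<Longrightarrow> p \<noteq> 1 \<Longrightarrow> d p = D \<Longrightarrow> u p 1 = e p [^] \<beta>"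
proof -
  have t: "t \<in> I" "1 \<in> I" "t \<noteq> 1" using n r by auto
  define \<beta> where "\<beta> = c t (u t 1)"
  have b: "\<beta> = 0 \<or> \<beta> = int (D div 2)" unfolding \<beta>_def using c_u_top_cases[of t t 1] t by simp
  have other: "u p 1 = e p [^] \<beta>" if p: "p \<in> I" "p \<noteq> 1" "d p = D" "p \<noteq> t" for p
    using u_exchange(1)[of t p 1] p t by (simp add: \<beta>_def)
  have "u t 1 = e t [^] \<beta>"
  proof (cases rule: unique_top_cases)
    case 1
    show ?thesis using u_unique_top[OF 1 _ t(1,2)] n r by (simp add: \<beta>_def)
  next
    case 2
    have "u t 1 = e t [^] c (Suc t) (u (Suc t) 1)"
      using u_exchange(1)[of "Suc t" t 1] 2 t by auto
    moreover have "u (Suc t) 1 = e (Suc t) [^] \<beta>" using other[of "Suc t"] 2 n by simp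
    moreover have "c (Suc t) (e (Suc t) [^] \<beta>) = \<beta>"
      using c_e_pow[OF 2(1) 2(1), of \<beta>] 2(2) c_mod[of t "u t 1"] by (simp add: \<beta>_def)
    ultimately show ?thesis by simp
  qed
  then show thesis using that[OF b] other by metis
qed

lemma e_not_one: "i \<in> I \<Longrightarrow> e i \<noteq> \<one>"
  using c_e[of i i] c_one[of i] by auto

text \<open>Otherwise \<open>e i\<close> itself would be a product, hence annihilate everything, and \<open>e i = u i l\<close> would be
  trivial. This is what rules out products when the largest finite order is two.\<close>

lemma u_not_basis:
  assumes "i \<in> I" "l \<in> I" shows "u i l \<noteq> e i"
proof
  assume "u i l = e i"
  then have "u l i = \<one>" using B_nil[of "e l" "e i" "e l"] e_closed assms by simp
  then show False using \<open>u i l = e i\<close> u_sym[OF assms] e_not_one[OF assms(1)] by simp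
qed

text \<open>For distinct \<open>p\<close> and \<open>l\<close> a third basis element of order \<open>D\<close> puts \<open>u p l\<close> both in the span of \<open>e p\<close> and,
  by symmetry, in the span of \<open>e l\<close>. The diagonal values are then exchanged for off-diagonal ones.\<close>

lemma u_rank_zero_three:
  assumes n: "n = 0" and r: "3 \<le> r" "d 3 = D" and p: "p \<in> I" and l: "l \<in> I"
  shows "u p l = \<one>"
proof -
  have top: "i \<in> I \<and> d i = D" if "i \<in> {1,2,3}" for i
    using d_anti[of i 3] d_anti[of 1 i] that r n by auto
  have dd: "d p dvd D" if "p \<in> I" for p using d_dvd[of 1 p] that n by auto
  have ne: "u p l = \<one>" if p: "p \<in> I" and l: "l \<in> I" and "p \<noteq> l" for p l
  proof -
    have "\<exists>i\<in>{1,2,3}. i \<noteq> p \<and> i \<noteq> l" by auto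
    then obtain i where i: "i \<in> {1,2,3}" "p \<noteq> i" "l \<noteq> i" by auto
    have iI: "i \<in> I" and di: "d i = D" using top[OF i(1)] by auto
    have "d p dvd d i" "d l dvd d i" using dd p l di by simp_all
    then have "u p l = e p [^] c i (u i l)" "u l p = e l [^] c i (u i p)"
      using u_exchange(1)[OF iI p i(2) _ l i(3)] u_exchange(1)[OF iI l i(3) _ p i(2)] by simp_all
    then have "c q (u p l) = 0" if "q \<in> I" for q
      using c_e_pow[OF that p, of "c i (u i l)"] c_e_pow[OF that l, of "c i (u i p)"]
        u_sym[OF p l] \<open>p \<noteq> l\<close> by (cases "q = p") auto
    then show ?thesis by (intro u_eq_oneI p l)
  qed
  show ?thesis
  proof (cases "p = l")
    case True
    have "\<exists>i\<in>{1,2,3}. p \<noteq> i" by auto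
    then obtain i where i: "i \<in> {1,2,3}" "p \<noteq> i" by blast
    have iI: "i \<in> I" and di: "d i = D" using top[OF i(1)] by auto
    have "d p dvd d i" using dd[OF p] di by simp
    from u_exchange(1)[OF iI p i(2) this p i(2)] have "u p p = e p [^] c i (u i p)" .
    moreover have "u i p = \<one>" by (rule ne[OF iI p i(2)[symmetric]])
    moreover have "c i \<one> = 0" by (rule c_one[OF iI])
    ultimately have "u p p = \<one>" by simp
    then show ?thesis using True by simp
  qed (use ne p l in simp)
qed

lemma u_rank_zero_two_lower:
  assumes n: "n = 0" and top: "2 \<le> r" "d 2 = D" and p: "p \<in> I" "d p \<noteq> D" and l: "l \<in> I"
  shows "u p l = \<one>"
proof -
  have "\<exists>i\<in>{1,2}. l \<noteq> i" by auto
  then obtain i where i: "i \<in> {1,2}" "l \<noteq> i" by blast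
  have di: "i \<in> I" "d i = D" "p \<noteq> i" using i top p n by auto
  have "2 * d p dvd D" using lower_dvd[of p] p n by auto
  then show ?thesis using u_eq_one[of i p l] di p l i by simp
qed

text \<open>The transvections between \<open>e 1\<close> and \<open>e 2\<close> generate the group of order six that permutes the three
  involutions below them. Equivariance leaves one nontrivial candidate: \<open>B\<close> maps equal classes to the
  corresponding involution and distinct classes to the product of the two involutions.\<close>

lemma u_rank_zero_two:
  assumes n: "n = 0" and top: "2 \<le> r" "d 2 = D" "3 \<le> r \<longrightarrow> d 3 \<noteq> D"
  obtains \<beta> where "\<beta> = 0 \<or> \<beta> = int (D div 2)"
    "u 1 1 = e 1 [^] \<beta>" "u 2 2 = e 2 [^] \<beta>" "u 1 2 = e 1 [^] \<beta> \<otimes> e 2 [^] \<beta>"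
proof -
  have I12: "1 \<in> I" "2 \<in> I" "d 1 = D" using n top by auto
  define \<beta> where "\<beta> = c 1 (u 1 1)"
  have b: "\<beta> = 0 \<or> \<beta> = int (D div 2)" unfolding \<beta>_def using c_u_top_cases[of 1 1 1] I12 n by simp
  have bm: "\<beta> mod int D = \<beta>" using c_mod[of 1 "u 1 1"] unfolding \<beta>_def I12(3) .
  have u22: "u 2 2 = e 2 [^] \<beta>" using u_exchange(2)[of 1 2] I12 top by (simp add: \<beta>_def)
  have u11: "u 1 1 = e 1 [^] \<beta>"
    using u_exchange(2)[of 2 1] I12 top c_e_pow[of 2 2 \<beta>] u22 bm by simp
  have "u 2 2 = e 2 [^] c 1 (u 1 2)" "u 1 1 = e 1 [^] c 2 (u 2 1)"
    using u_exchange(1)[of 1 2 2] u_exchange(1)[of 2 1 1] I12 top by simp_all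
  then have "c 2 (e 2 [^] \<beta>) = c 2 (e 2 [^] c 1 (u 1 2))" "c 1 (e 1 [^] \<beta>) = c 1 (e 1 [^] c 2 (u 1 2))"
    using u11 u22 u_sym[OF I12(1,2)] by simp_all
  moreover have "c 1 (u 1 2) mod int D = c 1 (u 1 2)" using c_mod[of 1 "u 1 2"] unfolding I12(3) .
  moreover have "c 2 (u 1 2) mod int D = c 2 (u 1 2)" using c_mod[of 2 "u 1 2"] unfolding top(2) .
  ultimately have c12: "c 1 (u 1 2) = \<beta>" "c 2 (u 1 2) = \<beta>"
    using c_e_pow[of 2 2] c_e_pow[of 1 1] I12 top(1,2) bm by simp_all
  have "u 1 2 = e 1 [^] \<beta> \<otimes> e 2 [^] \<beta>"
  proof (rule c_eqI)
    fix i assume i: "i \<in> I"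
    have low: "c i (u 1 2) = 0" if "i \<noteq> 1" "i \<noteq> 2"
    proof -
      have "d i \<noteq> D" using top d_anti[of 3 i] d_anti[of 1 3] i that n by auto
      then show ?thesis using c_u_not_top[OF i] I12 by blast
    qed
    have "c i (e 1 [^] \<beta> \<otimes> e 2 [^] \<beta>) =
        ((if i = 1 then \<beta> mod int (d i) else 0) + (if i = 2 then \<beta> mod int (d i) else 0)) mod int (d i)"
      using c_mult[OF _ _ i, of "e 1 [^] \<beta>" "e 2 [^] \<beta>"] c_e_pow[OF i I12(1)] c_e_pow[OF i I12(2)]
        e_closed I12 by simp
    then show "c i (u 1 2) = c i (e 1 [^] \<beta> \<otimes> e 2 [^] \<beta>)"
      using low c12 bm I12 top by (cases "i = 1"; cases "i = 2") auto
  qed (use e_closed I12 in auto)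
  then show thesis using that b u11 u22 by blast
qed

lemma u_rank_zero_one_other:
  assumes n: "n = 0" and top: unique_top and p: "p \<in> I" "p \<noteq> 1" and l: "l \<in> I" "l \<noteq> 1"
  shows "u p l = \<one>"
proof -
  have "2 * d p dvd D" using lower_dvd[of p] unique_topD[OF top] p n by auto
  then show ?thesis using u_eq_one[of 1 p l] p l n by auto
qed

lemma u_rank_zero_one_first:
  assumes n: "n = 0" and top: unique_top and p: "p \<in> I" "p \<noteq> 1"
    and i: "i \<in> I" "i \<noteq> 1" "i \<noteq> p" "d p dvd d i"
  shows "u p 1 = \<one>"
proof -
  have I1: "1 \<in> I" using p by auto
  have "u p 1 = e p [^] c i (u i 1)" using u_exchange(1)[of i p 1] p i I1 by auto
  moreover have "c i (u i 1) = 0"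
    using c_u_not_top[OF i(1)] unique_topD[OF top i(1)] i I1 n by auto
  ultimately show ?thesis by simp
qed

text \<open>The map \<open>x \<mapsto> x \<otimes> x \<otimes> B x x\<close> is additive because \<open>B\<close> takes involutions as values, so it suffices to
  check the basis. If it is trivial, the circle group has exponent two, whereas \<open>G\<close> has an element of
  order four. This is what rules out products with nontrivial squares when the largest order is four.\<close>

lemma not_in_HH_if_square:
  assumes n: "n = 0" and D: "D = 4" "0 < r" and sq: "\<And>j. j \<in> I \<Longrightarrow> e j \<otimes> e j \<otimes> u j j = \<one>"
  shows "circ_set G B \<notin> HH G"
proof
  assume HH: "circ_set G B \<in> HH G"
  have all: "x \<otimes> x \<otimes> B x x = \<one>" if x: "x \<in> carrier G" for x
  proof -
    have "(\<lambda>x. x \<otimes> x \<otimes> B x x) \<in> hom G G"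
    proof (rule homI)
      fix x y assume xy: "x \<in> carrier G" "y \<in> carrier G"
      have "x \<otimes> y \<otimes> (x \<otimes> y) \<otimes> B (x \<otimes> y) (x \<otimes> y) = x \<otimes> x \<otimes> B x x \<otimes> (y \<otimes> y \<otimes> B y y) \<otimes> (B x y \<otimes> B x y)"
        using xy B_sym[OF xy] by (simp add: B_mult B_mult2 m_ac del: B_sq)
      then show "x \<otimes> y \<otimes> (x \<otimes> y) \<otimes> B (x \<otimes> y) (x \<otimes> y) = x \<otimes> x \<otimes> B x x \<otimes> (y \<otimes> y \<otimes> B y y)"
        using xy B_sq by simp
    qed simp
    moreover have "(\<lambda>x. \<one>) \<in> hom G G" by (auto intro: homI)
    ultimately show ?thesis using hom_eq_on_basis[of "\<lambda>x. x \<otimes> x \<otimes> B x x" "\<lambda>x. \<one>" x] sq x by simp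
  qed
  have I1: "1 \<in> I" using D by auto
  have "e 1 \<otimes> e 1 = \<one>"
    using HH all e_closed[OF I1] unfolding HH_def regular_subgroup_def
    by (intro exponent_two_if_square_eq_product) auto
  then have "e 1 [^] (2::int) = \<one>" using int_pow_int[of G "e 1" 2] e_closed[OF I1] by (simp add: numeral_2_eq_2)
  then show False using e_pow_eq_one_iff[OF I1] D n by simp
qed

end

section \<open>Diagonal and alternating forms\<close>

context comm_group
begin

lemma involution_pow:
  assumes "w \<in> carrier G" "w \<otimes> w = \<one>" shows "w [^] (k::int) = (if odd k then w else \<one>)"
proof (cases "odd k")
  case True
  then have "w [^] k = w [^] (1::int)" using assms by (intro int_pow_parity) auto
  then show ?thesis using True assms by simp
next
  case False
  then have "w [^] k = w [^] (0::int)" using assms by (intro int_pow_parity) auto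
  then show ?thesis using False by simp
qed

end

context adapted_basis
begin

lemma c_mult_parity:
  assumes "x \<in> carrier G" "y \<in> carrier G" "i \<in> I"
  shows "even (c i (x \<otimes> y) - (c i x + c i y))"
proof -
  let ?s = "c i x + c i y"
  have "c i (x \<otimes> y) - ?s = - (int (d i) * (?s div int (d i)))"
    using c_mult[OF assms] minus_mult_div_eq_mod[of ?s "int (d i)"] by linarith
  then show ?thesis using d_even[OF assms(3)] by simp
qed

lemma even_on_basis:
  fixes \<phi> :: "'a \<Rightarrow> int"
  assumes add: "\<And>x y. x \<in> carrier G \<Longrightarrow> y \<in> carrier G \<Longrightarrow> even (\<phi> (x \<otimes> y) - (\<phi> x + \<phi> y))"
    and base: "\<And>j. j \<in> I \<Longrightarrow> even (\<phi> (e j))" and x: "x \<in> carrier G"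
  shows "even (\<phi> x)"
proof (rule basis_induct[OF _ _ _ _ x])
  have one: "even (\<phi> \<one>)" using add[of \<one> \<one>] by simp
  then show "even (\<phi> \<one>)" .
  show "even (\<phi> (x \<otimes> y))" if "x \<in> carrier G" "y \<in> carrier G" "even (\<phi> x)" "even (\<phi> y)" for x y
    using add[of x y] that by simp
  show "even (\<phi> (inv x))" if "x \<in> carrier G" "even (\<phi> x)" for x
    using add[of x "inv x"] that one by simp
qed (rule base)

lemma c_aut_mult_parity:
  assumes \<alpha>: "\<alpha> \<in> iso G G" and "x \<in> carrier G" "y \<in> carrier G" "i \<in> I"
  shows "even (c i (\<alpha> (x \<otimes> y)) - (c i (\<alpha> x) + c i (\<alpha> y)))"
proof -
  have h: "\<alpha> \<in> hom G G" using \<alpha> by (simp add: iso_def)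
  show ?thesis using c_mult_parity[of "\<alpha> x" "\<alpha> y" i] hom_mult[OF h, of x y] assms hom_in_carrier[OF h] by simp
qed

text \<open>If the order of \<open>e j\<close> is at most half that of \<open>e a\<close>, any element killed by \<open>d j\<close> has an even coordinate at \<open>a\<close>.\<close>

lemma c_aut_even:
  assumes \<alpha>: "\<alpha> \<in> iso G G" and j: "j \<in> I" "d j > 0" and a: "a \<in> I" and dd: "2 * d j dvd d a"
  shows "even (c a (\<alpha> (e j)))"
proof -
  have h: "\<alpha> \<in> hom G G" using \<alpha> by (simp add: iso_def)
  interpret h: group_hom G G \<alpha> by unfold_locales (rule h)
  have ej: "e j \<in> carrier G" by (rule e_closed[OF j(1)])
  have "\<alpha> (e j) [^] d j = \<one>" using h.hom_nat_pow[OF ej, of "d j"] e_pow[OF j(1)] by simp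
  then have "(int (d j) * c a (\<alpha> (e j))) mod int (d a) = 0"
    using c_nat_pow[of "\<alpha> (e j)" a "d j"] c_one[OF a] a ej by simp
  then have "int (d a) dvd int (d j) * c a (\<alpha> (e j))" by (simp add: mod_eq_0_iff_dvd)
  then have "int (2 * d j) dvd int (d j) * c a (\<alpha> (e j))" using dd by (meson dvd_trans of_nat_dvd_iff)
  then show ?thesis using j(2) by (simp add: mult.commute)
qed

text \<open>The involutions (and the identity) below elements of order \<open>D\<close>. The description by powers shows at
  once that \<open>Z\<close> is characteristic.\<close>

definition Z :: "'a set" where "Z = {y [^] (D div 2) | y. y \<in> carrier G \<and> y [^] D = \<one>}"

text \<open>For \<open>e i\<close> of order \<open>D\<close> this is the involution below \<open>e i\<close>; it is trivial for smaller finite orders.\<close>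

definition w :: "nat \<Rightarrow> 'a" where "w i = e i [^] (D div 2)"

lemma Z_memI: "y \<in> carrier G \<Longrightarrow> y [^] D = \<one> \<Longrightarrow> y [^] (D div 2) \<in> Z"
  unfolding Z_def by blast

lemma Z_memE:
  assumes "z \<in> Z" obtains y where "y \<in> carrier G" "y [^] D = \<one>" "z = y [^] (D div 2)"
  using assms unfolding Z_def by blast

lemma Z_subgroup: "subgroup Z G"
proof (rule subgroupI)
  show "Z \<subseteq> carrier G" unfolding Z_def by auto
  show "Z \<noteq> {}" using Z_memI[of \<one>] by auto
  show "inv z \<in> Z" if "z \<in> Z" for z
  proof -
    obtain y where y: "y \<in> carrier G" "y [^] D = \<one>" "z = y [^] (D div 2)" using \<open>z \<in> Z\<close> by (rule Z_memE)
    have "inv z = (inv y) [^] (D div 2)" using y by (simp add: nat_pow_inv)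
    then show ?thesis using Z_memI[of "inv y"] y by (simp add: nat_pow_inv)
  qed
  show "z \<otimes> z' \<in> Z" if "z \<in> Z" "z' \<in> Z" for z z'
  proof -
    obtain y where y: "y \<in> carrier G" "y [^] D = \<one>" "z = y [^] (D div 2)" using \<open>z \<in> Z\<close> by (rule Z_memE)
    obtain y' where y': "y' \<in> carrier G" "y' [^] D = \<one>" "z' = y' [^] (D div 2)" using \<open>z' \<in> Z\<close> by (rule Z_memE)
    have "z \<otimes> z' = (y \<otimes> y') [^] (D div 2)" using y y' by (simp add: nat_pow_distrib)
    then show ?thesis using Z_memI[of "y \<otimes> y'"] y y' by (simp add: nat_pow_distrib)
  qed
qed

lemma Z_carrier: "z \<in> Z \<Longrightarrow> z \<in> carrier G"
  using subgroup.subset[OF Z_subgroup] by blast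

lemma Z_char:
  assumes \<alpha>: "\<alpha> \<in> iso G G" and z: "z \<in> Z" shows "\<alpha> z \<in> Z"
proof -
  have h: "\<alpha> \<in> hom G G" using \<alpha> by (simp add: iso_def)
  interpret h: group_hom G G \<alpha> by unfold_locales (rule h)
  obtain y where y: "y \<in> carrier G" "y [^] D = \<one>" "z = y [^] (D div 2)" using z by (rule Z_memE)
  have "\<alpha> y [^] D = \<one>" "\<alpha> z = \<alpha> y [^] (D div 2)"
    using h.hom_nat_pow[OF y(1), of D] h.hom_nat_pow[OF y(1), of "D div 2"] y by simp_all
  then show ?thesis using Z_memI[of "\<alpha> y"] y by simp
qed

lemma Z_sq:
  assumes "n < r" "z \<in> Z" shows "z \<otimes> z = \<one>"
proof -
  obtain y where y: "y \<in> carrier G" "y [^] D = \<one>" "z = y [^] (D div 2)" using assms(2) by (rule Z_memE)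
  have "D div 2 + D div 2 = D" using D_even[OF assms(1)] by (metis mult_2 dvd_mult_div_cancel)
  then show ?thesis using y nat_pow_mult[OF y(1), of "D div 2" "D div 2"] by simp
qed

lemma Z_coord_infinite: "n < r \<Longrightarrow> z \<in> Z \<Longrightarrow> i \<in> I \<Longrightarrow> i \<le> n \<Longrightarrow> c i z = 0"
proof -
  assume z: "n < r" "z \<in> Z" "i \<in> I" "i \<le> n"
  have "c i (z \<otimes> z) = 0" using Z_sq z c_one by simp
  then show ?thesis using c_mult[of z z i] Z_carrier z d_zero[of i] by simp
qed

lemma Z_coord_dvd:
  assumes z: "z \<in> Z" and i: "i \<in> I" and v: "v dvd D div 2" "v dvd d i"
  shows "int v dvd c i z"
proof -
  obtain y where y: "y \<in> carrier G" "y [^] D = \<one>" "z = y [^] (D div 2)" using z by (rule Z_memE)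
  have "c i z = (int (D div 2) * c i y) mod int (d i)" using c_nat_pow[OF y(1) i] y(3) by simp
  moreover have "int v dvd int (D div 2)" "int v dvd int (d i)" using v by (simp_all only: of_nat_dvd_iff)
  ultimately show ?thesis by (simp add: dvd_mod)
qed

lemma w_in_Z: "i \<in> I \<Longrightarrow> d i dvd D \<Longrightarrow> w i \<in> Z"
proof -
  assume i: "i \<in> I" "d i dvd D"
  then obtain m where "D = d i * m" by (elim dvdE)
  then have "e i [^] D = \<one>" using e_pow[OF i(1)] e_closed[OF i(1)] by (simp flip: nat_pow_pow)
  then show ?thesis unfolding w_def using Z_memI e_closed i by blast
qed

lemma c_w: "j \<in> I \<Longrightarrow> i \<in> I \<Longrightarrow> c j (w i) = (if j = i then int (D div 2) mod int (d i) else 0)"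
  unfolding w_def using c_e_pow[of j i "int (D div 2)"] by (auto simp: int_pow_int)

lemma w_eq_one_iff: "i \<in> I \<Longrightarrow> w i = \<one> \<longleftrightarrow> d i dvd D div 2"
  unfolding w_def using e_pow_eq_one_iff[of i "int (D div 2)"] by (simp add: int_pow_int)

lemma w_top_not_one: "i \<in> I \<Longrightarrow> n < r \<Longrightarrow> d i = D \<Longrightarrow> w i \<noteq> \<one>"
proof -
  assume i: "i \<in> I" "n < r" "d i = D"
  obtain k where k: "D = 2 * k" using D_even[OF i(2)] by (elim evenE)
  then have "k > 0" using D_pos[OF i(2)] by simp
  then have "\<not> D dvd D div 2" using k by (simp add: nat_dvd_not_less)
  then show ?thesis using w_eq_one_iff[OF i(1)] i by simp
qed

lemma w_lower: "i \<in> I \<Longrightarrow> n < i \<Longrightarrow> d i \<noteq> D \<Longrightarrow> w i = \<one>"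
proof -
  assume i: "i \<in> I" "n < i" "d i \<noteq> D"
  then have "2 * d i dvd D" by (rule lower_dvd)
  then obtain m where "D = 2 * d i * m" by (elim dvdE)
  then have "d i dvd D div 2" by simp
  then show ?thesis using w_eq_one_iff[OF i(1)] by simp
qed

lemma Z_unique_top:
  assumes top: unique_top and n: "n < r" and z: "z \<in> Z" shows "z = \<one> \<or> z = w t"
proof -
  have zero: "c i z = 0" if i: "i \<in> I" "i \<noteq> t" for i
  proof (cases "i \<le> n")
    case False
    then have "2 * d i dvd D" using lower_dvd[of i] unique_topD[OF top i(1)] i by simp
    then obtain m where "D = 2 * d i * m" by (elim dvdE)
    then have "d i dvd D div 2" by simp
    then have "int (d i) dvd c i z" using Z_coord_dvd[OF z i(1)] by simp
    then show ?thesis by (rule c_eq_zero_if_dvd)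
  qed (use Z_coord_infinite n z i in auto)
  have "(c t z + c t z) mod int D = 0"
    using c_mult[of z z t] Z_sq[OF n z] Z_carrier[OF z] c_one[of t] n by auto
  then have h: "int D dvd 2 * c t z" by (simp add: mod_eq_0_iff_dvd)
  have "c t z = 0 \<or> c t z = int (D div 2)" using half_cases[OF t_in[OF n] refl n h] .
  moreover have "z = e t [^] c t z"
  proof (rule c_eqI)
    show "c i z = c i (e t [^] c t z)" if "i \<in> I" for i
      using zero[OF that] c_e_pow[OF that t_in[OF n], of "c t z"] by auto
  qed (use Z_carrier[OF z] e_closed[OF t_in[OF n]] in auto)
  ultimately show ?thesis unfolding w_def by (auto simp: int_pow_int)
qed

text \<open>When \<open>e t\<close> is the only basis element of order \<open>D\<close>, the subgroup \<open>Z\<close> has order two.\<close>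

lemma w_fixed:
  assumes top: unique_top and n: "n < r" and \<alpha>: "\<alpha> \<in> iso G G" shows "\<alpha> (w t) = w t"
proof -
  have h: "\<alpha> \<in> hom G G" and b: "bij_betw \<alpha> (carrier G) (carrier G)" using \<alpha> by (simp_all add: iso_def)
  have w: "w t \<in> Z" using w_in_Z[of t] t_in[OF n] by simp
  have "\<alpha> (w t) \<noteq> \<one>"
  proof
    assume "\<alpha> (w t) = \<one>"
    then have "\<alpha> (w t) = \<alpha> \<one>" using hom_one[OF h is_group is_group] by simp
    then have "w t = \<one>" using inj_onD[OF bij_betw_imp_inj_on[OF b]] Z_carrier[OF w] by simp
    then show False using w_top_not_one[OF t_in[OF n] n refl] by simp
  qed
  then show ?thesis using Z_unique_top[OF top n Z_char[OF \<alpha> w]] by simp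
qed

text \<open>Writing \<open>\<chi>\<^sub>i\<close> for the parity of the \<open>i\<close>-th coordinate, \<open>diag a v\<close> is \<open>\<chi>\<^sub>a \<chi>\<^sub>a\<close> times \<open>v\<close>, and the refinement uses
  the binomial coefficient of the coordinate over two.\<close>

definition diag :: "nat \<Rightarrow> 'a \<Rightarrow> 'a \<Rightarrow> 'a \<Rightarrow> 'a" where
  "diag a v x y = v [^] (c a x * c a y)"

definition diag_q :: "nat \<Rightarrow> 'a \<Rightarrow> 'a \<Rightarrow> 'a" where
  "diag_q a v x = v [^] (c a x * (c a x - 1) div 2)"

text \<open>The alternating form \<open>\<chi>\<^sub>a \<chi>\<^sub>b + \<chi>\<^sub>b \<chi>\<^sub>a\<close> times \<open>v\<close>.\<close>

definition alt :: "nat \<Rightarrow> nat \<Rightarrow> 'a \<Rightarrow> 'a \<Rightarrow> 'a \<Rightarrow> 'a" where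
  "alt a b v x y = v [^] (c a x * c b y + c b x * c a y)"

definition alt_q :: "nat \<Rightarrow> nat \<Rightarrow> 'a \<Rightarrow> 'a \<Rightarrow> 'a" where
  "alt_q a b v x = v [^] (c a x * c b x)"

lemma Z_pow: "v \<in> Z \<Longrightarrow> v [^] (k::int) \<in> Z"
  using subgroup_int_pow_closed[OF Z_subgroup] by blast

lemma Z_pow_eq: "n < r \<Longrightarrow> v \<in> Z \<Longrightarrow> even (a - b) \<Longrightarrow> v [^] (a::int) = v [^] b"
  using int_pow_parity[OF Z_carrier Z_sq] by blast

lemma Z_pow_even: "n < r \<Longrightarrow> v \<in> Z \<Longrightarrow> even a \<Longrightarrow> v [^] (a::int) = \<one>"
  using Z_pow_eq[of v a 0] by simp

text \<open>The parity of \<open>s (s - 1) / 2\<close> depends on \<open>s\<close> modulo four only, so that it makes sense for a coordinate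
  modulo a multiple of four (or an integer coordinate, \<open>k = 0\<close>).\<close>

lemma binomial_parity:
  fixes s k :: int
  assumes "4 dvd k"
  shows "even (s mod k * (s mod k - 1) div 2 - s * (s - 1) div 2)"
proof -
  let ?m = "s mod k"
  have "4 dvd ?m - s" using assms by (metis dvd_trans mod_mod_trivial mod_eq_dvd_iff)
  then obtain v where "?m - s = 4 * v" by (elim dvdE)
  then have v: "?m = s + 4 * v" by simp
  have "even (s * (s - 1))" by simp
  then obtain u where u: "s * (s - 1) = 2 * u" by (elim evenE)
  have "?m * (?m - 1) = 2 * (u + 2 * (v * (2 * s + 4 * v - 1)))"
    unfolding v using u by (simp add: algebra_simps)
  then show ?thesis unfolding u by simp
qed

text \<open>The refinement has to vanish on \<open>Z\<close>, where the coordinate of a basis element of order \<open>D\<close> can be \<open>D / 2\<close>: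
  hence the requirement that coordinates on \<open>Z\<close> be divisible by four, that is \<open>8 dvd D\<close> for a basis
  element of finite order. For the alternating form below, divisibility by two is enough.\<close>

lemma polar_diag:
  assumes n: "n < r" and a: "a \<in> I" "4 dvd d a" and v: "v \<in> Z" and Z: "\<And>z. z \<in> Z \<Longrightarrow> 4 dvd c a z"
  shows "polar_pair G Z (diag a v) (diag_q a v)"
proof unfold_locales
  note vc = Z_carrier[OF v]
  show "diag a v x y = diag a v y x" for x y by (simp add: diag_def mult.commute)
  show "diag a v (x \<otimes> y) w = diag a v x w \<otimes> diag a v y w"
    if "x \<in> carrier G" "y \<in> carrier G" for x y w
  proof -
    have "diag a v (x \<otimes> y) w = v [^] (c a x * c a w + c a y * c a w)"
      unfolding diag_def
    proof (rule Z_pow_eq[OF n v])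
      show "even (c a (x \<otimes> y) * c a w - (c a x * c a w + c a y * c a w))"
        using dvd_mult2[OF c_mult_parity[OF that a(1)], of "c a w"] by (simp add: algebra_simps)
    qed
    then show ?thesis using vc by (simp add: diag_def int_pow_mult)
  qed
  show "diag a v x z = \<one>" if "z \<in> Z" for x z
  proof -
    have "even (c a z)" using Z[OF that] by (meson dvd_trans even_numeral)
    then show ?thesis unfolding diag_def by (intro Z_pow_even[OF n v]) simp
  qed
  show "diag_q a v (x \<otimes> y) = diag_q a v x \<otimes> diag_q a v y \<otimes> diag a v x y"
    if x: "x \<in> carrier G" and y: "y \<in> carrier G" for x y
  proof -
    let ?s = "c a x + c a y"
    have ev: "even (k * (k - 1))" for k :: int by simp
    have "?s * (?s - 1) = c a x * (c a x - 1) + c a y * (c a y - 1) + 2 * (c a x * c a y)"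
      by (simp add: algebra_simps)
    then have sum: "?s * (?s - 1) div 2 = c a x * (c a x - 1) div 2 + c a y * (c a y - 1) div 2 + c a x * c a y"
      using ev[of "c a x"] ev[of "c a y"] by (auto elim!: evenE)
    have "diag_q a v (x \<otimes> y) = v [^] (?s * (?s - 1) div 2)"
      unfolding diag_q_def c_mult[OF x y a(1)]
      using a(2) by (intro Z_pow_eq[OF n v] binomial_parity) presburger
    then show ?thesis unfolding sum using vc by (simp add: diag_def diag_q_def int_pow_mult)
  qed
  show "diag_q a v z = \<one>" if z: "z \<in> Z" for z
  proof -
    obtain k where "c a z = 4 * k" using Z[OF z] by (elim dvdE)
    then have "c a z * (c a z - 1) div 2 = 2 * (k * (4 * k - 1))" by simp
    then show ?thesis unfolding diag_q_def by (intro Z_pow_even[OF n v]) simp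
  qed
qed (auto simp: Z_sq n diag_def diag_q_def Z_pow v Z_carrier subgroup.m_closed[OF Z_subgroup]
    subgroup.one_closed[OF Z_subgroup] subgroup.m_inv_closed[OF Z_subgroup])

lemma polar_alt:
  assumes n: "n < r" and a: "a \<in> I" and b: "b \<in> I" and v: "v \<in> Z"
    and Z: "\<And>z. z \<in> Z \<Longrightarrow> even (c a z) \<and> even (c b z)"
  shows "polar_pair G Z (alt a b v) (alt_q a b v)"
proof unfold_locales
  note vc = Z_carrier[OF v]
  show "alt a b v x y = alt a b v y x" for x y by (simp add: alt_def algebra_simps)
  show "alt a b v (x \<otimes> y) w = alt a b v x w \<otimes> alt a b v y w"
    if "x \<in> carrier G" "y \<in> carrier G" for x y w
  proof -
    have "alt a b v (x \<otimes> y) w = v [^] ((c a x * c b w + c b x * c a w) + (c a y * c b w + c b y * c a w))"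
      unfolding alt_def
    proof (rule Z_pow_eq[OF n v])
      show "even (c a (x \<otimes> y) * c b w + c b (x \<otimes> y) * c a w -
          ((c a x * c b w + c b x * c a w) + (c a y * c b w + c b y * c a w)))"
        using dvd_add[OF dvd_mult2[OF c_mult_parity[OF that a], of "c b w"]
            dvd_mult2[OF c_mult_parity[OF that b], of "c a w"]] by (simp add: algebra_simps)
    qed
    then show ?thesis using vc by (simp add: alt_def int_pow_mult)
  qed
  show "alt a b v x z = \<one>" if "z \<in> Z" for x z
    unfolding alt_def using Z[OF that] by (intro Z_pow_even[OF n v]) simp
  show "alt_q a b v (x \<otimes> y) = alt_q a b v x \<otimes> alt_q a b v y \<otimes> alt a b v x y"
    if x: "x \<in> carrier G" and y: "y \<in> carrier G" for x y
  proof -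
    let ?s = "c a x + c a y" and ?s' = "c b x + c b y"
    have "alt_q a b v (x \<otimes> y) = v [^] (?s * ?s')"
      unfolding alt_q_def
    proof (rule Z_pow_eq[OF n v])
      have "even (c a (x \<otimes> y)) = even ?s" "even (c b (x \<otimes> y)) = even ?s'"
        using c_mult_parity[OF x y a] c_mult_parity[OF x y b] by auto
      then show "even (c a (x \<otimes> y) * c b (x \<otimes> y) - ?s * ?s')" by simp
    qed
    also have "?s * ?s' = c a x * c b x + c a y * c b y + (c a x * c b y + c b x * c a y)"
      by (simp add: algebra_simps)
    finally show ?thesis using vc by (simp add: alt_def alt_q_def int_pow_mult)
  qed
  show "alt_q a b v z = \<one>" if "z \<in> Z" for z
    unfolding alt_q_def using Z[OF that] by (intro Z_pow_even[OF n v]) simp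
qed (auto simp: Z_sq n alt_def alt_q_def Z_pow v Z_carrier subgroup.m_closed[OF Z_subgroup]
    subgroup.one_closed[OF Z_subgroup] subgroup.m_inv_closed[OF Z_subgroup])

text \<open>By the hypothesis on the orders the functional \<open>\<chi>\<^sub>a \<circ> \<alpha>\<close> is a multiple of \<open>\<chi>\<^sub>a\<close>, and the multiple is not zero
  because \<open>\<alpha>\<close> is onto.\<close>

lemma c_aut_one:
  assumes \<alpha>: "\<alpha> \<in> iso G G" and a: "a \<in> I"
    and low: "\<And>j. j \<in> I \<Longrightarrow> j \<noteq> a \<Longrightarrow> d j > 0 \<and> 2 * d j dvd d a" and x: "x \<in> carrier G"
  shows "even (c a (\<alpha> x)) \<longleftrightarrow> even (c a x)"
proof -
  have b: "bij_betw \<alpha> (carrier G) (carrier G)" using \<alpha> by (simp add: iso_def)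
  define m where "m = c a (\<alpha> (e a))"
  have lin: "even (c a (\<alpha> x) - m * c a x)" if x: "x \<in> carrier G" for x
  proof (rule even_on_basis[OF _ _ x])
    show "even (c a (\<alpha> (x \<otimes> y)) - m * c a (x \<otimes> y) - (c a (\<alpha> x) - m * c a x + (c a (\<alpha> y) - m * c a y)))"
      if "x \<in> carrier G" "y \<in> carrier G" for x y
      using dvd_diff[OF c_aut_mult_parity[OF \<alpha> that a] dvd_mult[OF c_mult_parity[OF that a], of m]]
      by (simp add: algebra_simps)
    show "even (c a (\<alpha> (e j)) - m * c a (e j))" if "j \<in> I" for j
      using c_e[OF a that] c_aut_even[OF \<alpha> that _ a] low[OF that] by (cases "j = a") (auto simp: m_def)
  qed
  obtain x0 where "x0 \<in> carrier G" "\<alpha> x0 = e a"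
    using bij_betw_imp_surj_on[OF b] e_closed[OF a] by (metis imageE)
  then have "odd m" using lin[of x0] c_e[OF a a] by auto
  then show ?thesis using lin[OF x] by auto
qed

lemma diag_aut:
  assumes n: "n < r" and \<alpha>: "\<alpha> \<in> iso G G" and a: "a \<in> I" and v: "v \<in> Z" "\<alpha> v = v"
    and low: "\<And>j. j \<in> I \<Longrightarrow> j \<noteq> a \<Longrightarrow> d j > 0 \<and> 2 * d j dvd d a"
    and x: "x \<in> carrier G" and y: "y \<in> carrier G"
  shows "diag a v (\<alpha> x) (\<alpha> y) = \<alpha> (diag a v x y)"
proof -
  have h: "\<alpha> \<in> hom G G" using \<alpha> by (simp add: iso_def)
  interpret h: group_hom G G \<alpha> by unfold_locales (rule h)
  have "\<alpha> (diag a v x y) = v [^] (c a x * c a y)"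
    using h.hom_int_pow[OF Z_carrier[OF v(1)]] v(2) by (simp add: diag_def)
  also have "\<dots> = diag a v (\<alpha> x) (\<alpha> y)" unfolding diag_def
    using c_aut_one[OF \<alpha> a low x] c_aut_one[OF \<alpha> a low y] by (intro Z_pow_eq[OF n v(1)]) simp
  finally show ?thesis by simp
qed

text \<open>By the hypothesis on the orders \<open>\<alpha>\<close> acts on the plane spanned by the functionals \<open>\<chi>\<^sub>a\<close> and \<open>\<chi>\<^sub>b\<close>. An
  alternating form changes by the determinant of this action, which is one because it is odd.\<close>

lemma alt_aut:
  assumes n: "n < r" and \<alpha>: "\<alpha> \<in> iso G G" and a: "a \<in> I" and b: "b \<in> I" and ab: "a \<noteq> b"
    and v: "v \<in> Z" "\<alpha> v = v"
    and low: "\<And>j. j \<in> I \<Longrightarrow> j \<noteq> a \<Longrightarrow> j \<noteq> b \<Longrightarrow> d j > 0 \<and> 2 * d j dvd d a \<and> 2 * d j dvd d b"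
    and x: "x \<in> carrier G" and y: "y \<in> carrier G"
  shows "alt a b v (\<alpha> x) (\<alpha> y) = \<alpha> (alt a b v x y)"
proof -
  have h: "\<alpha> \<in> hom G G" using \<alpha> by (simp add: iso_def)
  interpret h: group_hom G G \<alpha> by unfold_locales (rule h)
  have bij: "bij_betw \<alpha> (carrier G) (carrier G)" using \<alpha> by (simp add: iso_def)
  have lin: "even (c i (\<alpha> x) - (c i (\<alpha> (e a)) * c a x + c i (\<alpha> (e b)) * c b x))"
    if x: "x \<in> carrier G" and i: "i = a \<or> i = b" for x i
  proof -
    let ?m = "c i (\<alpha> (e a))" and ?m' = "c i (\<alpha> (e b))"
    have iI: "i \<in> I" using i a b by auto
    show ?thesis
    proof (rule even_on_basis[OF _ _ x])
      show "even (c i (\<alpha> (x \<otimes> y)) - (?m * c a (x \<otimes> y) + ?m' * c b (x \<otimes> y)) -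
          (c i (\<alpha> x) - (?m * c a x + ?m' * c b x) + (c i (\<alpha> y) - (?m * c a y + ?m' * c b y))))"
        if "x \<in> carrier G" "y \<in> carrier G" for x y
        using dvd_diff[OF c_aut_mult_parity[OF \<alpha> that iI]
            dvd_add[OF dvd_mult[OF c_mult_parity[OF that a], of ?m] dvd_mult[OF c_mult_parity[OF that b], of ?m']]]
        by (simp add: algebra_simps)
      show "even (c i (\<alpha> (e j)) - (?m * c a (e j) + ?m' * c b (e j)))" if "j \<in> I" for j
        using c_e[OF a that] c_e[OF b that] c_aut_even[OF \<alpha> that _ iI] low[OF that] i ab
        by (cases "j = a"; cases "j = b") auto
    qed
  qed
  obtain x0 where x0: "x0 \<in> carrier G" "\<alpha> x0 = e a"
    using bij_betw_imp_surj_on[OF bij] e_closed[OF a] by (metis imageE)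
  obtain y0 where y0: "y0 \<in> carrier G" "\<alpha> y0 = e b"
    using bij_betw_imp_surj_on[OF bij] e_closed[OF b] by (metis imageE)
  let ?f = "\<lambda>x y. c a x * c b y + c b x * c a y"
  let ?maa = "c a (\<alpha> (e a))" and ?mab = "c a (\<alpha> (e b))" and ?mba = "c b (\<alpha> (e a))" and ?mbb = "c b (\<alpha> (e b))"
  have det: "even (?f (\<alpha> x) (\<alpha> y) - (?maa * ?mbb + ?mab * ?mba) * ?f x y)"
    if x: "x \<in> carrier G" and y: "y \<in> carrier G" for x y
    using lin[OF x, of a] lin[OF x, of b] lin[OF y, of a] lin[OF y, of b]
    by simp argo
  \<comment> \<open>Evaluating the form on preimages of \<open>e a\<close> and \<open>e b\<close> shows that the determinant is odd.\<close>
  have "?f (\<alpha> x0) (\<alpha> y0) = 1" using x0 y0 c_e[OF a a] c_e[OF a b] c_e[OF b a] c_e[OF b b] ab by simp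
  then have odd: "odd (?maa * ?mbb + ?mab * ?mba)" using det[OF x0(1) y0(1)] by auto
  have even_iff: "even p \<longleftrightarrow> even q" if "even (p - q)" for p q :: int using that by simp
  have even_odd_mult: "even (p * q) \<longleftrightarrow> even q" if "odd p" for p q :: int using that by simp
  have even_diffI: "even (p - q)" if "even p \<longleftrightarrow> even q" for p q :: int using that by simp
  have "\<alpha> (alt a b v x y) = v [^] ?f x y"
    using h.hom_int_pow[OF Z_carrier[OF v(1)]] v(2) by (simp add: alt_def)
  also have "\<dots> = v [^] ?f (\<alpha> x) (\<alpha> y)"
  proof (rule Z_pow_eq[OF n v(1)])
    have "even (?f (\<alpha> x) (\<alpha> y)) \<longleftrightarrow> even ((?maa * ?mbb + ?mab * ?mba) * ?f x y)"
      by (rule even_iff[OF det[OF x y]])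
    also have "\<dots> \<longleftrightarrow> even (?f x y)" by (rule even_odd_mult[OF odd])
    finally show "even (?f x y - ?f (\<alpha> x) (\<alpha> y))" by (rule even_diffI[OF sym])
  qed
  finally show ?thesis unfolding alt_def by simp
qed

end

section \<open>Two further forms\<close>

(* Indices are written as the numerals 1, 2, 3; keep the simplifier from turning 1 into Suc 0. *)
declare One_nat_def [simp del]

context adapted_basis
begin

text \<open>The \<open>(D / 2)\<close>-th power of the torsion part of \<open>x\<close>, for \<open>n = 1\<close>.\<close>

definition S :: "'a \<Rightarrow> 'a" where "S x = (x \<otimes> e 1 [^] (- c 1 x)) [^] (D div 2)"

text \<open>The form \<open>\<chi>\<^sub>1 S + S \<chi>\<^sub>1\<close>, which pairs the infinite cyclic factor with the torsion subgroup.\<close>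

definition cross :: "'a \<Rightarrow> 'a \<Rightarrow> 'a" where "cross x y = S y [^] c 1 x \<otimes> S x [^] c 1 y"

definition cross_q :: "'a \<Rightarrow> 'a" where "cross_q x = S x [^] c 1 x"

context
  assumes n: "n = 1" and r: "1 < r"
begin

lemma nr: "n < r" and I1: "1 \<in> I" and d1: "d 1 = 0"
  using n r d_zero[of 1] by auto

lemma e1: "e 1 \<in> carrier G" by (rule e_closed[OF I1])

lemma c1_mult: "x \<in> carrier G \<Longrightarrow> y \<in> carrier G \<Longrightarrow> c 1 (x \<otimes> y) = c 1 x + c 1 y"
  using c_mult[of x y 1] I1 d1 by simp

lemma S_mult: "x \<in> carrier G \<Longrightarrow> y \<in> carrier G \<Longrightarrow> S (x \<otimes> y) = S x \<otimes> S y"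
proof -
  assume x: "x \<in> carrier G" and y: "y \<in> carrier G"
  have "e 1 [^] (- c 1 (x \<otimes> y)) = e 1 [^] (- c 1 x) \<otimes> e 1 [^] (- c 1 y)"
    unfolding c1_mult[OF x y] using int_pow_mult[OF e1, of "- c 1 x" "- c 1 y"] by simp
  then have "x \<otimes> y \<otimes> e 1 [^] (- c 1 (x \<otimes> y)) = (x \<otimes> e 1 [^] (- c 1 x)) \<otimes> (y \<otimes> e 1 [^] (- c 1 y))"
    using x y e1 by (simp add: m_ac)
  then show ?thesis unfolding S_def using x y e1 by (simp only: nat_pow_distrib m_closed int_pow_closed)
qed

lemma S_in_Z: assumes x: "x \<in> carrier G" shows "S x \<in> Z"
proof -
  let ?p = "x \<otimes> e 1 [^] (- c 1 x)"
  have p: "?p \<in> carrier G" using x e1 by simp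
  have "?p [^] D = \<one>"
  proof (rule c_eqI)
    fix i assume i: "i \<in> I"
    show "c i (?p [^] D) = c i \<one>"
    proof (cases "i = 1")
      case True
      have "c 1 ?p = 0" using c1_mult[OF x, of "e 1 [^] (- c 1 x)"] c_e_pow[OF I1 I1, of "- c 1 x"] e1 d1 by simp
      then show ?thesis using c_nat_pow[OF p i, of D] c_one[OF i] True by simp
    next
      case False
      then have "d i dvd D" using d_dvd[of t i] i n nr by auto
      then have "int (d i) dvd int D * c i ?p" by simp
      then show ?thesis using c_nat_pow[OF p i, of D] c_one[OF i] by simp
    qed
  qed (use p in auto)
  then show ?thesis unfolding S_def using Z_memI[OF p] by simp
qed

lemma S_torsion: "x \<in> carrier G \<Longrightarrow> c 1 x = 0 \<Longrightarrow> S x = x [^] (D div 2)"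
  unfolding S_def by simp

lemma S_closed [simp]: "x \<in> carrier G \<Longrightarrow> S x \<in> carrier G"
  using S_in_Z Z_carrier by blast

lemma S_e: "j \<in> I \<Longrightarrow> S (e j) = (if j = 1 then \<one> else w j)"
  using S_torsion[of "e j"] c_e[OF I1, of j] e_closed[of j] e1
  by (auto simp: w_def S_def int_pow_neg)

lemma S_Z: "4 dvd D \<Longrightarrow> z \<in> Z \<Longrightarrow> S z = \<one>"
proof -
  assume D: "4 dvd D" and z: "z \<in> Z"
  obtain k where "D = 4 * k" using D by (elim dvdE)
  then have k: "D div 2 = 2 * k" by simp
  have zc: "z \<in> carrier G" using Z_carrier[OF z] .
  have "z [^] (2::nat) = \<one>" using Z_sq[OF nr z] zc by (simp add: numeral_2_eq_2)
  then have "z [^] (D div 2) = \<one>" unfolding k using zc by (simp flip: nat_pow_pow)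
  then show ?thesis using S_torsion[OF zc] Z_coord_infinite[OF nr z I1] n by simp
qed

text \<open>Both sides are additive and agree on the basis: on torsion elements \<open>S\<close> is just a power map, which
  commutes with \<open>\<alpha>\<close>.\<close>

lemma S_aut:
  assumes \<alpha>: "\<alpha> \<in> iso G G" and x: "x \<in> carrier G"
  shows "S (\<alpha> x) = S (\<alpha> (e 1)) [^] c 1 x \<otimes> \<alpha> (S x)"
proof -
  have h: "\<alpha> \<in> hom G G" using \<alpha> by (simp add: iso_def)
  interpret h: group_hom G G \<alpha> by unfold_locales (rule h)
  let ?s = "S (\<alpha> (e 1))"
  have s: "?s \<in> carrier G" using e1 by simp
  show ?thesis
  proof (rule hom_eq_on_basis[of "\<lambda>x. S (\<alpha> x)" "\<lambda>x. ?s [^] c 1 x \<otimes> \<alpha> (S x)", OF _ _ _ x])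
    show "(\<lambda>x. S (\<alpha> x)) \<in> hom G G" by (rule homI) (simp_all add: S_mult)
    show "(\<lambda>x. ?s [^] c 1 x \<otimes> \<alpha> (S x)) \<in> hom G G"
      by (rule homI) (use s in \<open>simp_all add: c1_mult S_mult int_pow_mult m_ac\<close>)
    fix j assume j: "j \<in> I"
    show "S (\<alpha> (e j)) = ?s [^] c 1 (e j) \<otimes> \<alpha> (S (e j))"
    proof (cases "j = 1")
      case True
      then show ?thesis using s S_e[OF I1] c_e[OF I1 I1] by simp
    next
      case False
      have ej: "e j \<in> carrier G" by (rule e_closed[OF j])
      have "\<alpha> (e j) [^] d j = \<one>" using h.hom_nat_pow[OF ej, of "d j"] e_pow[OF j] by simp
      then have "int (d j) * c 1 (\<alpha> (e j)) = 0"
        using c_nat_pow[of "\<alpha> (e j)" 1 "d j"] c_one[OF I1] I1 ej d1 by simp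
      then have "c 1 (\<alpha> (e j)) = 0" using d_zero[OF j] j n False by auto
      then have "S (\<alpha> (e j)) = \<alpha> (e j) [^] (D div 2)" using S_torsion[of "\<alpha> (e j)"] ej by simp
      also have "\<dots> = \<alpha> (w j)" unfolding w_def using h.hom_nat_pow[OF ej] by simp
      finally show ?thesis using S_e[OF j] c_e[OF I1 j] False e_closed[OF j] by (simp add: w_def)
    qed
  qed
qed

text \<open>The correction term \<open>S (\<alpha> (e 1))\<close> by which \<open>S \<circ> \<alpha>\<close> and \<open>\<alpha> \<circ> S\<close> differ occurs twice in the form and cancels.
  The condition \<open>4 dvd D\<close> makes \<open>S\<close> trivial on \<open>Z\<close>.\<close>

lemma quadratic_datum_cross:
  assumes D: "4 dvd D" shows "quadratic_datum G Z cross cross_q"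
proof unfold_locales
  fix x y assume x: "x \<in> carrier G" and y: "y \<in> carrier G"
  show "cross x y \<in> Z" unfolding cross_def
    using subgroup.m_closed[OF Z_subgroup Z_pow[OF S_in_Z[OF y]] Z_pow[OF S_in_Z[OF x]]] .
  show "cross_q x \<in> Z" unfolding cross_q_def by (rule Z_pow[OF S_in_Z[OF x]])
  show "cross x y = cross y x" unfolding cross_def using x y by (simp add: m_comm)
  show "cross (x \<otimes> y) z = cross x z \<otimes> cross y z" if "z \<in> carrier G" for z
    unfolding cross_def c1_mult[OF x y] S_mult[OF x y]
    using x y that by (simp add: int_pow_mult int_pow_distrib m_ac)
  show "cross_q (x \<otimes> y) = cross_q x \<otimes> cross_q y \<otimes> cross x y"
    unfolding cross_def cross_q_def c1_mult[OF x y] S_mult[OF x y]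
    using x y by (simp add: int_pow_mult int_pow_distrib m_ac)
  show "cross x z = \<one>" if "z \<in> Z" for z
    unfolding cross_def using S_Z[OF D that] Z_coord_infinite[OF nr that I1] n x by simp
next
  show "cross_q z = \<one>" if "z \<in> Z" for z
    unfolding cross_q_def using S_Z[OF D that] by simp
next
  fix \<alpha> x y assume \<alpha>: "\<alpha> \<in> iso G G" and x: "x \<in> carrier G" and y: "y \<in> carrier G"
  have h: "\<alpha> \<in> hom G G" using \<alpha> by (simp add: iso_def)
  interpret h: group_hom G G \<alpha> by unfold_locales (rule h)
  let ?s = "S (\<alpha> (e 1))"
  have s: "?s \<in> Z" "?s \<in> carrier G" using S_in_Z[of "\<alpha> (e 1)"] e1 by auto
  have par: "even (c 1 (\<alpha> x)) \<longleftrightarrow> even (c 1 x)" if "x \<in> carrier G" for x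
  proof (rule c_aut_one[OF \<alpha> I1 _ that])
    fix j assume "j \<in> I" "j \<noteq> 1"
    then show "0 < d j \<and> 2 * d j dvd d 1" using d_zero[of j] n d1 by auto
  qed
  have "cross (\<alpha> x) (\<alpha> y) = S (\<alpha> y) [^] c 1 x \<otimes> S (\<alpha> x) [^] c 1 y"
    unfolding cross_def using par[OF x] par[OF y] x y
    by (intro arg_cong2[where f = "(\<otimes>)"] Z_pow_eq[OF nr] S_in_Z) auto
  also have "\<dots> = (?s [^] (c 1 y * c 1 x) \<otimes> ?s [^] (c 1 x * c 1 y)) \<otimes> (\<alpha> (S y) [^] c 1 x \<otimes> \<alpha> (S x) [^] c 1 y)"
    unfolding S_aut[OF \<alpha> x] S_aut[OF \<alpha> y] using x y s(2)
    by (simp add: int_pow_distrib int_pow_pow m_ac)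
  also have "?s [^] (c 1 y * c 1 x) \<otimes> ?s [^] (c 1 x * c 1 y) = ?s [^] (2 * (c 1 x * c 1 y))"
    using int_pow_mult[OF s(2), of "c 1 x * c 1 y" "c 1 x * c 1 y"] by (simp add: mult.commute)
  also have "\<dots> = \<one>" by (rule Z_pow_even[OF nr s(1)]) simp
  also have "\<one> \<otimes> (\<alpha> (S y) [^] c 1 x \<otimes> \<alpha> (S x) [^] c 1 y) = \<alpha> (cross x y)"
    unfolding cross_def using x y h.hom_int_pow by simp
  finally show "cross (\<alpha> x) (\<alpha> y) = \<alpha> (cross x y)" .
qed (auto simp: Z_sq nr Z_char Z_carrier subgroup.m_closed[OF Z_subgroup]
    subgroup.one_closed[OF Z_subgroup] subgroup.m_inv_closed[OF Z_subgroup])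

lemma cross_e: "j \<in> I \<Longrightarrow> l \<in> I \<Longrightarrow> cross (e j) (e l) =
    (if j = 1 \<and> l \<noteq> 1 then w l else if j \<noteq> 1 \<and> l = 1 then w j else \<one>)"
  using c_e[OF I1, of j] c_e[OF I1, of l] e_closed[of j] e_closed[of l]
  by (auto simp: cross_def S_e w_def)

end

lemma diag_e: "a \<in> I \<Longrightarrow> v \<in> carrier G \<Longrightarrow> j \<in> I \<Longrightarrow> l \<in> I \<Longrightarrow>
    diag a v (e j) (e l) = (if j = a \<and> l = a then v else \<one>)"
  by (auto simp: diag_def c_e)

lemma alt_e: "a \<in> I \<Longrightarrow> b \<in> I \<Longrightarrow> a \<noteq> b \<Longrightarrow> v \<in> carrier G \<Longrightarrow> j \<in> I \<Longrightarrow> l \<in> I \<Longrightarrow>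
    alt a b v (e j) (e l) = (if (j = a \<and> l = b) \<or> (j = b \<and> l = a) then v else \<one>)"
  by (auto simp: alt_def c_e)

text \<open>The invariant product for two basis elements of order \<open>D\<close>: the squares of \<open>e 1\<close> and \<open>e 2\<close> are the
  involutions below them, and their product is the product of these involutions.\<close>

definition plane :: "'a \<Rightarrow> 'a \<Rightarrow> 'a" where
  "plane x y = diag 1 (w 1) x y \<otimes> diag 2 (w 2) x y \<otimes> alt 1 2 (w 1 \<otimes> w 2) x y"

definition plane_q :: "'a \<Rightarrow> 'a" where
  "plane_q x = diag_q 1 (w 1) x \<otimes> diag_q 2 (w 2) x \<otimes> alt_q 1 2 (w 1 \<otimes> w 2) x"

context
  assumes n0: "n = 0" and top2: "2 \<le> r" "d 2 = D" "3 \<le> r \<longrightarrow> d 3 \<noteq> D"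
begin

lemma dI: "1 \<in> I" "2 \<in> I" "d 1 = D" "n < r" using n0 top2 by (auto simp: One_nat_def)

lemma w12: "w 1 \<in> Z" "w 2 \<in> Z" "w 1 \<otimes> w 2 \<in> Z" "w 1 \<in> carrier G" "w 2 \<in> carrier G"
  using w_in_Z[of 1] w_in_Z[of 2] dI top2 subgroup.m_closed[OF Z_subgroup] Z_carrier by auto

lemma plane_e: "j \<in> I \<Longrightarrow> l \<in> I \<Longrightarrow> plane (e j) (e l) =
   (if j = 1 \<and> l = 1 then w 1 else if j = 2 \<and> l = 2 then w 2
    else if (j = 1 \<and> l = 2) \<or> (j = 2 \<and> l = 1) then w 1 \<otimes> w 2 else \<one>)"
  unfolding plane_def using w12 dI by (simp add: diag_e alt_e)

lemma w12_distinct: "w 1 \<noteq> \<one>" "w 2 \<noteq> \<one>" "w 1 \<noteq> w 2"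
proof -
  show w1: "w 1 \<noteq> \<one>" using w_top_not_one[of 1] dI by simp
  show "w 2 \<noteq> \<one>" using w_top_not_one[of 2] dI top2 by simp
  show "w 1 \<noteq> w 2"
  proof
    assume eq: "w 1 = w 2"
    have "c i (w 1) = 0" if "i \<in> I" for i
      using c_w[OF that dI(1)] c_w[OF that dI(2)] eq by (cases "i = 1") auto
    then have "w 1 = \<one>" using c_one w12 by (intro c_eqI) auto
    then show False using w1 by simp
  qed
qed

lemma pow_half:
  assumes x: "x \<in> carrier G" shows "x [^] (D div 2) = w 1 [^] c 1 x \<otimes> w 2 [^] c 2 x"
proof (rule c_eqI)
  fix i assume i: "i \<in> I"
  have z: "d i dvd D div 2" if "i \<noteq> 1" "i \<noteq> 2"
  proof -
    have "d i \<noteq> D" using top2 d_anti[of 3 i] d_anti[of 1 3] i that n0 dI(3) by auto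
    then show ?thesis using w_lower[OF i] w_eq_one_iff[OF i] i n0 by simp
  qed
  have "c i (w 1 [^] c 1 x \<otimes> w 2 [^] c 2 x) =
      ((c 1 x * c i (w 1)) mod int (d i) + (c 2 x * c i (w 2)) mod int (d i)) mod int (d i)"
    using c_mult[of "w 1 [^] c 1 x" "w 2 [^] c 2 x" i] i w12 c_int_pow[OF w12(4) i] c_int_pow[OF w12(5) i] by simp
  moreover have "c i (x [^] (D div 2)) = (int (D div 2) * c i x) mod int (d i)" by (rule c_nat_pow[OF x i])
  ultimately show "c i (x [^] (D div 2)) = c i (w 1 [^] c 1 x \<otimes> w 2 [^] c 2 x)"
    using c_w[OF i dI(1)] c_w[OF i dI(2)] z
    by (cases "i = 1"; cases "i = 2") (auto simp: mod_simps mult.commute)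
qed (use x w12 in auto)

text \<open>A description of \<open>plane\<close> in terms of the classes \<open>x [^] (D div 2)\<close> that does not refer to the basis,
  which makes its invariance under automorphisms evident.\<close>

definition pairing :: "'a \<Rightarrow> 'a \<Rightarrow> 'a" where
  "pairing a b = (if a = \<one> \<or> b = \<one> then \<one> else if a = b then a else a \<otimes> b)"

lemma plane_eq_pairing:
  assumes x: "x \<in> carrier G" and y: "y \<in> carrier G"
  shows "plane x y = pairing (x [^] (D div 2)) (y [^] (D div 2))"
proof -
  note sq = Z_sq[OF dI(4) w12(1)] Z_sq[OF dI(4) w12(2)] Z_sq[OF dI(4) w12(3)]
  have ne: "w 1 \<otimes> w 2 \<noteq> \<one>" "w 1 \<otimes> w 2 \<noteq> w 1" "w 1 \<otimes> w 2 \<noteq> w 2"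
  proof -
    show "w 1 \<otimes> w 2 \<noteq> \<one>"
    proof
      assume "w 1 \<otimes> w 2 = \<one>"
      then have "w 1 \<otimes> w 2 = w 1 \<otimes> w 1" using sq by simp
      then have "w 2 = w 1" by (rule cancel_left) (use w12 in simp_all)
      then show False using w12_distinct by simp
    qed
    show "w 1 \<otimes> w 2 \<noteq> w 1" "w 1 \<otimes> w 2 \<noteq> w 2"
      using w12_distinct w12 by simp_all
  qed
  have sq': "w 1 \<otimes> (w 1 \<otimes> a) = a" "w 2 \<otimes> (w 2 \<otimes> a) = a" if "a \<in> carrier G" for a
    using sq w12 that by (simp_all flip: m_assoc)
  have p: "w 1 [^] k = (if odd k then w 1 else \<one>)" "w 2 [^] k = (if odd k then w 2 else \<one>)"
     "(w 1 \<otimes> w 2) [^] k = (if odd k then w 1 \<otimes> w 2 else \<one>)" for k :: int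
    using involution_pow sq w12 by auto
  have comm: "w 2 \<otimes> w 1 = w 1 \<otimes> w 2" using w12 m_comm by simp
  have com2: "w 2 \<otimes> (w 1 \<otimes> a) = w 1 \<otimes> (w 2 \<otimes> a)" if "a \<in> carrier G" for a
    using w12 that by (simp add: m_lcomm)
  show ?thesis unfolding pow_half[OF x] pow_half[OF y] plane_def diag_def alt_def p
    by (cases "even (c 1 x)"; cases "even (c 2 x)"; cases "even (c 1 y)"; cases "even (c 2 y)")
      (use w12 w12_distinct ne ne[symmetric] w12_distinct(3)[symmetric] in
        \<open>simp_all add: pairing_def sq sq' m_assoc comm com2 del: One_nat_def\<close>)
qed

lemma quadratic_datum_plane:
  assumes D: "8 dvd D" shows "quadratic_datum G Z plane plane_q"
proof -
  have D2: "4 dvd D div 2" "4 dvd D" using D by (auto elim!: dvdE)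
  have z4: "4 dvd c i z" if "i \<in> {1, 2}" "z \<in> Z" for i z
    using Z_coord_dvd[OF that(2), of i 4] D2 dI top2 that(1) by auto
  have z2: "even (c 1 z) \<and> even (c 2 z)" if "z \<in> Z" for z
    using z4[of 1 z] z4[of 2 z] that by (meson dvd_trans even_numeral insertI1 insertI2)
  interpret polar_pair G Z plane plane_q
    unfolding plane_def[abs_def] plane_q_def[abs_def]
    by (intro polar_pair_mult polar_diag polar_alt dI w12 z4 z2) (use D2 dI top2 in auto)
  show ?thesis
  proof unfold_locales
    fix \<alpha> x y assume \<alpha>: "\<alpha> \<in> iso G G" and x: "x \<in> carrier G" and y: "y \<in> carrier G"
    have h: "\<alpha> \<in> hom G G" and b: "bij_betw \<alpha> (carrier G) (carrier G)" using \<alpha> by (simp_all add: iso_def)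
    interpret h: group_hom G G \<alpha> by unfold_locales (rule h)
    have inj: "\<alpha> a = \<alpha> b \<longleftrightarrow> a = b" if "a \<in> carrier G" "b \<in> carrier G" for a b
      using inj_onD[OF bij_betw_imp_inj_on[OF b] _ that] by auto
    have one: "\<alpha> a = \<one> \<longleftrightarrow> a = \<one>" if "a \<in> carrier G" for a using inj[OF that one_closed] by simp
    have "plane (\<alpha> x) (\<alpha> y) = pairing (\<alpha> (x [^] (D div 2))) (\<alpha> (y [^] (D div 2)))"
      using plane_eq_pairing[of "\<alpha> x" "\<alpha> y"] h.hom_nat_pow[OF x] h.hom_nat_pow[OF y] x y by simp
    also have "\<dots> = \<alpha> (pairing (x [^] (D div 2)) (y [^] (D div 2)))"
      unfolding pairing_def using x y by (simp add: one inj)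
    finally show "plane (\<alpha> x) (\<alpha> y) = \<alpha> (plane x y)" using plane_eq_pairing[OF x y] by simp
  qed (rule Z_char)
qed

end

lemma quadratic_datum_diag:
  assumes n: "n < r" and top: unique_top and a: "a \<in> I" "4 dvd d a" and Z: "\<And>z. z \<in> Z \<Longrightarrow> 4 dvd c a z"
    and low: "\<And>j. j \<in> I \<Longrightarrow> j \<noteq> a \<Longrightarrow> d j > 0 \<and> 2 * d j dvd d a"
  shows "quadratic_datum G Z (diag a (w t)) (diag_q a (w t))"
proof -
  have wt: "w t \<in> Z" using w_in_Z[of t] t_in[OF n] by simp
  interpret polar_pair G Z "diag a (w t)" "diag_q a (w t)" by (rule polar_diag[OF n a wt Z])
  show ?thesis
    by unfold_locales (rule Z_char, assumption+, rule diag_aut[OF n _ a(1) wt w_fixed[OF top n] low], assumption+)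
qed

lemma quadratic_datum_alt:
  assumes n: "n < r" and top: unique_top and a: "a \<in> I" and b: "b \<in> I" and ab: "a \<noteq> b"
    and Z: "\<And>z. z \<in> Z \<Longrightarrow> even (c a z) \<and> even (c b z)"
    and low: "\<And>j. j \<in> I \<Longrightarrow> j \<noteq> a \<Longrightarrow> j \<noteq> b \<Longrightarrow> d j > 0 \<and> 2 * d j dvd d a \<and> 2 * d j dvd d b"
  shows "quadratic_datum G Z (alt a b (w t)) (alt_q a b (w t))"
proof -
  have wt: "w t \<in> Z" using w_in_Z[of t] t_in[OF n] by simp
  interpret polar_pair G Z "alt a b (w t)" "alt_q a b (w t)" by (rule polar_alt[OF n a b wt Z])
  show ?thesis
    by unfold_locales (rule Z_char, assumption+, rule alt_aut[OF n _ a b ab wt w_fixed[OF top n] low], assumption+)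
qed

end

section \<open>Counting regular subgroups\<close>

lemma (in monoid) nat_pow_two: "x \<in> carrier G \<Longrightarrow> x [^] (2::nat) = x \<otimes> x"
  by (simp add: numeral_2_eq_2)

(* Also fold Suc 0, which appears when n = 0 is substituted in the index Suc n. *)
declare One_nat_def [symmetric, simp]

context adapted_basis
begin

text \<open>Invariant products are thus determined by finitely many values, the \<open>u j l\<close>.\<close>

lemma biadditive_eq_on_basis:
  assumes cl: "\<And>x y. x \<in> carrier G \<Longrightarrow> y \<in> carrier G \<Longrightarrow> B x y \<in> carrier G"
      "\<And>x y. x \<in> carrier G \<Longrightarrow> y \<in> carrier G \<Longrightarrow> B' x y \<in> carrier G"
    and left: "\<And>x y v. x \<in> carrier G \<Longrightarrow> y \<in> carrier G \<Longrightarrow> v \<in> carrier G \<Longrightarrow> B (x \<otimes> y) v = B x v \<otimes> B y v"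
      "\<And>x y v. x \<in> carrier G \<Longrightarrow> y \<in> carrier G \<Longrightarrow> v \<in> carrier G \<Longrightarrow> B' (x \<otimes> y) v = B' x v \<otimes> B' y v"
    and right: "\<And>x y v. x \<in> carrier G \<Longrightarrow> y \<in> carrier G \<Longrightarrow> v \<in> carrier G \<Longrightarrow> B v (x \<otimes> y) = B v x \<otimes> B v y"
      "\<And>x y v. x \<in> carrier G \<Longrightarrow> y \<in> carrier G \<Longrightarrow> v \<in> carrier G \<Longrightarrow> B' v (x \<otimes> y) = B' v x \<otimes> B' v y"
    and eq: "\<And>j l. j \<in> I \<Longrightarrow> l \<in> I \<Longrightarrow> B (e j) (e l) = B' (e j) (e l)"
    and x: "x \<in> carrier G" and y: "y \<in> carrier G"
  shows "B x y = B' x y"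
proof (rule hom_eq_on_basis[of "\<lambda>x. B x y" "\<lambda>x. B' x y", OF _ _ _ x])
  fix j assume j: "j \<in> I"
  show "B (e j) y = B' (e j) y"
    by (rule hom_eq_on_basis[of "B (e j)" "B' (e j)", OF _ _ _ y])
      (use e_closed[OF j] cl right eq[OF j] in \<open>auto intro: homI\<close>)
qed (use cl left y in \<open>auto intro: homI\<close>)

lemma circ_set_eq_on_basis:
  assumes "invariant_product G B" "quadratic_datum G Y B' q"
    "\<forall>j\<in>I. \<forall>l\<in>I. B (e j) (e l) = B' (e j) (e l)"
  shows "circ_set G B = circ_set G B'"
proof -
  interpret B: invariant_product G B by fact
  interpret B': quadratic_datum G Y B' q by fact
  have "B x y = B' x y" if "x \<in> carrier G" "y \<in> carrier G" for x y
    by (rule biadditive_eq_on_basis[OF _ _ _ _ _ _ _ that]) (use assms(3) in \<open>auto simp: B.B_mult B'.B_mult B.B_mult2 B'.B_mult2\<close>)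
  then show ?thesis unfolding circ_set_def circ_def by (intro image_cong restrict_ext) simp_all
qed

lemma circ_set_neq:
  assumes "quadratic_datum G Y B q" "quadratic_datum G Y' B' q'"
    and a: "a \<in> I" "b \<in> I" and ne: "B (e a) (e b) \<noteq> B' (e a) (e b)"
  shows "circ_set G B \<noteq> circ_set G B'"
proof -
  interpret B: quadratic_datum G Y B q by fact
  interpret B': quadratic_datum G Y' B' q' by fact
  have one: "B \<one> x = \<one>" "B' \<one> x = \<one>" if "x \<in> carrier G" for x
    using B.B_Z2[OF that subgroup.one_closed[OF B.Z_sub]] B'.B_Z2[OF that subgroup.one_closed[OF B'.Z_sub]]
    by simp_all
  have "circ_set G B = circ_set G B' \<longleftrightarrow> (\<forall>x\<in>carrier G. \<forall>y\<in>carrier G. B x y = B' x y)"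
    by (rule circ_set_eq_iff) (simp_all add: one)
  then show ?thesis using ne e_closed a by blast
qed

lemma finite_two_lower:
  assumes n0: "n = 0" and top2: "2 \<le> r" "d 2 = D" "3 \<le> r \<longrightarrow> d 3 \<noteq> D"
    and i: "i \<in> I" "i \<noteq> 1" "i \<noteq> 2"
  shows "d i \<noteq> D"
proof -
  have i3: "3 \<le> i" "i \<le> r" using i by auto
  then have "d i \<le> d 3" using d_anti[of 3 i] n0 by linarith
  moreover have "d 3 \<le> D" using d_anti[of t 3] n0 i3 by linarith
  moreover have "d 3 \<noteq> D" using top2 i3 by linarith
  ultimately show ?thesis by linarith
qed

abbreviation trivial_product :: "'a \<Rightarrow> 'a \<Rightarrow> 'a" where "trivial_product \<equiv> \<lambda>x y. \<one>"

lemma card_HH_eq_one: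
  assumes "\<And>B j l. invariant_product G B \<Longrightarrow> circ_set G B \<in> HH G \<Longrightarrow> j \<in> I \<Longrightarrow> l \<in> I \<Longrightarrow> B (e j) (e l) = \<one>"
  shows "card (HH G) = 1"
proof -
  have "HH G = {circ_set G trivial_product}"
  proof (intro equalityI subsetI)
    fix N assume N: "N \<in> HH G"
    then obtain B where B: "N = circ_set G B" "invariant_product G B" using HH_imp_invariant_product by blast
    then show "N \<in> {circ_set G trivial_product}"
      using circ_set_eq_on_basis[OF B(2) quadratic_datum_trivial] assms[OF B(2)] N by simp
  qed (use quadratic_datum.circ_set_in_HH[OF quadratic_datum_trivial] in auto)
  then show ?thesis by simp
qed

lemma card_HH_eq_two:
  assumes P: "quadratic_datum G Y P q" and a: "a \<in> I" "b \<in> I" and ne: "P (e a) (e b) \<noteq> \<one>"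
    and all: "\<And>B. invariant_product G B \<Longrightarrow> circ_set G B \<in> HH G \<Longrightarrow>
      (\<forall>j\<in>I. \<forall>l\<in>I. B (e j) (e l) = \<one>) \<or> (\<forall>j\<in>I. \<forall>l\<in>I. B (e j) (e l) = P (e j) (e l))"
  shows "card (HH G) = 2"
proof -
  have "HH G = {circ_set G trivial_product, circ_set G P}"
  proof (intro equalityI subsetI)
    fix N assume N: "N \<in> HH G"
    then obtain B where B: "N = circ_set G B" "invariant_product G B" using HH_imp_invariant_product by blast
    then show "N \<in> {circ_set G trivial_product, circ_set G P}"
      using circ_set_eq_on_basis[OF B(2) quadratic_datum_trivial] circ_set_eq_on_basis[OF B(2) P] all[OF B(2)] N
      by auto
  qed (use quadratic_datum.circ_set_in_HH[OF quadratic_datum_trivial] quadratic_datum.circ_set_in_HH[OF P] in auto)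
  moreover have "circ_set G P \<noteq> circ_set G trivial_product"
    by (rule circ_set_neq[OF P quadratic_datum_trivial a ne])
  ultimately show ?thesis by auto
qed

lemma card_HH_eq_four:
  assumes P: "quadratic_datum G Y P q" and Q: "quadratic_datum G Y Q q'"
    and a: "a \<in> I" "b \<in> I" and a': "a' \<in> I" "b' \<in> I"
    and Pab: "P (e a) (e b) \<noteq> \<one>" "Q (e a) (e b) = \<one>"
    and Qab: "Q (e a') (e b') \<noteq> \<one>" "P (e a') (e b') = \<one>"
    and all: "\<And>B. invariant_product G B \<Longrightarrow> circ_set G B \<in> HH G \<Longrightarrow>
      (\<forall>j\<in>I. \<forall>l\<in>I. B (e j) (e l) = \<one>) \<or> (\<forall>j\<in>I. \<forall>l\<in>I. B (e j) (e l) = P (e j) (e l)) \<or>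
      (\<forall>j\<in>I. \<forall>l\<in>I. B (e j) (e l) = Q (e j) (e l)) \<or>
      (\<forall>j\<in>I. \<forall>l\<in>I. B (e j) (e l) = P (e j) (e l) \<otimes> Q (e j) (e l))"
  shows "card (HH G) = 4"
proof -
  let ?PQ = "\<lambda>x y. P x y \<otimes> Q x y"
  have PQ: "quadratic_datum G Y ?PQ (\<lambda>x. q x \<otimes> q' x)" by (rule quadratic_datum_mult[OF P Q])
  note T = quadratic_datum_trivial
  interpret P: quadratic_datum G Y P q by fact
  interpret Q: quadratic_datum G Y Q q' by fact
  have "HH G = {circ_set G trivial_product, circ_set G P, circ_set G Q, circ_set G ?PQ}"
  proof (intro equalityI subsetI)
    fix N assume N: "N \<in> HH G"
    then obtain B where B: "N = circ_set G B" "invariant_product G B" using HH_imp_invariant_product by blast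
    then show "N \<in> {circ_set G trivial_product, circ_set G P, circ_set G Q, circ_set G ?PQ}"
      using circ_set_eq_on_basis[OF B(2) T] circ_set_eq_on_basis[OF B(2) P] circ_set_eq_on_basis[OF B(2) Q]
        circ_set_eq_on_basis[OF B(2) PQ] all[OF B(2)] N by auto
  qed (use quadratic_datum.circ_set_in_HH[OF T] P.circ_set_in_HH Q.circ_set_in_HH
      quadratic_datum.circ_set_in_HH[OF PQ] in auto)
  moreover have cl: "P (e a) (e b) \<in> carrier G" "Q (e a') (e b') \<in> carrier G"
    using a a' e_closed by auto
  moreover have "circ_set G P \<noteq> circ_set G trivial_product" "circ_set G Q \<noteq> circ_set G trivial_product"
    "circ_set G P \<noteq> circ_set G Q" "circ_set G ?PQ \<noteq> circ_set G trivial_product"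
    "circ_set G ?PQ \<noteq> circ_set G P" "circ_set G ?PQ \<noteq> circ_set G Q"
    using circ_set_neq[OF P T a] circ_set_neq[OF Q T a'] circ_set_neq[OF P Q a]
      circ_set_neq[OF PQ T a] circ_set_neq[OF PQ P a'] circ_set_neq[OF PQ Q a] Pab Qab cl by simp_all
  ultimately show ?thesis by auto
qed

end

context basis_product
begin

lemma u_unique_top_cases:
  assumes top: unique_top and n: "n < r" and j: "j \<in> I" and l: "l \<in> I"
  shows "u j l = \<one> \<or> u j l = w t"
  using u_unique_top[OF top n j l] c_u_top_cases[OF t_in[OF n] _ refl j l]
  by (auto simp: w_def int_pow_int)

lemma u_rank_one_cases:
  assumes n: "n = 1" and r: "1 < r"
  shows "(\<forall>p\<in>I. p \<noteq> 1 \<longrightarrow> u p 1 = \<one>) \<or> (\<forall>p\<in>I. p \<noteq> 1 \<longrightarrow> u p 1 = w p)"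
proof -
  obtain \<beta> where \<beta>: "\<beta> = 0 \<or> \<beta> = int (D div 2)"
    "\<And>p. p \<in> I \<Longrightarrow> p \<noteq> 1 \<Longrightarrow> d p = D \<Longrightarrow> u p 1 = e p [^] \<beta>"
    using u_rank_one_top[OF n r] by metis
  have low: "u p 1 = \<one>" "w p = \<one>" if "p \<in> I" "p \<noteq> 1" "d p \<noteq> D" for p
    using u_rank_one_lower[OF n that] w_lower[of p] that n by auto
  have top: "u p 1 = (if \<beta> = 0 then \<one> else w p)" if p: "p \<in> I" "p \<noteq> 1" "d p = D" for p
    using \<beta>(2)[OF p] \<beta>(1) by (auto simp: w_def int_pow_int)
  have "u p 1 = (if \<beta> = 0 then \<one> else w p)" if "p \<in> I" "p \<noteq> 1" for p
    using low[OF that] top[OF that] by (cases "d p = D") auto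
  then show ?thesis by (cases "\<beta> = 0") auto
qed

lemma u_rank_one_cases_two:
  assumes n: "n = 1" and r: "1 < r" and D: "D = 2" and p: "p \<in> I" "p \<noteq> 1"
  shows "u p 1 = \<one>"
proof -
  have t: "t \<in> I" "t \<noteq> 1" "1 \<in> I" using n r by auto
  have "w t = e t" using D e_closed[OF t(1)] by (simp add: w_def)
  then have "u t 1 \<noteq> w t" using u_not_basis[OF t(1,3)] by simp
  then show ?thesis using u_rank_one_cases[OF n r] p t by auto
qed

text \<open>For \<open>e j\<close> of order four the value \<open>w j\<close> is the square of \<open>e j\<close>, so that a fourth power results; for \<open>e j\<close> of
  order two the square is already trivial.\<close>

lemma square_cancels:
  assumes D: "D = 4" and j: "j \<in> I" "n < j" and ujj: "u j j = (if d j = D then w j else \<one>)"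
  shows "e j \<otimes> e j \<otimes> u j j = \<one>"
proof -
  have ej: "e j \<in> carrier G" by (rule e_closed[OF j(1)])
  have sq: "e j [^] (2::nat) = e j \<otimes> e j" by (rule nat_pow_two[OF ej])
  have wj: "w j = e j [^] (2::nat)" by (simp add: w_def D)
  show ?thesis
  proof (cases "d j = D")
    case True
    then have "e j \<otimes> e j \<otimes> u j j = e j [^] (2::nat) \<otimes> e j [^] (2::nat)" using ujj wj sq by simp
    also have "\<dots> = e j [^] d j" using nat_pow_mult[OF ej, of 2 2] True D by simp
    finally show ?thesis using e_pow[OF j(1)] by simp
  next
    case False
    then show ?thesis using ujj w_lower[OF j False] wj sq by simp
  qed
qed

lemma u_finite_two_cases:
  assumes n0: "n = 0" and top2: "2 \<le> r" "d 2 = D" "3 \<le> r \<longrightarrow> d 3 \<noteq> D"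
  shows "(\<forall>j\<in>I. \<forall>l\<in>I. u j l = \<one>) \<or> (\<forall>j\<in>I. \<forall>l\<in>I. u j l = plane (e j) (e l))"
proof -
  note f = dI[OF n0 top2]
  obtain \<beta> where \<beta>: "\<beta> = 0 \<or> \<beta> = int (D div 2)"
    and v: "u 1 1 = e 1 [^] \<beta>" "u 2 2 = e 2 [^] \<beta>" "u 1 2 = e 1 [^] \<beta> \<otimes> e 2 [^] \<beta>"
    using u_rank_zero_two[OF n0 top2] by metis
  have low: "u j l = \<one>" if j: "j \<in> I" and l: "l \<in> I" and jl: "j \<notin> {1, 2} \<or> l \<notin> {1, 2}" for j l
  proof -
    have ne: "d i \<noteq> D" if "i \<in> I" "i \<notin> {1, 2}" for i
      using finite_two_lower[OF n0 top2 that(1)] that(2) by simp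
    show ?thesis using jl
    proof
      assume "j \<notin> {1, 2}"
      then show ?thesis by (rule u_rank_zero_two_lower[OF n0 top2(1,2) j ne[OF j] l])
    next
      assume "l \<notin> {1, 2}"
      then have "u l j = \<one>" by (rule u_rank_zero_two_lower[OF n0 top2(1,2) l ne[OF l] j])
      then show ?thesis using u_sym[OF j l] by simp
    qed
  qed
  have u21: "u 2 1 = u 1 2" by (rule u_sym[OF f(2,1)])
  show ?thesis using \<beta>
  proof
    assume "\<beta> = 0"
    then have "u j l = \<one>" if "j \<in> I" "l \<in> I" for j l
      using v u21 low[OF that] by (cases "j \<in> {1,2} \<and> l \<in> {1,2}") auto
    then show ?thesis by blast
  next
    assume b: "\<beta> = int (D div 2)"
    have w: "e 1 [^] \<beta> = w 1" "e 2 [^] \<beta> = w 2" unfolding b w_def by (simp_all only: int_pow_int)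
    have "u j l = plane (e j) (e l)" if "j \<in> I" "l \<in> I" for j l
      unfolding plane_e[OF n0 top2 that] using v u21 low[OF that] w by (cases "j \<in> {1,2} \<and> l \<in> {1,2}") auto
    then show ?thesis by blast
  qed
qed

end

context adapted_basis
begin

lemma basis_productI: "invariant_product G B \<Longrightarrow> basis_product G n r e d B"
  by (intro basis_product.intro adapted_basis_axioms)

lemma card_HH_large_rank: "3 \<le> n \<or> r = n \<Longrightarrow> card (HH G) = 1"
proof (rule card_HH_eq_one)
  fix B j l assume n: "3 \<le> n \<or> r = n" and "invariant_product G B" and jl: "j \<in> I" "l \<in> I"
  then interpret basis_product G n r e d B by (intro basis_productI)
  show "B (e j) (e l) = \<one>" using n u_rank_three[OF _ jl] u_no_torsion[OF _ jl] by blast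
qed

lemma card_HH_rank_two_unique:
  assumes n: "n = 2" and r: "2 < r" and top: unique_top
  shows "card (HH G) = 2"
proof -
  have I12: "1 \<in> I" "2 \<in> I" "d 1 = 0" "d 2 = 0" using n r d_zero[of 1] d_zero[of 2] by auto
  have nr: "n < r" using n r by simp
  have wt: "w t \<in> carrier G" "w t \<noteq> \<one>" using e_closed[OF t_in[OF nr]] w_top_not_one[OF t_in[OF nr] nr refl] by (auto simp: w_def)
  have P: "quadratic_datum G Z (alt 1 2 (w t)) (alt_q 1 2 (w t))"
  proof (rule quadratic_datum_alt[OF nr top I12(1,2)])
    show "even (c 1 z) \<and> even (c 2 z)" if "z \<in> Z" for z using Z_coord_infinite[OF nr that] I12 n by simp
    show "0 < d j \<and> 2 * d j dvd d 1 \<and> 2 * d j dvd d 2" if "j \<in> I" "j \<noteq> 1" "j \<noteq> 2" for j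
      using d_zero[of j] that I12 n by auto
  qed simp
  show ?thesis
  proof (rule card_HH_eq_two[OF P I12(1,2)])
    show "alt 1 2 (w t) (e 1) (e 2) \<noteq> \<one>" using alt_e[of 1 2 "w t" 1 2] I12 wt by simp
    fix B assume "invariant_product G B"
    then interpret basis_product G n r e d B by (intro basis_productI)
    define v where "v = u 1 2"
    have form: "u j l = (if (j = 1 \<and> l = 2) \<or> (j = 2 \<and> l = 1) then v else \<one>)" if "j \<in> I" "l \<in> I" for j l
      unfolding v_def using u_rank_two[OF n that] u_sym[OF I12(1,2)] by auto
    have Q: "alt 1 2 (w t) (e j) (e l) = (if (j = 1 \<and> l = 2) \<or> (j = 2 \<and> l = 1) then w t else \<one>)"
      if "j \<in> I" "l \<in> I" for j l by (rule alt_e[OF I12(1,2) _ wt(1) that]) simp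
    have "v = \<one> \<or> v = w t" unfolding v_def by (rule u_unique_top_cases[OF top nr I12(1,2)])
    then show "(\<forall>j\<in>I. \<forall>l\<in>I. u j l = \<one>) \<or> (\<forall>j\<in>I. \<forall>l\<in>I. u j l = alt 1 2 (w t) (e j) (e l))"
      by (elim disjE) (simp_all add: form Q del: atLeastAtMost_iff)
  qed
qed

lemma card_HH_rank_two:
  assumes n: "n = 2" and top: "\<not> unique_top"
  shows "card (HH G) = 1"
proof (rule card_HH_eq_one)
  fix B j l assume "invariant_product G B" and jl: "j \<in> I" "l \<in> I"
  then interpret basis_product G n r e d B by (intro basis_productI)
  show "B (e j) (e l) = \<one>" using u_rank_two[OF n jl] u_infinite[OF top] jl n by auto
qed

context
  assumes n: "n = 1" and r: "1 < r"
begin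

lemma rank_one_facts: "n < r" "1 \<in> I" "t \<in> I" "t \<noteq> 1" "d 1 = 0" "w t \<in> carrier G" "w t \<noteq> \<one>"
proof -
  show nr: "n < r" and "1 \<in> I" "t \<noteq> 1" "d 1 = 0" using n r d_zero[of 1] by auto
  show t: "t \<in> I" by (rule t_in[OF nr])
  show "w t \<in> carrier G" "w t \<noteq> \<one>" using e_closed[OF t] w_top_not_one[OF t nr refl] by (auto simp: w_def)
qed

lemma quadratic_datum_rank_one_diag:
  assumes top: unique_top shows "quadratic_datum G Z (diag 1 (w t)) (diag_q 1 (w t))"
proof (rule quadratic_datum_diag[OF rank_one_facts(1) top rank_one_facts(2)])
  show "4 dvd c 1 z" if "z \<in> Z" for z using Z_coord_infinite[OF rank_one_facts(1) that rank_one_facts(2)] n by simp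
  show "0 < d j \<and> 2 * d j dvd d 1" if "j \<in> I" "j \<noteq> 1" for j
    using d_zero[of j] that rank_one_facts n by auto
qed (simp add: rank_one_facts)

lemma card_HH_rank_one_unique:
  assumes top: unique_top and D: "4 dvd D" shows "card (HH G) = 4"
proof (rule card_HH_eq_four[OF quadratic_datum_rank_one_diag[OF top] quadratic_datum_cross[OF n r D]
      rank_one_facts(2,2) rank_one_facts(3,2)])
  note f = rank_one_facts
  show "diag 1 (w t) (e 1) (e 1) \<noteq> \<one>" "cross (e 1) (e 1) = \<one>"
    "cross (e t) (e 1) \<noteq> \<one>" "diag 1 (w t) (e t) (e 1) = \<one>"
    using f cross_e[OF n r f(2,2)] cross_e[OF n r f(3,2)]
      diag_e[OF f(2,6) f(2,2)] diag_e[OF f(2,6) f(3,2)] by auto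
  fix B assume "invariant_product G B"
  then interpret basis_product G n r e d B by (intro basis_productI)
  have fin: "u j l = \<one>" if "j \<in> I" "l \<in> I" "j \<noteq> 1" "l \<noteq> 1" for j l
    using u_rank_one_finite[OF n] that by blast
  have sym: "u 1 l = u l 1" if "l \<in> I" for l using u_sym[OF f(2) that] .
  have wcl: "w j \<in> carrier G" if "j \<in> I" for j using e_closed[OF that] by (simp add: w_def)
  define v where "v = u 1 1"
  have c11: "v = \<one> \<or> v = w t" unfolding v_def by (rule u_unique_top_cases[OF top f(1,2,2)])
  have PQ: "diag 1 (w t) (e j) (e l) = (if j = 1 \<and> l = 1 then w t else \<one>)"
    "cross (e j) (e l) = (if j = 1 \<and> l \<noteq> 1 then w l else if j \<noteq> 1 \<and> l = 1 then w j else \<one>)"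
    if "j \<in> I" "l \<in> I" for j l using diag_e[OF f(2,6) that] cross_e[OF n r that] by auto
  show "(\<forall>j\<in>I. \<forall>l\<in>I. u j l = \<one>) \<or> (\<forall>j\<in>I. \<forall>l\<in>I. u j l = diag 1 (w t) (e j) (e l)) \<or>
      (\<forall>j\<in>I. \<forall>l\<in>I. u j l = cross (e j) (e l)) \<or>
      (\<forall>j\<in>I. \<forall>l\<in>I. u j l = diag 1 (w t) (e j) (e l) \<otimes> cross (e j) (e l))"
    using u_rank_one_cases[OF n r]
  proof
    assume a: "\<forall>p\<in>I. p \<noteq> 1 \<longrightarrow> u p 1 = \<one>"
    have form: "u j l = (if j = 1 \<and> l = 1 then v else \<one>)" if "j \<in> I" "l \<in> I" for j l
      unfolding v_def using a fin[OF that] sym[OF that(2)] that by (cases "j = 1"; cases "l = 1") auto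
    show ?thesis using c11 by (elim disjE) (simp_all add: form PQ(1) del: atLeastAtMost_iff)
  next
    assume a: "\<forall>p\<in>I. p \<noteq> 1 \<longrightarrow> u p 1 = w p"
    have form: "u j l = (if j = 1 \<and> l = 1 then v else if j = 1 then w l else if l = 1 then w j else \<one>)"
      if "j \<in> I" "l \<in> I" for j l
      unfolding v_def using a fin[OF that] sym[OF that(2)] that by (cases "j = 1"; cases "l = 1") auto
    have "(\<forall>j\<in>I. \<forall>l\<in>I. u j l = cross (e j) (e l)) \<or>
      (\<forall>j\<in>I. \<forall>l\<in>I. u j l = diag 1 (w t) (e j) (e l) \<otimes> cross (e j) (e l))"
      using c11 f(6) wcl by (elim disjE) (simp_all add: form PQ del: atLeastAtMost_iff)
    then show ?thesis by blast
  qed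
qed

lemma card_HH_rank_one_unique_two:
  assumes top: unique_top and D: "D = 2" shows "card (HH G) = 2"
proof (rule card_HH_eq_two[OF quadratic_datum_rank_one_diag[OF top] rank_one_facts(2,2)])
  note f = rank_one_facts
  show "diag 1 (w t) (e 1) (e 1) \<noteq> \<one>" using f diag_e[OF f(2,6) f(2,2)] by auto
  fix B assume "invariant_product G B"
  then interpret basis_product G n r e d B by (intro basis_productI)
  define v where "v = u 1 1"
  have form: "u j l = (if j = 1 \<and> l = 1 then v else \<one>)" if "j \<in> I" "l \<in> I" for j l
    unfolding v_def using u_rank_one_cases_two[OF n r D that(1)] u_rank_one_cases_two[OF n r D that(2)]
      u_rank_one_finite[OF n that(1) _ that(2)] u_sym[OF f(2) that(2)]
    by (cases "j = 1"; cases "l = 1") auto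
  have "v = \<one> \<or> v = w t" unfolding v_def by (rule u_unique_top_cases[OF top f(1,2,2)])
  then show "(\<forall>j\<in>I. \<forall>l\<in>I. u j l = \<one>) \<or> (\<forall>j\<in>I. \<forall>l\<in>I. u j l = diag 1 (w t) (e j) (e l))"
    by (elim disjE) (simp_all add: form diag_e[OF f(2,6)] del: atLeastAtMost_iff)
qed

lemma card_HH_rank_one:
  assumes top: "\<not> unique_top" and D: "4 dvd D" shows "card (HH G) = 2"
proof (rule card_HH_eq_two[OF quadratic_datum_cross[OF n r D] rank_one_facts(3,2)])
  note f = rank_one_facts
  show "cross (e t) (e 1) \<noteq> \<one>" using f cross_e[OF n r f(3,2)] by auto
  fix B assume "invariant_product G B"
  then interpret basis_product G n r e d B by (intro basis_productI)
  have u11: "u 1 1 = \<one>" using u_infinite[OF top f(2) _ f(2)] n by simp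
  show "(\<forall>j\<in>I. \<forall>l\<in>I. u j l = \<one>) \<or> (\<forall>j\<in>I. \<forall>l\<in>I. u j l = cross (e j) (e l))"
    using u_rank_one_cases[OF n r]
  proof
    assume a: "\<forall>p\<in>I. p \<noteq> 1 \<longrightarrow> u p 1 = \<one>"
    have "u j l = \<one>" if "j \<in> I" "l \<in> I" for j l
      using a u_rank_one_finite[OF n that(1) _ that(2)] u_sym[OF f(2) that(2)] that u11
      by (cases "j = 1"; cases "l = 1") auto
    then show ?thesis by blast
  next
    assume a: "\<forall>p\<in>I. p \<noteq> 1 \<longrightarrow> u p 1 = w p"
    have "u j l = cross (e j) (e l)" if "j \<in> I" "l \<in> I" for j l
      using a u_rank_one_finite[OF n that(1) _ that(2)] u_sym[OF f(2) that(2)] that u11 cross_e[OF n r that]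
      by (cases "j = 1"; cases "l = 1") auto
    then show ?thesis by blast
  qed
qed

lemma card_HH_rank_one_two:
  assumes top: "\<not> unique_top" and D: "D = 2" shows "card (HH G) = 1"
proof (rule card_HH_eq_one)
  note f = rank_one_facts
  fix B j l assume "invariant_product G B" and jl: "j \<in> I" "l \<in> I"
  then interpret basis_product G n r e d B by (intro basis_productI)
  have u11: "u 1 1 = \<one>" using u_infinite[OF top f(2) _ f(2)] n by simp
  show "u j l = \<one>"
    using u_rank_one_cases_two[OF n r D] u_rank_one_finite[OF n jl(1) _ jl(2)] u_sym[OF f(2) jl(2)] jl u11
    by (cases "j = 1"; cases "l = 1") auto
qed

end

lemma card_HH_finite_three:
  assumes n: "n = 0" and r: "3 \<le> r" "d 3 = D" shows "card (HH G) = 1"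
proof (rule card_HH_eq_one)
  fix B j l assume "invariant_product G B" and jl: "j \<in> I" "l \<in> I"
  then interpret basis_product G n r e d B by (intro basis_productI)
  show "u j l = \<one>" by (rule u_rank_zero_three[OF n r jl])
qed

context
  assumes n0: "n = 0" and top2: "2 \<le> r" "d 2 = D" "3 \<le> r \<longrightarrow> d 3 \<noteq> D"
begin

lemma card_HH_finite_two_large:
  assumes D: "8 dvd D" shows "card (HH G) = 2"
proof (rule card_HH_eq_two[OF quadratic_datum_plane[OF n0 top2 D]])
  note f = dI[OF n0 top2]
  show "1 \<in> I" "1 \<in> I" by (fact f)+
  show "plane (e 1) (e 1) \<noteq> \<one>" using plane_e[OF n0 top2 f(1,1)] w12_distinct[OF n0 top2] by simp
  fix B assume "invariant_product G B"
  then interpret basis_product G n r e d B by (intro basis_productI)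
  show "(\<forall>j\<in>I. \<forall>l\<in>I. u j l = \<one>) \<or> (\<forall>j\<in>I. \<forall>l\<in>I. u j l = plane (e j) (e l))"
    by (rule u_finite_two_cases[OF n0 top2])
qed

lemma card_HH_finite_two_small:
  assumes D: "D = 2 \<or> D = 4" shows "card (HH G) = 1"
proof (rule card_HH_eq_one)
  note f = dI[OF n0 top2]
  fix B j l assume B: "invariant_product G B" and HH: "circ_set G B \<in> HH G" and jl: "j \<in> I" "l \<in> I"
  from B interpret basis_product G n r e d B by (intro basis_productI)
  have "\<not> (\<forall>j\<in>I. \<forall>l\<in>I. u j l = plane (e j) (e l))"
  proof
    assume plane: "\<forall>j\<in>I. \<forall>l\<in>I. u j l = plane (e j) (e l)"
    show False using D
    proof
      assume D: "D = 2"
      have "u 1 1 = w 1" using plane f plane_e[OF n0 top2 f(1,1)] by simp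
      then have "u 1 1 = e 1" using D e_closed[OF f(1)] by (simp add: w_def)
      then show False using u_not_basis[OF f(1,1)] by simp
    next
      assume D: "D = 4"
      have "e j \<otimes> e j \<otimes> u j j = \<one>" if j: "j \<in> I" for j
      proof (rule square_cancels[OF D j])
        show "n < j" using n0 j by auto
        have "d j = D \<longleftrightarrow> j = 1 \<or> j = 2" using finite_two_lower[OF n0 top2 j] f(3) top2(2) by metis
        then show "u j j = (if d j = D then w j else \<one>)"
          using bspec[OF bspec[OF plane j] j] plane_e[OF n0 top2 j j] by auto
      qed
      then show False using not_in_HH_if_square[OF n0 D] HH f n0 by simp
    qed
  qed
  then show "u j l = \<one>" using u_finite_two_cases[OF n0 top2] jl by blast
qed

end

context
  assumes n0: "n = 0" and r: "0 < r" and top: unique_top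
begin

lemma finite_unique_facts: "1 \<in> I" "t = 1" "d 1 = D" "n < r" "w 1 \<in> carrier G" "w 1 \<noteq> \<one>"
proof -
  show 1: "1 \<in> I" and "t = 1" and D: "d 1 = D" and nr: "n < r" using n0 r by auto
  show "w 1 \<in> carrier G" "w 1 \<noteq> \<one>" using e_closed[OF 1] w_top_not_one[OF 1 nr D] by (auto simp: w_def)
qed

lemma finite_unique_lower: "j \<in> I \<Longrightarrow> j \<noteq> 1 \<Longrightarrow> d j > 0 \<and> 2 * d j dvd d 1"
proof -
  assume j: "j \<in> I" "j \<noteq> 1"
  then have nj: "n < j" "j \<noteq> t" using n0 by auto
  then have "2 * d j dvd D" using lower_dvd[OF j(1)] unique_topD[OF top j(1)] by blast
  moreover have "d j > 0" using d_zero[OF j(1)] nj by auto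
  ultimately show ?thesis unfolding finite_unique_facts(3) by blast
qed

lemma quadratic_datum_finite_diag:
  assumes D: "8 dvd D" shows "quadratic_datum G Z (diag 1 (w 1)) (diag_q 1 (w 1))"
proof -
  note f = finite_unique_facts
  have "quadratic_datum G Z (diag 1 (w t)) (diag_q 1 (w t))"
  proof (rule quadratic_datum_diag[OF f(4) top f(1) _ _ finite_unique_lower])
    have D2: "4 dvd D div 2" "4 dvd D" using D by (auto elim!: dvdE)
    then show "4 dvd d 1" using f(3) by simp
    show "4 dvd c 1 z" if "z \<in> Z" for z using Z_coord_dvd[OF that f(1), of 4] D2 f(3) by simp
  qed
  then show ?thesis unfolding f(2) .
qed

lemma quadratic_datum_finite_alt:
  assumes D: "4 dvd D" and r2: "2 \<le> r" "3 \<le> r \<longrightarrow> d 3 \<noteq> d 2"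
  shows "quadratic_datum G Z (alt 1 2 (w 1)) (alt_q 1 2 (w 1))"
proof -
  note f = finite_unique_facts
  have I2: "2 \<in> I" using r2 by simp
  have "quadratic_datum G Z (alt 1 2 (w t)) (alt_q 1 2 (w t))"
  proof (rule quadratic_datum_alt[OF f(4) top f(1) I2])
    have D2: "2 dvd D div 2" using D by (auto elim!: dvdE)
    show "even (c 1 z) \<and> even (c 2 z)" if "z \<in> Z" for z
      using Z_coord_dvd[OF that f(1), of 2] Z_coord_dvd[OF that I2, of 2] D2 d_even[OF f(1)] d_even[OF I2] by simp
    show "0 < d j \<and> 2 * d j dvd d 1 \<and> 2 * d j dvd d 2" if j: "j \<in> I" "j \<noteq> 1" "j \<noteq> 2" for j
    proof -
      have "d j \<le> d 3" "d 3 \<le> d 2" "d 3 \<noteq> d 2" using d_anti[of 3 j] d_anti[of 2 3] j n0 r2 by auto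
      then have "d 2 \<noteq> d j" by simp
      then have "2 * d j dvd d 2" using d_dvd2[OF I2 j(1)] j by auto
      then show ?thesis using finite_unique_lower[OF j(1,2)] by simp
    qed
  qed simp
  then show ?thesis unfolding f(2) .
qed

end

end

context basis_product
begin

text \<open>A basis element \<open>e i\<close> with \<open>i \<noteq> 1\<close> whose order is at least that of \<open>e p\<close> kills \<open>u p 1\<close>. Only \<open>p = 2\<close> can escape, and
  only if the order of \<open>e 2\<close> is not repeated.\<close>

lemma u_finite_unique_form:
  assumes n0: "n = 0" and r: "0 < r" and top: unique_top and j: "j \<in> I" and l: "l \<in> I"
  shows "u j l = (if j = 1 \<and> l = 1 then u 1 1
    else if 2 \<le> r \<and> (3 \<le> r \<longrightarrow> d 3 \<noteq> d 2) \<and> ((j = 1 \<and> l = 2) \<or> (j = 2 \<and> l = 1)) then u 2 1 else \<one>)"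
proof -
  have I1: "1 \<in> I" using r by simp
  have up1: "u p 1 = \<one>" if p: "p \<in> I" "p \<noteq> 1" "\<not> (p = 2 \<and> (3 \<le> r \<longrightarrow> d 3 \<noteq> d 2))" for p
  proof (cases "p = 2")
    case True
    then have "3 \<le> r" "d 3 = d 2" using p by auto
    then show ?thesis using u_rank_zero_one_first[OF n0 top p(1,2), of 3] True by auto
  next
    case False
    then have "d p dvd d 2" using d_dvd[of 2 p] p by auto
    then show ?thesis using u_rank_zero_one_first[OF n0 top p(1,2), of 2] False p by auto
  qed
  have r2: "2 \<le> r" if "2 \<in> I" using that by simp
  show ?thesis
    using up1[OF j] up1[OF l] u_rank_zero_one_other[OF n0 top j _ l] u_sym[OF I1 l] u_sym[OF I1 j] j l r2
    by (cases "j = 1"; cases "l = 1") auto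
qed

text \<open>A nontrivial square \<open>u 1 1\<close> is the involution below \<open>e 1\<close>. For \<open>D = 2\<close> this is \<open>e 1\<close>, which is not a
  product; for \<open>D = 4\<close> it is the square of \<open>e 1\<close>, and then the circle group has exponent two.\<close>

lemma u_finite_unique_first:
  assumes n0: "n = 0" and r: "0 < r" and top: unique_top and D: "D = 2 \<or> D = 4"
    and HH: "circ_set G B \<in> HH G"
  shows "u 1 1 = \<one>"
proof (rule ccontr)
  note f = finite_unique_facts[OF n0 r top]
  assume "u 1 1 \<noteq> \<one>"
  then have u11: "u 1 1 = w 1" using u_unique_top_cases[OF top f(4,1,1)] f(2) by simp
  show False using D
  proof
    assume "D = 2"
    then have "u 1 1 = e 1" using u11 e_closed[OF f(1)] by (simp add: w_def)
    then show False using u_not_basis[OF f(1,1)] by simp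
  next
    assume D: "D = 4"
    have "e j \<otimes> e j \<otimes> u j j = \<one>" if j: "j \<in> I" for j
    proof (rule square_cancels[OF D j])
      show "n < j" using n0 j by auto
      then have "d j = D \<longleftrightarrow> j = 1" using f(2,3) unique_topD[OF top j] by metis
      then show "u j j = (if d j = D then w j else \<one>)"
        using u11 u_rank_zero_one_other[OF n0 top j _ j] by auto
    qed
    then show False using not_in_HH_if_square[OF n0 D] HH r by simp
  qed
qed

end

context adapted_basis
begin

context
  assumes n0: "n = 0" and r: "0 < r" and top: unique_top
begin

lemmas unique_facts = finite_unique_facts[OF n0 r top]
  and unique_diag = quadratic_datum_finite_diag[OF n0 r top]
  and unique_alt = quadratic_datum_finite_alt[OF n0 r top]

lemma card_HH_finite_unique_four:
  assumes D: "8 dvd D" and r2: "2 \<le> r" "3 \<le> r \<longrightarrow> d 3 \<noteq> d 2" shows "card (HH G) = 4"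
proof -
  note f = unique_facts
  have D4: "4 dvd D" using D by (auto elim!: dvdE)
  have I2: "2 \<in> I" using r2 by simp
  show ?thesis
  proof (rule card_HH_eq_four[OF unique_diag[OF D] unique_alt[OF D4 r2]
        f(1,1) I2 f(1)])
    have PQ: "diag 1 (w 1) (e j) (e l) = (if j = 1 \<and> l = 1 then w 1 else \<one>)"
      "alt 1 2 (w 1) (e j) (e l) = (if (j = 1 \<and> l = 2) \<or> (j = 2 \<and> l = 1) then w 1 else \<one>)"
      if "j \<in> I" "l \<in> I" for j l using diag_e[OF f(1,5) that] alt_e[OF f(1) I2 _ f(5) that] by auto
    show "diag 1 (w 1) (e 1) (e 1) \<noteq> \<one>" "alt 1 2 (w 1) (e 1) (e 1) = \<one>"
      "alt 1 2 (w 1) (e 2) (e 1) \<noteq> \<one>" "diag 1 (w 1) (e 2) (e 1) = \<one>"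
      using PQ f I2 by auto
    fix B assume "invariant_product G B"
    then interpret basis_product G n r e d B by (intro basis_productI)
    define v v' where "v = u 1 1" and "v' = u 2 1"
    have form: "u j l = (if j = 1 \<and> l = 1 then v else if (j = 1 \<and> l = 2) \<or> (j = 2 \<and> l = 1) then v' else \<one>)"
      if "j \<in> I" "l \<in> I" for j l unfolding v_def v'_def using u_finite_unique_form[OF n0 r top that] r2 by simp
    have "v = \<one> \<or> v = w 1" "v' = \<one> \<or> v' = w 1"
      unfolding v_def v'_def using u_unique_top_cases[OF top f(4,1,1)] u_unique_top_cases[OF top f(4) I2 f(1)] f(2) by simp_all
    then show "(\<forall>j\<in>I. \<forall>l\<in>I. u j l = \<one>) \<or> (\<forall>j\<in>I. \<forall>l\<in>I. u j l = diag 1 (w 1) (e j) (e l)) \<or>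
      (\<forall>j\<in>I. \<forall>l\<in>I. u j l = alt 1 2 (w 1) (e j) (e l)) \<or>
      (\<forall>j\<in>I. \<forall>l\<in>I. u j l = diag 1 (w 1) (e j) (e l) \<otimes> alt 1 2 (w 1) (e j) (e l))"
      using f(5) by (elim disjE) (simp_all add: form PQ del: atLeastAtMost_iff)
  qed
qed

lemma card_HH_finite_unique_diag:
  assumes D: "8 dvd D" and r2: "\<not> (2 \<le> r \<and> (3 \<le> r \<longrightarrow> d 3 \<noteq> d 2))" shows "card (HH G) = 2"
proof -
  note f = unique_facts
  show ?thesis
  proof (rule card_HH_eq_two[OF unique_diag[OF D] f(1,1)])
    show "diag 1 (w 1) (e 1) (e 1) \<noteq> \<one>" using diag_e[OF f(1,5) f(1,1)] f by simp
    fix B assume "invariant_product G B"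
    then interpret basis_product G n r e d B by (intro basis_productI)
    define v where "v = u 1 1"
    have form: "u j l = (if j = 1 \<and> l = 1 then v else \<one>)" if "j \<in> I" "l \<in> I" for j l
      unfolding v_def using u_finite_unique_form[OF n0 r top that] r2 by metis
    have "v = \<one> \<or> v = w 1" unfolding v_def using u_unique_top_cases[OF top f(4,1,1)] f(2) by simp
    then show "(\<forall>j\<in>I. \<forall>l\<in>I. u j l = \<one>) \<or> (\<forall>j\<in>I. \<forall>l\<in>I. u j l = diag 1 (w 1) (e j) (e l))"
      by (elim disjE) (simp_all add: form diag_e[OF f(1,5)] del: atLeastAtMost_iff)
  qed
qed

lemma card_HH_finite_unique_alt:
  assumes D: "D = 4" and r2: "2 \<le> r" "3 \<le> r \<longrightarrow> d 3 \<noteq> d 2" shows "card (HH G) = 2"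
proof -
  note f = unique_facts
  have D4: "4 dvd D" using D by simp
  have I2: "2 \<in> I" using r2 by simp
  show ?thesis
  proof (rule card_HH_eq_two[OF unique_alt[OF D4 r2] I2 f(1)])
    have Q: "alt 1 2 (w 1) (e j) (e l) = (if (j = 1 \<and> l = 2) \<or> (j = 2 \<and> l = 1) then w 1 else \<one>)"
      if "j \<in> I" "l \<in> I" for j l using alt_e[OF f(1) I2 _ f(5) that] by auto
    show "alt 1 2 (w 1) (e 2) (e 1) \<noteq> \<one>" using Q f I2 by auto
    fix B assume B: "invariant_product G B" and HH: "circ_set G B \<in> HH G"
    from B interpret basis_product G n r e d B by (intro basis_productI)
    have u11: "u 1 1 = \<one>" using u_finite_unique_first[OF n0 r top _ HH] D by simp
    define v where "v = u 2 1"
    have form: "u j l = (if (j = 1 \<and> l = 2) \<or> (j = 2 \<and> l = 1) then v else \<one>)"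
      if "j \<in> I" "l \<in> I" for j l unfolding v_def using u_finite_unique_form[OF n0 r top that] r2 u11 by simp
    have "v = \<one> \<or> v = w 1" unfolding v_def using u_unique_top_cases[OF top f(4) I2 f(1)] f(2) by simp
    then show "(\<forall>j\<in>I. \<forall>l\<in>I. u j l = \<one>) \<or> (\<forall>j\<in>I. \<forall>l\<in>I. u j l = alt 1 2 (w 1) (e j) (e l))"
      by (elim disjE) (simp_all add: form Q del: atLeastAtMost_iff)
  qed
qed

lemma card_HH_finite_unique_one:
  assumes D: "D = 2 \<or> D = 4" and r2: "\<not> (2 \<le> r \<and> (3 \<le> r \<longrightarrow> d 3 \<noteq> d 2))" shows "card (HH G) = 1"
proof (rule card_HH_eq_one)
  fix B j l assume B: "invariant_product G B" and HH: "circ_set G B \<in> HH G" and jl: "j \<in> I" "l \<in> I"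
  from B interpret basis_product G n r e d B by (intro basis_productI)
  show "u j l = \<one>"
    using u_finite_unique_form[OF n0 r top jl] r2 u_finite_unique_first[OF n0 r top D HH] by metis
qed

end

end

section \<open>The classification\<close>

(* Back to the default normal form of 1. *)
declare One_nat_def [symmetric, simp del] One_nat_def [simp]

context comm_group
begin

lemma direct_product_of_cyclics_closed:
  "direct_product_of_cyclics G A J g \<Longrightarrow> i \<in> J \<Longrightarrow> g i \<in> A \<and> g i \<in> carrier G"
  unfolding direct_product_of_cyclics_def using subgroup.subset by blast

lemma direct_product_of_cyclics_span:
  assumes dp: "direct_product_of_cyclics G A J g" and a: "a \<in> A"
  shows "\<exists>k. a = finprod G (\<lambda>i. g i [^] (k i :: int)) J"
proof -
  have sub: "subgroup A G" and
    iso: "(\<lambda>f. finprod G f J) \<in> iso (product_group J (\<lambda>i. subgroup_generated G {g i})) (subgroup_generated G A)"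
    using dp by (auto simp: direct_product_of_cyclics_def)
  have "a \<in> carrier (subgroup_generated G A)"
    using a subgroup.carrier_subgroup_generated_subgroup[OF sub] by simp
  then obtain f where f: "f \<in> (\<Pi>\<^sub>E i\<in>J. carrier (subgroup_generated G {g i}))" "a = finprod G f J"
    using iso unfolding iso_iff by auto
  have "\<exists>k::int. f i = g i [^] k" if "i \<in> J" for i
  proof -
    have "g i \<in> carrier G" using direct_product_of_cyclics_closed[OF dp that] by simp
    then show ?thesis using carrier_subgroup_generated_by_singleton[of "g i"] f(1) that by (auto simp: PiE_iff)
  qed
  then obtain k :: "'c \<Rightarrow> int" where k: "\<And>i. i \<in> J \<Longrightarrow> f i = g i [^] k i" by metis
  have "finprod G f J = finprod G (\<lambda>i. g i [^] k i) J"
    using k direct_product_of_cyclics_closed[OF dp] by (intro finprod_cong') auto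
  then show ?thesis using f(2) by blast
qed

lemma direct_product_of_cyclics_indep:
  assumes dp: "direct_product_of_cyclics G A J g"
    and one: "finprod G (\<lambda>i. g i [^] (k i :: int)) J = \<one>" and i: "i \<in> J"
  shows "int (ord (g i)) dvd k i"
proof -
  let ?P = "product_group J (\<lambda>i. subgroup_generated G {g i})"
  have inj: "inj_on (\<lambda>f. finprod G f J) (carrier ?P)"
    using dp unfolding direct_product_of_cyclics_def iso_iff by blast
  have gc: "g i \<in> carrier G" if "i \<in> J" for i using direct_product_of_cyclics_closed[OF dp that] by simp
  define f where "f = (\<lambda>i\<in>J. g i [^] k i)"
  define f1 where "f1 = (\<lambda>i\<in>J. \<one>)"
  have "f \<in> carrier ?P" "f1 \<in> carrier ?P"
    using gc carrier_subgroup_generated_by_singleton subgroup.one_closed[OF subgroup_of_powers]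
    by (auto simp: f_def f1_def PiE_iff)
  moreover have "finprod G f J = finprod G (\<lambda>i. g i [^] k i) J"
    using gc by (intro finprod_cong') (auto simp: f_def)
  moreover have "finprod G f1 J = \<one>" by (rule finprod_one_eqI) (simp add: f1_def)
  ultimately have "f = f1" using inj_onD[OF inj, of f f1] one by simp
  then have "f i = f1 i" by simp
  then have "g i [^] k i = \<one>" using i by (simp add: f_def f1_def)
  then show ?thesis using int_pow_eq_id[OF gc[OF i]] by simp
qed

lemma subgroup_finprod_int_pow:
  assumes A: "subgroup A G" and "finite J" "\<And>i. i \<in> J \<Longrightarrow> g i \<in> A"
  shows "finprod G (\<lambda>i. g i [^] (k i :: int)) J \<in> A"
  using assms(2,3)
proof (induction J)
  case (insert i J)
  have "g j [^] k j \<in> A" if "j \<in> insert i J" for j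
    using insert.prems that subgroup_int_pow_closed[OF A] by blast
  then show ?case using insert subgroup.m_closed[OF A] subgroup.subset[OF A]
    by (subst finprod_insert) auto
qed (use subgroup.one_closed[OF A] in simp)

lemma ord_dvd_card_subgroup:
  assumes "subgroup H G" "finite H" "x \<in> H" shows "ord x dvd card H"
proof -
  interpret H: group "G\<lparr>carrier := H\<rparr>" by (rule subgroup_imp_group[OF assms(1)])
  have "x [^]\<^bsub>G\<lparr>carrier := H\<rparr>\<^esub> order (G\<lparr>carrier := H\<rparr>) = \<one>"
    using H.pow_order_eq_1[of x] assms(3) by simp
  then have "x [^] card H = \<one>" by (simp add: order_def flip: nat_pow_consistent)
  then show ?thesis using pow_eq_id subgroup.subset[OF assms(1)] assms(3) by blast
qed

text \<open>The generators of \<open>F\<close> followed by those of \<open>H\<close>.\<close>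

lemma adapted_basis_exists:
  fixes z x :: "nat \<Rightarrow> 'a" and n m :: nat
  assumes G_eq: "(\<lambda>(a, b). a \<otimes> b) \<in> iso (subgroup_generated G F \<times>\<times> subgroup_generated G H) G"
    and F: "direct_product_of_cyclics G F {1..n} z" and H: "direct_product_of_cyclics G H {1..m} x"
    and z: "\<forall>i\<in>{1..n}. ord (z i) = 0"
    and two: "finite H" "\<exists>k. card H = 2 ^ k"
    and anti: "\<forall>i j. 1 \<le> i \<and> i \<le> j \<and> j \<le> m \<longrightarrow> ord (x i) \<ge> ord (x j)"
    and nontriv: "\<forall>i\<in>{1..m}. ord (x i) > 1"
  shows "adapted_basis G n (n + m) (\<lambda>i. if i \<le> n then z i else x (i - n)) (\<lambda>i. if i \<le> n then 0 else ord (x (i - n)))"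
    (is "adapted_basis G n _ ?e ?d")
proof -
  have sub: "subgroup F G" "subgroup H G" using F H by (auto simp: direct_product_of_cyclics_def)
  have carr: "carrier (subgroup_generated G F) = F" "carrier (subgroup_generated G H) = H"
    using subgroup.carrier_subgroup_generated_subgroup sub by blast+
  have zc: "z i \<in> carrier G" if "i \<in> {1..n}" for i using direct_product_of_cyclics_closed[OF F that] by simp
  have xc: "x i \<in> carrier G" "x i \<in> H" if "i \<in> {1..m}" for i using direct_product_of_cyclics_closed[OF H that] by simp_all
  have idx: "i - n \<in> {1..m}" if "i \<in> {1..n + m}" "\<not> i \<le> n" for i using that by auto
  have split: "finprod G (\<lambda>i. ?e i [^] (k i :: int)) {1..n + m} =
      finprod G (\<lambda>i. z i [^] k i) {1..n} \<otimes> finprod G (\<lambda>i. x i [^] k (n + i)) {1..m}" for k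
  proof -
    have U: "{1..n + m} = {1..n} \<union> (+) n ` {1..m}" by (auto simp: image_add_atLeastAtMost)
    have ec: "(\<lambda>i. ?e i [^] k i) \<in> {1..n} \<rightarrow> carrier G" using zc by auto
    have ec': "(\<lambda>i. ?e i [^] k i) \<in> (+) n ` {1..m} \<rightarrow> carrier G"
    proof
      fix i assume "i \<in> (+) n ` {1..m}"
      then obtain j where "j \<in> {1..m}" "i = n + j" by blast
      then show "?e i [^] k i \<in> carrier G" using xc(1)[of j] by auto
    qed
    have "finprod G (\<lambda>i. ?e i [^] k i) {1..n + m} =
       finprod G (\<lambda>i. ?e i [^] k i) {1..n} \<otimes> finprod G (\<lambda>i. ?e i [^] k i) ((+) n ` {1..m})"
      unfolding U by (rule finprod_Un_disjoint[OF _ _ _ ec ec']) auto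
    also have "finprod G (\<lambda>i. ?e i [^] k i) ((+) n ` {1..m}) = finprod G (\<lambda>i. ?e (n + i) [^] k (n + i)) {1..m}"
      by (rule finprod_reindex[OF ec']) simp
    also have "\<dots> = finprod G (\<lambda>i. x i [^] k (n + i)) {1..m}"
      using xc by (intro finprod_cong') auto
    also have "finprod G (\<lambda>i. ?e i [^] k i) {1..n} = finprod G (\<lambda>i. z i [^] k i) {1..n}"
      using zc by (intro finprod_cong') auto
    finally show ?thesis .
  qed
  have Fc: "finprod G (\<lambda>i. z i [^] (k i :: int)) {1..n} \<in> F" for k
    using direct_product_of_cyclics_closed[OF F] by (intro subgroup_finprod_int_pow[OF sub(1)]) auto
  have Hc: "finprod G (\<lambda>i. x i [^] (k i :: int)) {1..m} \<in> H" for k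
    using direct_product_of_cyclics_closed[OF H] by (intro subgroup_finprod_int_pow[OF sub(2)]) auto
  have inj: "a = \<one> \<and> b = \<one>" if "a \<in> F" "b \<in> H" "a \<otimes> b = \<one>" for a b
  proof -
    have inj: "inj_on (\<lambda>(a, b). a \<otimes> b) (F \<times> H)" using G_eq carr by (auto simp: iso_iff)
    have "(a, b) = (\<one>, \<one>)"
      by (rule inj_onD[OF inj]) (use that subgroup.one_closed[OF sub(1)] subgroup.one_closed[OF sub(2)] in auto)
    then show ?thesis by simp
  qed
  have ordx: "\<exists>k. ord (x i) = 2 ^ Suc k" if i: "i \<in> {1..m}" for i
  proof -
    obtain k where "card H = 2 ^ k" using two by blast
    then have "ord (x i) dvd 2 ^ k" using ord_dvd_card_subgroup[OF sub(2) two(1) xc(2)[OF i]] by simp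
    then obtain j where j: "ord (x i) = 2 ^ j" using divides_primepow_nat[of 2 "ord (x i)" k] by auto
    moreover have "j \<noteq> 0" using bspec[OF nontriv i] j by (cases j) auto
    ultimately show ?thesis by (cases j) auto
  qed
  show ?thesis
  proof unfold_locales
    fix y assume y: "y \<in> carrier G"
    have "(\<lambda>(a, b). a \<otimes> b) ` (F \<times> H) = carrier G" using G_eq carr by (simp add: iso_iff)
    then have "y \<in> (\<lambda>(a, b). a \<otimes> b) ` (F \<times> H)" using y by simp
    then obtain a b where ab: "a \<in> F" "b \<in> H" "y = a \<otimes> b" by auto
    obtain k where k: "a = finprod G (\<lambda>i. z i [^] (k i :: int)) {1..n}"
      using direct_product_of_cyclics_span[OF F ab(1)] by blast
    obtain l where l: "b = finprod G (\<lambda>i. x i [^] (l i :: int)) {1..m}"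
      using direct_product_of_cyclics_span[OF H ab(2)] by blast
    define s where "s i = (if i \<le> n then k i else l (i - n))" for i
    have "a = finprod G (\<lambda>i. z i [^] s i) {1..n}"
      unfolding k using zc by (intro finprod_cong') (auto simp: s_def)
    moreover have "b = finprod G (\<lambda>i. x i [^] s (n + i)) {1..m}"
      unfolding l using xc by (intro finprod_cong') (auto simp: s_def)
    ultimately have "y = finprod G (\<lambda>i. ?e i [^] s i) {1..n + m}" using split ab(3) by simp
    then show "\<exists>k::nat \<Rightarrow> int. y = finprod G (\<lambda>i. ?e i [^] k i) {1..n + m}" by blast
  next
    fix k :: "nat \<Rightarrow> int" and i assume one: "finprod G (\<lambda>i. ?e i [^] k i) {1..n + m} = \<one>" and i: "i \<in> {1..n + m}"
    have "finprod G (\<lambda>i. z i [^] k i) {1..n} = \<one>" "finprod G (\<lambda>i. x i [^] k (n + i)) {1..m} = \<one>"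
      using inj[OF Fc Hc one[unfolded split]] by simp_all
    note ind = direct_product_of_cyclics_indep[OF F this(1)] direct_product_of_cyclics_indep[OF H this(2)]
    show "int (?d i) dvd k i"
    proof (cases "i \<le> n")
      case True
      then show ?thesis using ind(1)[of i] i z by auto
    next
      case False
      then show ?thesis using ind(2)[OF idx[OF i False]] by simp
    qed
  next
    fix i assume i: "i \<in> {1..n + m}"
    show "?e i \<in> carrier G" using zc[of i] xc[OF idx[OF i]] i by (cases "i \<le> n") auto
    show "?e i [^] ?d i = \<one>" using pow_ord_eq_1[of "x (i - n)"] xc[OF idx[OF i]] by (cases "i \<le> n") auto
    show "(?d i = 0) = (i \<le> n)" using ordx[OF idx[OF i]] by (cases "i \<le> n") auto
    show "n < i \<Longrightarrow> \<exists>k. ?d i = 2 ^ Suc k" using ordx[OF idx[OF i]] by auto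
  next
    fix i j assume "n < i" "i \<le> j" "j \<le> n + m"
    then have "1 \<le> i - n \<and> i - n \<le> j - n \<and> j - n \<le> m" by auto
    then have "ord (x (j - n)) \<le> ord (x (i - n))" using anti by blast
    then show "?d j \<le> ?d i" using \<open>n < i\<close> \<open>i \<le> j\<close> by simp
  qed simp
qed

end

text \<open>The witness is the last index of the initial run of equal orders.\<close>

lemma equal_initial_segment_iff:
  fixes d :: "nat \<Rightarrow> nat"
  assumes anti: "\<And>i j. 1 \<le> i \<Longrightarrow> i \<le> j \<Longrightarrow> j \<le> m \<Longrightarrow> d j \<le> d i"
  shows "(\<exists>k. 2 \<le> k \<and> k \<le> m \<and> (\<forall>i\<in>{1..k}. d i = d 1) \<and> d 1 \<ge> 4 \<and> (k < m \<longrightarrow> d k > d (k + 1)))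
    \<longleftrightarrow> 2 \<le> m \<and> d 2 = d 1 \<and> d 1 \<ge> 4" (is "?L \<longleftrightarrow> ?R")
proof
  assume ?L
  then obtain k where k: "2 \<le> k" "k \<le> m" "\<forall>i\<in>{1..k}. d i = d 1" "d 1 \<ge> 4" by blast
  have "2 \<in> {1..k}" using k(1) by simp
  with k(3) have "d 2 = d 1" by (rule bspec)
  moreover have "2 \<le> m" using k(1,2) by (rule order_trans)
  ultimately show ?R using k(4) by blast
next
  assume R: ?R
  define K where "K = {k. 2 \<le> k \<and> k \<le> m \<and> d k = d 1}"
  have fin: "finite K" unfolding K_def by (rule finite_subset[of _ "{..m}"]) auto
  have "2 \<in> K" using R by (simp add: K_def)
  then have "Max K \<in> K" using fin by (intro Max_in) auto
  then have k: "2 \<le> Max K" "Max K \<le> m" "d (Max K) = d 1" by (simp_all add: K_def)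
  have "d i = d 1" if "i \<in> {1..Max K}" for i
    using anti[of 1 i] anti[of i "Max K"] k that by auto
  moreover have "d (Max K + 1) < d (Max K)" if "Max K < m"
  proof -
    have "Max K + 1 \<notin> K" using Max_ge[OF fin, of "Max K + 1"] by auto
    then have "d (Max K + 1) \<noteq> d 1" using k that by (simp add: K_def)
    then show ?thesis using anti[of "Max K" "Max K + 1"] k that by simp
  qed
  ultimately show ?L using k(1,2) R by (intro exI[of _ "Max K"] conjI ballI impI) blast+
qed

context adapted_basis
begin

lemma d_cases: "i \<in> I \<Longrightarrow> n < i \<Longrightarrow> d i = 2 \<or> d i = 4 \<or> (8 dvd d i \<and> 8 \<le> d i)"
proof -
  assume "i \<in> I" "n < i"
  then obtain k where k: "d i = 2 ^ Suc k" using d_two by blast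
  consider "k = 0" | "k = 1" | "2 \<le> k" by linarith
  then show ?thesis
  proof cases
    case 3
    then have "(2::nat) ^ 3 dvd 2 ^ Suc k" by (intro le_imp_power_dvd) simp
    then have "8 dvd d i" using k by simp
    moreover have "d i > 0" using k by simp
    ultimately show ?thesis using dvd_imp_le by blast
  qed (use k in simp_all)
qed

text \<open>The two lists are mutually exclusive, so that the cardinality determines which of them applies.\<close>

theorem card_HH_classification:
  assumes d': "\<And>i. 1 \<le> i \<Longrightarrow> d' i = d (n + i)" and m: "r = n + m"
  shows "card (HH G) = (if list_of_four n m d' then 4 else if list_of_two n m d' then 2 else 1)"
    and "\<not> (list_of_four n m d' \<and> list_of_two n m d')"
proof -
  have anti: "d' j \<le> d' i" if "1 \<le> i" "i \<le> j" "j \<le> m" for i j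
    using d_anti[of "n + i" "n + j"] d' that m by simp
  have segment: "(\<exists>k. 2 \<le> k \<and> k \<le> m \<and> (\<forall>i\<in>{1..k}. d' i = d' 1) \<and> d' 1 \<ge> 4 \<and> (k < m \<longrightarrow> d' k > d' (k + 1)))
      \<longleftrightarrow> 2 \<le> m \<and> d' 2 = d' 1 \<and> d' 1 \<ge> 4"
    by (rule equal_initial_segment_iff) (rule anti)
  define a b b' where "a = d' 1" and "b = d' 2" and "b' = d' 3"
  have four: "list_of_four n m d' \<longleftrightarrow>
     (n = 0 \<and> 2 \<le> m \<and> 4 < a \<and> b < a \<and> (2 < m \<longrightarrow> b' < b)) \<or>
     (n = 1 \<and> 1 \<le> m \<and> 4 \<le> a \<and> (m = 1 \<or> (1 < m \<and> b < a)))"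
    unfolding list_of_four_def a_def b_def b'_def by (simp only:)
  have two: "list_of_two n m d' \<longleftrightarrow>
     (n = 0 \<and> m = 1 \<and> 4 < a) \<or> (n = 0 \<and> m = 2 \<and> a = 4 \<and> b = 2) \<or>
     (n = 0 \<and> 2 < m \<and> 4 < a \<and> b < a \<and> b = b') \<or>
     (n = 0 \<and> 2 \<le> m \<and> a = b \<and> 4 < b \<and> (2 < m \<longrightarrow> b' < b)) \<or>
     (n = 1 \<and> 2 \<le> m \<and> b = a \<and> 4 \<le> a) \<or> (n = 1 \<and> m = 1 \<and> a = 2) \<or>
     (n = 2 \<and> 1 \<le> m \<and> (1 < m \<longrightarrow> b < a))"
    unfolding list_of_two_def segment a_def b_def b'_def by (rule refl)
  show "\<not> (list_of_four n m d' \<and> list_of_two n m d')" unfolding four two by auto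
  have aD: "D = a" using d'[of 1] by (simp add: a_def)
  have a: "a = 2 \<or> a = 4 \<or> (8 dvd a \<and> 8 \<le> a)" if "1 \<le> m" using d_cases[of t] that m aD by auto
  have b: "b \<le> a" "b = 2 \<or> b = 4 \<or> 8 \<le> b" if "2 \<le> m"
    using anti[of 1 2] d_cases[of "n + 2"] d'[of 2] that m by (auto simp: a_def b_def)
  have b': "b' \<le> b" "b' = 2 \<or> b' = 4 \<or> 8 \<le> b'" if "3 \<le> m"
    using anti[of 2 3] d_cases[of "n + 3"] d'[of 3] that m by (auto simp: b_def b'_def)
  have top: "unique_top \<longleftrightarrow> (2 \<le> m \<longrightarrow> b \<noteq> a)"
  proof -
    have "d (Suc t) = b" using d'[of 2] by (simp add: b_def)
    moreover have "Suc t \<le> r \<longleftrightarrow> 2 \<le> m" using m by linarith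
    ultimately show ?thesis unfolding unique_top_def aD by simp
  qed
  have ut: "2 \<le> m \<longrightarrow> b \<noteq> a" if unique_top using top that by blast
  have nut: "2 \<le> m \<and> b = a" if "\<not> unique_top" using top that by blast
  have b0: "2 \<le> m \<longrightarrow> b \<le> a" using b by blast
  consider "3 \<le> n \<or> m = 0" | "n = 2" "1 \<le> m" | "n = 1" "1 \<le> m" | "n = 0" "1 \<le> m" by linarith
  then show "card (HH G) = (if list_of_four n m d' then 4 else if list_of_two n m d' then 2 else 1)"
  proof cases
    case 1
    then have "3 \<le> n \<or> r = n" using m by auto
    then have K: "card (HH G) = 1" by (rule card_HH_large_rank)
    show ?thesis unfolding four two K using 1 by (elim disjE) simp_all
  next
    case 2
    then have r: "2 < r" using m by simp
    show ?thesis
    proof (cases unique_top)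
      case True
      then show ?thesis unfolding four two card_HH_rank_two_unique[OF 2(1) r True] using 2 ut[OF True] b0 by auto
    next
      case False
      then show ?thesis unfolding four two card_HH_rank_two[OF 2(1) False] using 2 nut[OF False] by auto
    qed
  next
    case 3
    then have r: "1 < r" using m by simp
    have "4 dvd a" if "8 dvd a" using dvd_trans[OF _ that, of 4] by simp
    then have "a = 2 \<or> (4 dvd D \<and> 4 \<le> a)" using a[OF 3(2)] unfolding aD by (elim disjE) auto
    then consider "a = 2" | "4 dvd D" "4 \<le> a" by blast
    then show ?thesis
    proof cases
      case a2: 1
      then have D: "D = 2" using aD by simp
      show ?thesis
      proof (cases unique_top)
        case True
        then have "m = 1" using ut a2 b 3(2) by (cases "2 \<le> m") auto
        then show ?thesis unfolding four two card_HH_rank_one_unique_two[OF 3(1) r True D] using 3 a2 by auto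
      next
        case False
        then show ?thesis unfolding four two card_HH_rank_one_two[OF 3(1) r False D] using 3 nut[OF False] a2 by auto
      qed
    next
      case a4: 2
      show ?thesis
      proof (cases unique_top)
        case True
        then show ?thesis unfolding four two card_HH_rank_one_unique[OF 3(1) r True a4(1)] using 3 ut[OF True] a4(2) b0 by auto
      next
        case False
        then show ?thesis unfolding four two card_HH_rank_one[OF 3(1) r False a4(1)] using 3 nut[OF False] a4(2) by auto
      qed
    qed
  next
    case 4
    then have r: "0 < r" and rm: "r = m" using m by simp_all
    have d23: "d 2 = b" "d 3 = b'" using d'[of 2] d'[of 3] unfolding 4(1) b_def b'_def add_0
      by (simp_all only: one_le_numeral)
    show ?thesis
    proof (cases unique_top)
      case True
      show ?thesis
      proof (cases "2 \<le> r \<and> (3 \<le> r \<longrightarrow> d 3 \<noteq> d 2)")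
        case good: True
        then have g: "2 \<le> r" "3 \<le> r \<longrightarrow> d 3 \<noteq> d 2" by simp_all
        have "2 \<le> m" "3 \<le> m \<longrightarrow> b' \<noteq> b" using g unfolding d23 rm by blast+
        then have bb: "b < a" "3 \<le> m \<longrightarrow> b' < b" using b(1) b'(1) ut[OF True] by linarith+
        from a[OF 4(2)] show ?thesis
        proof (elim disjE)
          assume "a = 2"
          then show ?thesis using bb b g rm by auto
        next
          assume a4: "a = 4"
          then have "card (HH G) = 2" using card_HH_finite_unique_alt[OF 4(1) r True _ g] aD by simp
          moreover have "b = 2" using bb b a4 g rm by auto
          moreover have "m = 2" using bb b' \<open>b = 2\<close> g rm by (cases "3 \<le> m") auto
          ultimately show ?thesis unfolding four two using 4 a4 by auto
        next
          assume a8: "8 dvd a \<and> 8 \<le> a"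
          then have "card (HH G) = 4" using card_HH_finite_unique_four[OF 4(1) r True _ g] aD by simp
          then show ?thesis unfolding four two using 4 a8 bb g rm by auto
        qed
      next
        case bad: False
        then have bb: "m = 1 \<or> (3 \<le> m \<and> b' = b)" using d23 rm 4(2) by auto
        from a[OF 4(2)] show ?thesis
        proof (elim disjE)
          assume "a = 2"
          then have "card (HH G) = 1" using card_HH_finite_unique_one[OF 4(1) r True _ bad] aD by simp
          then show ?thesis unfolding four two using 4 \<open>a = 2\<close> bb by auto
        next
          assume "a = 4"
          then have "card (HH G) = 1" using card_HH_finite_unique_one[OF 4(1) r True _ bad] aD by simp
          then have K: "card (HH G) = 1" .
          show ?thesis unfolding four two K using bb 4(1) \<open>a = 4\<close> by (elim disjE conjE) simp_all
        next
          assume a8: "8 dvd a \<and> 8 \<le> a"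
          then have "card (HH G) = 2" using card_HH_finite_unique_diag[OF 4(1) r True _ bad] aD by simp
          then have K: "card (HH G) = 2" .
          have ba: "3 \<le> m \<longrightarrow> b < a" using ut[OF True] b0 by linarith
          show ?thesis unfolding four two K using bb 4(1) a8 ba by (elim disjE conjE) simp_all
        qed
      qed
    next
      case False
      then have ba: "2 \<le> m" "b = a" using nut by blast+
      then have r2: "2 \<le> r" "d 2 = D" using rm d23 aD by simp_all
      show ?thesis
      proof (cases "3 \<le> r \<and> d 3 = D")
        case True
        then have "card (HH G) = 1" using card_HH_finite_three[OF 4(1)] by simp
        then show ?thesis unfolding four two using 4 ba True d23 aD rm by auto
      next
        case low: False
        then have l3: "3 \<le> r \<longrightarrow> d 3 \<noteq> D" by simp
        then have bb: "3 \<le> m \<longrightarrow> b' < b" using b' ba rm d23 aD by auto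
        from a[OF 4(2)] show ?thesis
        proof (elim disjE)
          assume "a = 2"
          then have "card (HH G) = 1" using card_HH_finite_two_small[OF 4(1) r2 l3] aD by simp
          then show ?thesis unfolding four two using 4 \<open>a = 2\<close> ba by auto
        next
          assume "a = 4"
          then have "card (HH G) = 1" using card_HH_finite_two_small[OF 4(1) r2 l3] aD by simp
          then show ?thesis unfolding four two using 4 \<open>a = 4\<close> ba by auto
        next
          assume a8: "8 dvd a \<and> 8 \<le> a"
          then have "card (HH G) = 2" using card_HH_finite_two_large[OF 4(1) r2 l3] aD by simp
          then show ?thesis unfolding four two using 4 a8 ba bb by auto
        qed
      qed
    qed
  qed
qed

end

theorem theorem4p18:
  fixes G :: "('a, 'b) monoid_scheme"
    and F H :: "'a set"
    and z x :: "nat \<Rightarrow> 'a"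
    and n m :: nat
  assumes G: "comm_group G"
    and subgroups: "subgroup F G" "subgroup H G"
    and G_eq: "(\<lambda>(a, b). a \<otimes>\<^bsub>G\<^esub> b) \<in>
                 iso (subgroup_generated G F \<times>\<times> subgroup_generated G H) G"
    and F_eq: "direct_product_of_cyclics G F {1..n} z"
    and F_torsion_free: "\<forall>a\<in>F. a \<noteq> \<one>\<^bsub>G\<^esub> \<longrightarrow> group.ord G a = 0"
    and F_rank: "\<forall>i\<in>{1..n}. group.ord G (z i) = 0"
    and H_eq: "direct_product_of_cyclics G H {1..m} x"
    and H_2_group: "finite H" "\<exists>k. card H = 2 ^ k"
    and x_decreasing: "\<forall>i j. 1 \<le> i \<and> i \<le> j \<and> j \<le> m \<longrightarrow>
                         group.ord G (x i) \<ge> group.ord G (x j)"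
    and x_nontrivial: "\<forall>i\<in>{1..m}. group.ord G (x i) > 1"
  shows "(list_of_four n m (\<lambda>i. group.ord G (x i)) \<longleftrightarrow> card (HH G) = 4 \<and> order (TT G) = 4) \<and>
         (list_of_two n m (\<lambda>i. group.ord G (x i)) \<longleftrightarrow> card (HH G) = 2 \<and> order (TT G) = 2) \<and>
         (\<not> list_of_four n m (\<lambda>i. group.ord G (x i)) \<and> \<not> list_of_two n m (\<lambda>i. group.ord G (x i))
            \<longrightarrow> card (HH G) = 1 \<and> order (TT G) = 1)"
proof -
  interpret comm_group G by (rule G)
  interpret adapted_basis G n "n + m" "\<lambda>i. if i \<le> n then z i else x (i - n)"
      "\<lambda>i. if i \<le> n then 0 else group.ord G (x (i - n))"
    by (rule adapted_basis_exists[OF G_eq F_eq H_eq F_rank H_2_group x_decreasing x_nontrivial])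
  have d': "group.ord G (x i) = (if n + i \<le> n then 0 else group.ord G (x (n + i - n)))" if "1 \<le> i" for i
    using that by simp
  show ?thesis
    using card_HH_classification[of "\<lambda>i. group.ord G (x i)" m, OF d' refl] card_HH_eq_order_TT
    by (auto split: if_splits)
qed

end
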